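(* A stable submodule $\mathcal J\subset\mathcal P_a$, $\mathcal J\neq\{0\}$, is weakly localisable if and only if it contains a function $\varphi\not\equiv0$ such that $$\mathcal J(\varphi)\subset\mathcal J.$$
   Context: $\omega:[0,\infty)\to[0,\infty)$ is a non-decreasing continuous function such that: $t\mapsto\omega(e^t)$ is convex on $[0,\infty)$; $\omega(x)=o(x)$ and $\ln x=o(\omega(x))$ as $x\to\infty$; for every $\sigma>1$ there is $C>0$ with $\omega(x+y)\le\sigma(\omega(x)+\omega(y))+C$ for all $x,y\ge0$; $\int_1^\infty \omega(x)x^{-2}\,dx<\infty$. Fix $0<a\le+\infty$ and sequences $0<c_k\nearrow a$ with $c_k<a$, $0<r_k\nearrow1$ with $r_k<1$. $P_k$ is the Banach space of entire functions $\varphi$ with $\|\varphi\|_k=\sup_{z\in\mathbb C}|\varphi(z)|e^{-r_k\omega(|z|)-c_k|\mathrm{Im}\,z|}<\infty$, and $\mathcal P_a$ is the locally convex inductive limit of the $P_k$. $\mathcal P_a$ is a topological module over $\mathbb C[z]$; "submodule" means closed $\mathbb C[z]$-submodule. For a submodule $\mathcal J\neq\{0\}$ and $\lambda\in\mathbb C$ let $n_\lambda\ge0$ be the minimal multiplicity of vanishing at $\lambda$ of functions in $\mathcal J$. $\mathcal Z_{\mathcal J}$ is the set of points $\lambda$ with $n_\lambda\ge1$, counted with multiplicity $n_\lambda$. $\mathcal J$ is stable at $\lambda$ if $\varphi/(z-\lambda)\in\mathcal J$ whenever $\varphi\in\mathcal J$ vanishes at $\lambda$ with multiplicity greater than $n_\lambda$;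 $\mathcal J$ is stable if it is stable at every $\lambda\in\mathbb C$. For nonzero $\varphi\in\mathcal P_a$ let $h_\varphi(\theta)=\limsup_{r\to\infty}r^{-1}\ln|\varphi(re^{\mathrm i\theta})|$, $c_\varphi=-h_\varphi(-\pi/2)$, $d_\varphi=h_\varphi(\pi/2)$. The indicator segment of $\mathcal J\ne\{0\}$ is $[c_{\mathcal J};d_{\mathcal J}]\subset\overline{\mathbb R}$, $c_{\mathcal J}=\inf c_\varphi$, $d_{\mathcal J}=\sup d_\varphi$ over nonzero $\varphi\in\mathcal J$. A submodule $\mathcal J\ne\{0\}$ is weakly localisable if it is maximal among all submodules with the same zero set and the same indicator segment; equivalently, $\mathcal J$ contains every nonzero $\psi\in\mathcal P_a$ with $[c_\psi;d_\psi]\subset[c_{\mathcal J};d_{\mathcal J}]$ that vanishes on $\mathcal Z_{\mathcal J}$ (with multiplicities). For $\varphi\in\mathcal P_a$, $\mathcal J(\varphi)$ is the submodule of all $\psi\in\mathcal P_a$ of the form $\psi=\rho\varphi$, where $\rho$ is an entire function of minimal type with respect to order 1, i.e. for every $\varepsilon>0$ there is $C_\varepsilon$ with $|\rho(z)|\le C_\varepsilon e^{\varepsilon|z|}$ for all $z\in\mathbb C$. *)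

theory Defs
  imports "HOL-Complex_Analysis.Complex_Analysis" "HOL-Library.Landau_Symbols"
begin

text \<open>Only the values of the weight on \<open>[0, \<infinity>)\<close> matter.\<close>

definition admissible_weight :: "(real \<Rightarrow> real) \<Rightarrow> bool" where
  "admissible_weight \<omega> \<longleftrightarrow>
     (\<forall>x\<ge>0. 0 \<le> \<omega> x) \<and>
     mono_on {0..} \<omega> \<and>
     continuous_on {0..} \<omega> \<and>
     convex_on {0..} (\<lambda>t. \<omega> (exp t)) \<and>
     \<omega> \<in> o[at_top](\<lambda>x. x) \<and>
     (\<lambda>x. ln x) \<in> o[at_top](\<omega>) \<and>
     (\<forall>\<sigma>>1. \<exists>C>0. \<forall>x\<ge>0. \<forall>y\<ge>0. \<omega> (x + y) \<le> \<sigma> * (\<omega> x + \<omega> y) + C) \<and>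
     set_integrable lborel {1..} (\<lambda>x. \<omega> x / x\<^sup>2)"

definition Pk_quot ::
    "(real \<Rightarrow> real) \<Rightarrow> (nat \<Rightarrow> real) \<Rightarrow> (nat \<Rightarrow> real) \<Rightarrow> nat \<Rightarrow> (complex \<Rightarrow> complex) \<Rightarrow> complex \<Rightarrow> real"
  where "Pk_quot \<omega> r c k \<phi> z = norm (\<phi> z) * exp (- r k * \<omega> (norm z) - c k * \<bar>Im z\<bar>)"

definition Pk ::
    "(real \<Rightarrow> real) \<Rightarrow> (nat \<Rightarrow> real) \<Rightarrow> (nat \<Rightarrow> real) \<Rightarrow> nat \<Rightarrow> (complex \<Rightarrow> complex) set"
  where "Pk \<omega> r c k = {\<phi>. \<phi> holomorphic_on UNIV \<and> bdd_above (range (Pk_quot \<omega> r c k \<phi>))}"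

text \<open>Meaningful on \<open>Pk \<omega> r c k\<close> only.\<close>

definition Pk_norm ::
    "(real \<Rightarrow> real) \<Rightarrow> (nat \<Rightarrow> real) \<Rightarrow> (nat \<Rightarrow> real) \<Rightarrow> nat \<Rightarrow> (complex \<Rightarrow> complex) \<Rightarrow> real"
  where "Pk_norm \<omega> r c k \<phi> = (SUP z. Pk_quot \<omega> r c k \<phi> z)"

definition Pa ::
    "(real \<Rightarrow> real) \<Rightarrow> (nat \<Rightarrow> real) \<Rightarrow> (nat \<Rightarrow> real) \<Rightarrow> (complex \<Rightarrow> complex) set"
  where "Pa \<omega> r c = (\<Union>k. Pk \<omega> r c k)"

text \<open>A base of zero neighbourhoods of the locally convex inductive limit (the finest locally
  convex topology for which all inclusions of the steps are continuous): the absolutely convex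
  sets whose trace on every step is a zero neighbourhood of that step.  Such sets are
  automatically absorbing.\<close>

definition Pa_nhd0 ::
    "(real \<Rightarrow> real) \<Rightarrow> (nat \<Rightarrow> real) \<Rightarrow> (nat \<Rightarrow> real) \<Rightarrow> (complex \<Rightarrow> complex) set \<Rightarrow> bool"
  where "Pa_nhd0 \<omega> r c V \<longleftrightarrow>
     V \<subseteq> Pa \<omega> r c \<and>
     (\<forall>f\<in>V. \<forall>g\<in>V. \<forall>\<alpha> \<beta>. norm \<alpha> + norm \<beta> \<le> 1 \<longrightarrow> (\<lambda>z. \<alpha> * f z + \<beta> * g z) \<in> V) \<and>
     (\<forall>k. \<exists>\<epsilon>>0. \<forall>f\<in>Pk \<omega> r c k. Pk_norm \<omega> r c k f < \<epsilon> \<longrightarrow> f \<in> V)"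

definition Pa_topology ::
    "(real \<Rightarrow> real) \<Rightarrow> (nat \<Rightarrow> real) \<Rightarrow> (nat \<Rightarrow> real) \<Rightarrow> (complex \<Rightarrow> complex) topology"
  where "Pa_topology \<omega> r c = topology (\<lambda>U. U \<subseteq> Pa \<omega> r c \<and>
     (\<forall>f\<in>U. \<exists>V. Pa_nhd0 \<omega> r c V \<and> (\<forall>g\<in>V. (\<lambda>z. f z + g z) \<in> U)))"

lemma Pa_nhd0_Int:
  assumes "Pa_nhd0 \<omega> r c V" "Pa_nhd0 \<omega> r c W"
  shows "Pa_nhd0 \<omega> r c (V \<inter> W)"
proof -
  have "\<exists>\<epsilon>>0. \<forall>f\<in>Pk \<omega> r c k. Pk_norm \<omega> r c k f < \<epsilon> \<longrightarrow> f \<in> V \<inter> W" for k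
  proof -
    obtain d where d: "d > 0" "\<forall>f\<in>Pk \<omega> r c k. Pk_norm \<omega> r c k f < d \<longrightarrow> f \<in> V"
      using assms(1) unfolding Pa_nhd0_def by blast
    obtain e where e: "e > 0" "\<forall>f\<in>Pk \<omega> r c k. Pk_norm \<omega> r c k f < e \<longrightarrow> f \<in> W"
      using assms(2) unfolding Pa_nhd0_def by blast
    show ?thesis using d e by (intro exI[of _ "min d e"]) auto
  qed
  then show ?thesis using assms unfolding Pa_nhd0_def by blast
qed

lemma openin_Pa_topology:
  "openin (Pa_topology \<omega> r c) U \<longleftrightarrow> U \<subseteq> Pa \<omega> r c \<and>
     (\<forall>f\<in>U. \<exists>V. Pa_nhd0 \<omega> r c V \<and> (\<forall>g\<in>V. (\<lambda>z. f z + g z) \<in> U))"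
proof -
  let ?O = "\<lambda>U. U \<subseteq> Pa \<omega> r c \<and>
     (\<forall>f\<in>U. \<exists>V. Pa_nhd0 \<omega> r c V \<and> (\<forall>g\<in>V. (\<lambda>z. f z + g z) \<in> U))"
  have "?O (S \<inter> T)" if ST: "?O S" "?O T" for S T
  proof (intro conjI ballI)
    show "S \<inter> T \<subseteq> Pa \<omega> r c" using ST by blast
    fix f assume f: "f \<in> S \<inter> T"
    obtain V where "Pa_nhd0 \<omega> r c V" "\<forall>g\<in>V. (\<lambda>z. f z + g z) \<in> S"
      using ST(1) f by blast
    moreover obtain W where "Pa_nhd0 \<omega> r c W" "\<forall>g\<in>W. (\<lambda>z. f z + g z) \<in> T"
      using ST(2) f by blast
    ultimately show "\<exists>V. Pa_nhd0 \<omega> r c V \<and> (\<forall>g\<in>V. (\<lambda>z. f z + g z) \<in> S \<inter> T)"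
      using Pa_nhd0_Int by (intro exI[of _ "V \<inter> W"]) blast
  qed
  moreover have "?O (\<Union>\<K>)" if K: "\<forall>K\<in>\<K>. ?O K" for \<K>
  proof (intro conjI ballI)
    show "\<Union>\<K> \<subseteq> Pa \<omega> r c" using K by blast
    fix f assume "f \<in> \<Union>\<K>"
    then obtain K where "K \<in> \<K>" "f \<in> K" by blast
    with K obtain V where "Pa_nhd0 \<omega> r c V" "\<forall>g\<in>V. (\<lambda>z. f z + g z) \<in> K" by blast
    with \<open>K \<in> \<K>\<close> show "\<exists>V. Pa_nhd0 \<omega> r c V \<and> (\<forall>g\<in>V. (\<lambda>z. f z + g z) \<in> \<Union>\<K>)" by blast
  qed
  ultimately have "istopology ?O" unfolding istopology_def by simp
  then show ?thesis unfolding Pa_topology_def by (simp add: topology_inverse')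
qed

lemma Pk_mono:
  assumes "\<forall>x\<ge>0. 0 \<le> \<omega> x" "incseq r" "incseq c" "j \<le> k"
  shows "Pk \<omega> r c j \<subseteq> Pk \<omega> r c k"
proof
  fix f assume f: "f \<in> Pk \<omega> r c j"
  then obtain M where M: "\<And>z. Pk_quot \<omega> r c j f z \<le> M"
    unfolding Pk_def bdd_above_def by auto
  have "Pk_quot \<omega> r c k f z \<le> M" for z
  proof -
    have "r j * \<omega> (norm z) \<le> r k * \<omega> (norm z)" "c j * \<bar>Im z\<bar> \<le> c k * \<bar>Im z\<bar>"
      using assms by (auto intro!: mult_right_mono simp: incseq_def)
    then have "Pk_quot \<omega> r c k f z \<le> Pk_quot \<omega> r c j f z"
      unfolding Pk_quot_def by (intro mult_left_mono) auto
    with M[of z] show ?thesis by linarith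
  qed
  then show "f \<in> Pk \<omega> r c k" using f unfolding Pk_def by (auto intro!: bdd_aboveI2)
qed

lemma Pa_add:
  assumes "\<forall>x\<ge>0. 0 \<le> \<omega> x" "incseq r" "incseq c" "f \<in> Pa \<omega> r c" "g \<in> Pa \<omega> r c"
  shows "(\<lambda>z. f z + g z) \<in> Pa \<omega> r c"
proof -
  obtain i j where "f \<in> Pk \<omega> r c i" "g \<in> Pk \<omega> r c j" using assms unfolding Pa_def by blast
  then have fg: "f \<in> Pk \<omega> r c (max i j)" "g \<in> Pk \<omega> r c (max i j)"
    using Pk_mono[OF assms(1-3)] by (meson max.cobounded1 max.cobounded2 subsetD)+
  obtain M where M: "\<And>z. Pk_quot \<omega> r c (max i j) f z \<le> M"
    using fg unfolding Pk_def bdd_above_def by auto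
  obtain N where N: "\<And>z. Pk_quot \<omega> r c (max i j) g z \<le> N"
    using fg unfolding Pk_def bdd_above_def by auto
  have "Pk_quot \<omega> r c (max i j) (\<lambda>z. f z + g z) z \<le> M + N" for z
  proof -
    have "Pk_quot \<omega> r c (max i j) (\<lambda>z. f z + g z) z
        \<le> Pk_quot \<omega> r c (max i j) f z + Pk_quot \<omega> r c (max i j) g z"
      unfolding Pk_quot_def distrib_right[symmetric]
      by (intro mult_right_mono norm_triangle_ineq) auto
    with M[of z] N[of z] show ?thesis by linarith
  qed
  then have "(\<lambda>z. f z + g z) \<in> Pk \<omega> r c (max i j)"
    using fg unfolding Pk_def by (auto intro!: bdd_aboveI2 holomorphic_intros)
  then show ?thesis unfolding Pa_def by blast
qed

lemma topspace_Pa_topology: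
  assumes "\<forall>x\<ge>0. 0 \<le> \<omega> x" "incseq r" "incseq c"
  shows "topspace (Pa_topology \<omega> r c) = Pa \<omega> r c"
proof -
  have "Pa_nhd0 \<omega> r c (Pa \<omega> r c)"
  proof -
    have sc: "(\<lambda>z. \<alpha> * f z) \<in> Pa \<omega> r c" if f: "f \<in> Pa \<omega> r c" for f \<alpha>
    proof -
      obtain k where k: "f \<in> Pk \<omega> r c k" using f unfolding Pa_def by blast
      then obtain M where M: "\<And>z. Pk_quot \<omega> r c k f z \<le> M"
        unfolding Pk_def bdd_above_def by auto
      have "Pk_quot \<omega> r c k (\<lambda>z. \<alpha> * f z) z \<le> norm \<alpha> * M" for z
        using mult_left_mono[OF M[of z], of "norm \<alpha>"]
        by (simp add: Pk_quot_def norm_mult mult.assoc)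
      then have "(\<lambda>z. \<alpha> * f z) \<in> Pk \<omega> r c k"
        using k unfolding Pk_def by (auto intro!: bdd_aboveI2 holomorphic_intros)
      then show ?thesis unfolding Pa_def by blast
    qed
    have "\<exists>\<epsilon>>0. \<forall>f\<in>Pk \<omega> r c k. Pk_norm \<omega> r c k f < \<epsilon> \<longrightarrow> f \<in> Pa \<omega> r c" for k
      by (intro exI[of _ 1]) (auto simp: Pa_def)
    then show ?thesis unfolding Pa_nhd0_def
      by (auto intro!: Pa_add[OF assms] sc)
  qed
  then have "openin (Pa_topology \<omega> r c) (Pa \<omega> r c)"
    unfolding openin_Pa_topology using Pa_add[OF assms] by blast
  moreover have "topspace (Pa_topology \<omega> r c) \<subseteq> Pa \<omega> r c"
    using openin_topspace[of "Pa_topology \<omega> r c"] unfolding openin_Pa_topology by blast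
  ultimately show ?thesis by (simp add: openin_subset subset_antisym)
qed

definition closed_submodule ::
    "(real \<Rightarrow> real) \<Rightarrow> (nat \<Rightarrow> real) \<Rightarrow> (nat \<Rightarrow> real) \<Rightarrow> (complex \<Rightarrow> complex) set \<Rightarrow> bool"
  where "closed_submodule \<omega> r c J \<longleftrightarrow>
     (\<lambda>z. 0) \<in> J \<and>
     (\<forall>f\<in>J. \<forall>g\<in>J. (\<lambda>z. f z + g z) \<in> J) \<and>
     (\<forall>p. \<forall>f\<in>J. (\<lambda>z. poly p z * f z) \<in> J) \<and>
     closedin (Pa_topology \<omega> r c) J"

text \<open>The multiplicity \<open>n\<^sub>\<lambda>\<close>; the zero function has infinite multiplicity and does not affect the
  minimum.  The function \<open>zero_mult J\<close> encodes the zero set of \<open>J\<close> with multiplicities.\<close>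

definition zero_mult :: "(complex \<Rightarrow> complex) set \<Rightarrow> complex \<Rightarrow> nat" where
  "zero_mult J \<mu> = (INF \<phi>\<in>J - {\<lambda>z. 0}. nat (zorder \<phi> \<mu>))"

text \<open>The value at \<open>\<mu>\<close> fills in the removable singularity when \<open>\<phi> \<mu> = 0\<close>.\<close>

definition divide_root :: "complex \<Rightarrow> (complex \<Rightarrow> complex) \<Rightarrow> complex \<Rightarrow> complex" where
  "divide_root \<mu> \<phi> z = (if z = \<mu> then deriv \<phi> \<mu> else \<phi> z / (z - \<mu>))"

definition stable_at :: "(complex \<Rightarrow> complex) set \<Rightarrow> complex \<Rightarrow> bool" where
  "stable_at J \<mu> \<longleftrightarrow>
     (\<forall>\<phi>\<in>J - {\<lambda>z. 0}. zorder \<phi> \<mu> > int (zero_mult J \<mu>) \<longrightarrow> divide_root \<mu> \<phi> \<in> J)"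

definition stable_submodule :: "(complex \<Rightarrow> complex) set \<Rightarrow> bool" where
  "stable_submodule J \<longleftrightarrow> (\<forall>\<mu>. stable_at J \<mu>)"

text \<open>Since \<open>ln 0 = 0\<close> in HOL, zeros of \<open>\<phi>\<close> on the ray are given the value \<open>-\<infinity>\<close> explicitly.\<close>

definition indicator_fun :: "(complex \<Rightarrow> complex) \<Rightarrow> real \<Rightarrow> ereal" where
  "indicator_fun \<phi> \<theta> = Limsup at_top (\<lambda>t::real.
     if \<phi> (of_real t * cis \<theta>) = 0 then -\<infinity>
     else ereal (ln (norm (\<phi> (of_real t * cis \<theta>))) / t))"

definition ind_lower :: "(complex \<Rightarrow> complex) set \<Rightarrow> ereal" where
  "ind_lower J = (INF \<phi>\<in>J - {\<lambda>z. 0}. - indicator_fun \<phi> (- pi / 2))"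

definition ind_upper :: "(complex \<Rightarrow> complex) set \<Rightarrow> ereal" where
  "ind_upper J = (SUP \<phi>\<in>J - {\<lambda>z. 0}. indicator_fun \<phi> (pi / 2))"

definition weakly_localisable ::
    "(real \<Rightarrow> real) \<Rightarrow> (nat \<Rightarrow> real) \<Rightarrow> (nat \<Rightarrow> real) \<Rightarrow> (complex \<Rightarrow> complex) set \<Rightarrow> bool"
  where "weakly_localisable \<omega> r c J \<longleftrightarrow>
     closed_submodule \<omega> r c J \<and> J \<noteq> {\<lambda>z. 0} \<and>
     (\<forall>K. closed_submodule \<omega> r c K \<and> K \<noteq> {\<lambda>z. 0} \<and>
          zero_mult K = zero_mult J \<and> ind_lower K = ind_lower J \<and> ind_upper K = ind_upper J \<and>
          J \<subseteq> K \<longrightarrow> K = J)"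

definition minimal_type :: "(complex \<Rightarrow> complex) \<Rightarrow> bool" where
  "minimal_type \<rho> \<longleftrightarrow> \<rho> holomorphic_on UNIV \<and>
     (\<forall>\<epsilon>>0. \<exists>C. \<forall>z. norm (\<rho> z) \<le> C * exp (\<epsilon> * norm z))"

definition J_gen ::
    "(real \<Rightarrow> real) \<Rightarrow> (nat \<Rightarrow> real) \<Rightarrow> (nat \<Rightarrow> real) \<Rightarrow> (complex \<Rightarrow> complex) \<Rightarrow> (complex \<Rightarrow> complex) set"
  where "J_gen \<omega> r c \<phi> = {\<psi> \<in> Pa \<omega> r c. \<exists>\<rho>. minimal_type \<rho> \<and> \<psi> = (\<lambda>z. \<rho> z * \<phi> z)}"

end

theory Submission
  imports Defs
begin

text \<open>Suppose first that \<open>J\<close> is weakly localisable.  Let \<open>K\<close> consist of all functions of the inductive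
  limit that vanish on the zero set of \<open>J\<close> and whose indicator segment lies in that of \<open>J\<close>.  Then \<open>K\<close>
  contains \<open>J\<close> and those products \<open>\<rho> * \<phi>\<close> with \<open>\<phi> \<in> J\<close> and \<open>\<rho>\<close> of minimal type that belong to the
  inductive limit, and it has the zero set and the indicator segment of \<open>J\<close>.  So it suffices that \<open>K\<close> is closed.  A set is closed in the
  inductive limit if it contains the limits of those of its sequences that are bounded in one step and
  converge locally uniformly (\<open>closedin_Pa_if_sequentially_closed\<close>).  The bound on the indicator
  passes to such limits because of the Phragmen--Lindelof principle: since \<open>\<integral> \<omega>(x) / x\<^sup>2\<close> converges,
  there is a holomorphic function \<open>F\<close> in the half-plane whose real part dominates the weight up to
  constants and is \<open>o(y)\<close> on the imaginary axis, and a function with indicator at most \<open>d\<close> satisfies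
  \<open>\<bar>f z\<bar> \<le> M * exp (d * Im z + 4 * Re (F (- \<i> * z)))\<close> with \<open>M\<close> depending only on the
  weight and the norm of \<open>f\<close> (\<open>majorized_in_upper_half_plane\<close>).

  For the converse let \<open>\<phi> \<in> J\<close> be nonzero with \<open>J(\<phi>) \<subseteq> J\<close>, let \<open>\<psi> \<in> K\<close>, and suppose that
  \<open>\<psi> \<notin> J\<close>.  The Hahn--Banach theorem yields a continuous functional \<open>S\<close> with \<open>S = 0\<close> on \<open>J\<close> and
  \<open>S \<psi> \<noteq> 0\<close>.  For \<open>f \<in> J\<close> let \<open>\<Phi> f \<psi> l\<close> be the value of \<open>S\<close> at the function
  \<open>z \<mapsto> (f l * \<psi> z - \<psi> l * f z) / (z - l)\<close>.  This is an entire function of \<open>l\<close> which lies in the same step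
  as \<open>f\<close> and \<open>\<psi>\<close>, with a bilinear norm estimate (\<open>\<Phi>_Pk\<close>).  Stability gives \<open>\<Phi> f g = 0\<close> for
  \<open>f, g \<in> J\<close> (\<open>\<Phi>_eq_0\<close>), and it follows that \<open>\<Phi> f \<psi> = \<theta> * f\<close> with an entire function \<open>\<theta>\<close> that does
  not depend on \<open>f \<in> J\<close> (\<open>exists_quotient\<close>).

  The function \<open>\<theta>\<close> is of minimal type (\<open>quotient_minimal_type\<close>): the indicator of \<open>\<theta> * f\<close> at \<open>\<plusminus>\<pi>/2\<close>
  is at most the maximum of those of \<open>f\<close> and \<open>\<psi>\<close>, and \<open>f \<in> J\<close> can be chosen such that its indicator
  at \<open>\<pi>/2\<close>, or at \<open>-\<pi>/2\<close>, nearly reaches that of \<open>\<psi>\<close>.  To divide the estimates without any theory of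
  regular growth, zeros are removed by Blaschke products, and Harnack's inequality in large discs
  touching the real axis transports a lower bound for \<open>f\<close> from a single point to all larger
  distances (\<open>norm_quotient_le\<close>, \<open>quotient_in_upper_sector\<close>).

  Now \<open>\<theta> * \<phi> = \<Phi> \<phi> \<psi>\<close> lies in \<open>J(\<phi>) \<subseteq> J\<close>, so \<open>\<theta>\<^sup>2 * \<phi> = \<Phi> (\<theta> * \<phi>) \<psi>\<close> lies in \<open>J(\<phi>) \<subseteq> J\<close> as well,
  and so on.  All \<open>\<theta> ^ n * \<phi>\<close> belong to one step, and their norms are at most \<open>A ^ n\<close> times the
  norm of \<open>\<phi>\<close>.  Hence \<open>\<bar>\<theta>\<bar> \<le> A\<close> outside the zeros of \<open>\<phi>\<close>, and \<open>\<theta>\<close> is constant by Liouville's theorem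
  (\<open>quotient_constant\<close>).  This applies to \<open>z * \<psi>\<close> too, whose quotient is \<open>z * \<theta> + S \<psi>\<close>; therefore
  \<open>\<theta> = 0\<close> for every \<open>\<psi> \<in> K\<close>, and the quotient of \<open>z * \<psi>\<close> shows \<open>S \<psi> = 0\<close>, a contradiction.\<close>

section \<open>The Phragmen--Lindelof principle\<close>

lemma exp_eventually_le:
  fixes C M e :: real
  assumes "0 < M" "0 < e"
  shows "\<exists>R0. \<forall>R\<ge>R0. C * exp (C * R - e * (R * sqrt R)) \<le> M"
proof -
  define K where "K = max C 1"
  have K: "C \<le> K" "1 \<le> K" by (auto simp: K_def)
  define R0 where "R0 = max (((K + 1) / e)\<^sup>2) (max 1 (K / M))"
  have "C * exp (C * R - e * (R * sqrt R)) \<le> M" if R: "R0 \<le> R" for R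
  proof -
    have R1: "1 \<le> R" "K / M \<le> R" "((K + 1) / e)\<^sup>2 \<le> R" using R by (auto simp: R0_def)
    have "(K + 1) / e \<le> sqrt R" using R1(3) real_le_rsqrt by blast
    then have "K + 1 \<le> e * sqrt R" using assms by (simp add: field_simps)
    then have "(K + 1) * R \<le> e * sqrt R * R" using R1 by (intro mult_right_mono) auto
    moreover have "C * R \<le> K * R" using K R1 by (intro mult_right_mono) auto
    ultimately have "C * R - e * (R * sqrt R) \<le> - R" by (simp add: algebra_simps)
    then have "C * exp (C * R - e * (R * sqrt R)) \<le> K * exp (- R)"
      using K by (intro mult_mono) auto
    also have "\<dots> \<le> K * inverse R"
    proof -
      have "R \<le> exp R" using exp_ge_add_one_self[of R] by linarith
      then have "inverse (exp R) \<le> inverse R" using R1 by (intro le_imp_inverse_le) auto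
      then show ?thesis using K by (intro mult_left_mono) (auto simp: exp_minus)
    qed
    also have "\<dots> \<le> M" using R1 assms by (simp add: field_simps)
    finally show ?thesis .
  qed
  then show ?thesis by blast
qed

text \<open>On the sector \<open>\<bar>arg z\<bar> \<le> \<pi>/4\<close> the real part of \<open>z powr (3/2)\<close> is comparable to its modulus.\<close>

lemma Re_three_halves_power_ge:
  assumes "\<bar>Im z\<bar> \<le> Re z"
  shows "norm z * sqrt (norm z) / 4 \<le> Re (z * csqrt z)"
proof -
  define s where "s = csqrt z"
  define a b where "a = Re s" and "b = Im s"
  have z: "z = s\<^sup>2" by (simp add: s_def)
  have a0: "0 \<le> a" using csqrt_principal[of z] by (auto simp: s_def a_def)
  have Rez: "Re z = a\<^sup>2 - b\<^sup>2" and Imz: "Im z = 2 * a * b"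
    by (simp_all add: z a_def b_def power2_eq_square)
  \<comment> \<open>the sector condition forces \<open>5 * b\<^sup>2 \<le> a\<^sup>2\<close>, since \<open>tan (\<pi>/8)\<^sup>2 < 1/5\<close>\<close>
  define A B where "A = a\<^sup>2" and "B = b\<^sup>2"
  have AB0: "0 \<le> A" "0 \<le> B" "B \<le> A" using assms Rez by (auto simp: A_def B_def)
  have "(Im z)\<^sup>2 \<le> (Re z)\<^sup>2" using assms by (simp add: abs_le_square_iff[symmetric])
  then have le: "4 * A * B \<le> (A - B)\<^sup>2"
    by (simp add: Rez Imz A_def B_def power_mult_distrib)
  have B5: "5 * B \<le> A"
  proof (rule ccontr)
    assume "\<not> 5 * B \<le> A"
    then have gt: "A < 5 * B" by simp
    have Apos: "0 < A" using gt AB0 by linarith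
    have "A * A < A * (5 * B)" using gt Apos by simp
    moreover have "(A - B)\<^sup>2 \<le> (4 * A / 5)\<^sup>2" using gt AB0 by (intro power_mono) auto
    moreover have "0 < A * A" using Apos by simp
    ultimately show False using le by (simp add: power2_eq_square)
  qed
  have ns: "(norm s)\<^sup>2 = A + B" by (simp add: cmod_power2 A_def B_def a_def b_def)
  have nz: "norm z = (norm s)\<^sup>2" by (simp add: z norm_power)
  have "norm s \<le> 5 / 4 * a"
  proof (rule power2_le_imp_le)
    show "(norm s)\<^sup>2 \<le> (5 / 4 * a)\<^sup>2"
      using B5 AB0 unfolding ns power_mult_distrib A_def[symmetric] by (simp add: power2_eq_square)
  qed (use a0 in simp)
  moreover have "(A + B) / 3 \<le> A - 3 * B" using B5 by (simp add: field_simps)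
  ultimately have "(4 / 5 * norm s) * ((norm s)\<^sup>2 / 3) \<le> a * (A - 3 * B)"
    unfolding ns using a0 AB0 by (intro mult_mono) auto
  moreover have "Re (z * csqrt z) = a * (A - 3 * B)"
    unfolding s_def[symmetric] by (simp add: z a_def b_def A_def B_def power2_eq_square algebra_simps)
  moreover have "norm z * sqrt (norm z) / 4 \<le> (4 / 5 * norm s) * ((norm s)\<^sup>2 / 3)"
    by (simp add: nz power2_eq_square)
  ultimately show ?thesis by linarith
qed

lemma frontier_subset_closed:
  fixes S :: "complex set"
  assumes "closed S" "open U" "U \<subseteq> S"
  shows "frontier S \<subseteq> S - U"
  using assms interior_maximal[of U S] by (auto simp: frontier_def)

lemma Phragmen_Lindelof_sector:
  assumes hol: "f holomorphic_on {z. \<bar>Im z\<bar> < Re z}"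
    and cont: "continuous_on {z. \<bar>Im z\<bar> \<le> Re z} f"
    and growth: "\<And>z. \<bar>Im z\<bar> \<le> Re z \<Longrightarrow> norm (f z) \<le> C * exp (C * norm z)"
    and bound: "\<And>z. \<bar>Im z\<bar> = Re z \<Longrightarrow> norm (f z) \<le> M"
    and M: "0 < M" and z0: "\<bar>Im z0\<bar> \<le> Re z0"
  shows "norm (f z0) \<le> M"
proof -
  have est: "norm (f z0) * exp (- e * Re ((1 + z0) * csqrt (1 + z0))) \<le> M" if e: "0 < e" for e
  proof -
    \<comment> \<open>The order \<open>3/2\<close> of the damping factor exceeds the order \<open>1\<close> of growth and is less than the
      order \<open>2\<close> belonging to a right angle; the shift by \<open>1\<close> avoids the branch point.\<close>
    define g where "g = (\<lambda>z. f z * exp (- of_real e * ((1 + z) * csqrt (1 + z))))"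
    have ng: "norm (g z) = norm (f z) * exp (- e * Re ((1 + z) * csqrt (1 + z)))" for z
      by (simp add: g_def norm_mult)
    obtain R0 where R0: "\<And>R. R \<ge> R0 \<Longrightarrow> C * exp (C * R - e / 4 * (R * sqrt R)) \<le> M"
      using exp_eventually_le[OF M, of "e / 4" C] e by auto
    define R where "R = max R0 (max (norm z0 + 1) 1)"
    have "norm z0 + 1 \<le> R" "1 \<le> R" "R0 \<le> R" by (simp_all add: R_def le_max_iff_disj)
    then have R: "R0 \<le> R" "norm z0 < R" "0 < R" by linarith+
    define S where "S = {z. \<bar>Im z\<bar> \<le> Re z} \<inter> cball 0 R"
    define U where "U = {z. \<bar>Im z\<bar> < Re z} \<inter> ball 0 R"
    have clS: "closed S" unfolding S_def
      by (intro closed_Int closed_Collect_le closed_cball continuous_intros)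
    have opU: "open U" unfolding U_def
      by (intro open_Int open_Collect_less open_ball continuous_intros)
    have US: "U \<subseteq> S" by (auto simp: U_def S_def)
    have fr: "frontier S \<subseteq> S - U" by (rule frontier_subset_closed[OF clS opU US])
    have intS: "interior S \<subseteq> {z. \<bar>Im z\<bar> < Re z}"
    proof
      fix z assume "z \<in> interior S"
      then obtain d where d: "0 < d" "ball z d \<subseteq> S" by (meson mem_interior)
      have "z - of_real (d/2) \<in> ball z d" using d by (simp add: dist_norm)
      then have "z - of_real (d/2) \<in> S" using d(2) by blast
      then have "\<bar>Im z\<bar> \<le> Re z - d / 2" by (auto simp: S_def)
      then show "z \<in> {z. \<bar>Im z\<bar> < Re z}" using d by simp
    qed
    have nn: "1 + z \<notin> \<real>\<^sub>\<le>\<^sub>0" if "\<bar>Im z\<bar> \<le> Re z" for z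
      using that by (auto simp: complex_nonpos_Reals_iff)
    have "norm (g z0) \<le> M"
    proof (rule maximum_modulus_frontier[where S = S and f = g and \<xi> = z0])
      have holS: "f holomorphic_on interior S" by (rule holomorphic_on_subset[OF hol intS])
      have nnS: "1 + z \<notin> \<real>\<^sub>\<le>\<^sub>0" if "z \<in> interior S" for z
        using nn[of z] intS that by force
      show "g holomorphic_on interior S" unfolding g_def
        by (intro holomorphic_intros holS nnS)
      have "continuous_on {z. \<bar>Im z\<bar> \<le> Re z} g" unfolding g_def
        using nn by (intro continuous_intros cont continuous_on_compose2[OF continuous_on_csqrt]) auto
      then show "continuous_on (closure S) g"
        using clS by (auto simp: S_def intro: continuous_on_subset)
      show "bounded S" by (auto simp: S_def)
      show "z0 \<in> S" using z0 R by (auto simp: S_def)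
      fix z assume "z \<in> frontier S"
      then have z: "z \<in> S" "z \<notin> U" using fr by auto
      then have zc: "\<bar>Im z\<bar> \<le> Re z" "norm z \<le> R" by (auto simp: S_def)
      have 1: "norm (1 + z) * sqrt (norm (1 + z)) / 4 \<le> Re ((1 + z) * csqrt (1 + z))"
        using zc by (intro Re_three_halves_power_ge) auto
      have "0 \<le> norm (1 + z) * sqrt (norm (1 + z)) / 4" by simp
      then have pos: "0 \<le> Re ((1 + z) * csqrt (1 + z))" using 1 by linarith
      consider "\<bar>Im z\<bar> = Re z" | "norm z = R" using z zc by (force simp: U_def)
      then show "norm (g z) \<le> M"
      proof cases
        case 1
        have "norm (f z) * exp (- e * Re ((1 + z) * csqrt (1 + z))) \<le> M * 1"
          using bound[OF 1] pos e M by (intro mult_mono) (auto intro: mult_nonneg_nonneg simp del: times_complex.sel)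
        then show ?thesis by (simp add: ng)
      next
        case 2
        have "norm z \<le> norm (1 + z)"
          using zc by (simp add: cmod_def power2_eq_square algebra_simps)
        then have "R * sqrt R \<le> norm (1 + z) * sqrt (norm (1 + z))"
          using 2 R by (intro mult_mono) auto
        then have "R * sqrt R / 4 \<le> Re ((1 + z) * csqrt (1 + z))" using 1 by linarith
        then have "e * (R * sqrt R / 4) \<le> e * Re ((1 + z) * csqrt (1 + z))"
          using e by (intro mult_left_mono) auto
        then have ex: "exp (- e * Re ((1 + z) * csqrt (1 + z))) \<le> exp (- (e / 4 * (R * sqrt R)))" 
          by (simp del: times_complex.sel)
        have gr: "norm (f z) \<le> C * exp (C * R)" using growth[OF zc(1)] 2 by simp
        have "norm (g z) \<le> (C * exp (C * R)) * exp (- (e / 4 * (R * sqrt R)))"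
          unfolding ng by (rule mult_mono[OF gr ex order_trans[OF norm_ge_zero gr] exp_ge_zero])
        also have "\<dots> = C * exp (C * R - e / 4 * (R * sqrt R))"
          unfolding mult.assoc[of C] mult_exp_exp diff_conv_add_uminus ..
        also have "\<dots> \<le> M" using R0 R by blast
        finally show ?thesis .
      qed
    qed
    then show ?thesis by (simp add: ng)
  qed
  have "((\<lambda>e. norm (f z0) * exp (- e * Re ((1 + z0) * csqrt (1 + z0)))) \<longlongrightarrow>
      norm (f z0) * exp (- 0 * Re ((1 + z0) * csqrt (1 + z0)))) (at_right 0)"
    by (intro tendsto_intros)
  then have "norm (f z0) * exp (- 0 * Re ((1 + z0) * csqrt (1 + z0))) \<le> M"
    using est
    by (intro tendsto_upperbound[of _ _ "at_right (0::real)"])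
       (auto simp: eventually_at_right[of 0 1] intro!: exI[of _ 1] simp del: times_complex.sel)
  then show ?thesis by simp
qed

lemma Phragmen_Lindelof_bounded:
  assumes hol: "f holomorphic_on {z. 0 < Re z}"
    and cont: "continuous_on {z. 0 \<le> Re z} f"
    and bdd: "\<And>z. 0 \<le> Re z \<Longrightarrow> norm (f z) \<le> C"
    and bound: "\<And>z. Re z = 0 \<Longrightarrow> norm (f z) \<le> M"
    and M: "0 < M" and z0: "0 \<le> Re z0"
  shows "norm (f z0) \<le> M"
proof -
  have C0: "0 \<le> C" using bdd[OF z0] norm_ge_zero order_trans by blast
  have est: "norm (f z0) / norm (1 + of_real e * z0) \<le> M" if e: "0 < e" for e
  proof -
    define g where "g = (\<lambda>z. f z / (1 + of_real e * z))"
    define R where "R = norm z0 + C / (e * M) + 1"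
    have eM: "0 < e * M" using e M by simp
    then have "0 \<le> C / (e * M)" using C0 by simp
    then have R: "norm z0 < R" "0 < R" "C / (e * M) \<le> R"
      using norm_ge_zero[of z0] unfolding R_def by linarith+
    then have CR: "C \<le> M * (e * R)" using eM by (simp add: field_simps)
    define S where "S = {z. 0 \<le> Re z} \<inter> cball 0 R"
    define U where "U = {z. 0 < Re z} \<inter> ball 0 R"
    have clS: "closed S" unfolding S_def
      by (intro closed_Int closed_Collect_le closed_cball continuous_intros)
    have opU: "open U" unfolding U_def
      by (intro open_Int open_Collect_less open_ball continuous_intros)
    have US: "U \<subseteq> S" by (auto simp: U_def S_def)
    have fr: "frontier S \<subseteq> S - U" by (rule frontier_subset_closed[OF clS opU US])
    have intS: "interior S \<subseteq> {z. 0 < Re z}"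
    proof
      fix z assume "z \<in> interior S"
      then obtain d where d: "0 < d" "ball z d \<subseteq> S" by (meson mem_interior)
      have "z - of_real (d/2) \<in> ball z d" using d by (simp add: dist_norm)
      then have "z - of_real (d/2) \<in> S" using d(2) by blast
      then have "0 \<le> Re z - d / 2" by (auto simp: S_def)
      then show "z \<in> {z. 0 < Re z}" using d by simp
    qed
    have Re1: "1 \<le> Re (1 + of_real e * z)" if "0 \<le> Re z" for z using that e by simp
    have nz: "1 + complex_of_real e * z \<noteq> 0" if "0 \<le> Re z" for z
    proof
      assume "1 + complex_of_real e * z = 0"
      then show False using Re1[OF that] by simp
    qed
    have "norm (g z0) \<le> M"
    proof (rule maximum_modulus_frontier[where S = S and f = g and \<xi> = z0])
      have holS: "f holomorphic_on interior S" by (rule holomorphic_on_subset[OF hol intS])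
      have nzS: "1 + complex_of_real e * z \<noteq> 0" if "z \<in> interior S" for z
        using nz[of z] intS that by force
      show "g holomorphic_on interior S" unfolding g_def
        by (intro holomorphic_intros holS) (use nzS in auto)
      have "continuous_on {z. 0 \<le> Re z} g" unfolding g_def
        using nz by (intro continuous_intros cont) auto
      then show "continuous_on (closure S) g"
        using clS by (auto simp: S_def intro: continuous_on_subset)
      show "bounded S" by (auto simp: S_def)
      show "z0 \<in> S" using z0 R by (auto simp: S_def)
      fix z assume "z \<in> frontier S"
      then have z: "z \<in> S" "z \<notin> U" using fr by auto
      then have zc: "0 \<le> Re z" "norm z \<le> R" by (auto simp: S_def)
      consider "Re z = 0" | "norm z = R" using z zc by (force simp: U_def)
      then show "norm (g z) \<le> M"
      proof cases
        case 1
        have "1 \<le> norm (1 + of_real e * z)" using Re1[OF zc(1)] complex_Re_le_cmod order_trans by blast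
        then have "norm (g z) \<le> norm (f z) / 1" unfolding g_def norm_divide
          by (intro divide_left_mono) auto
        also have "\<dots> \<le> M" using bound[OF 1] by simp
        finally show ?thesis .
      next
        case 2
        have "(e * R)\<^sup>2 \<le> (norm (1 + of_real e * z))\<^sup>2"
        proof -
          have "(e * R)\<^sup>2 = (e * Re z)\<^sup>2 + (e * Im z)\<^sup>2"
            using cmod_power2[of z] 2 by (simp add: power_mult_distrib distrib_left)
          also have "\<dots> \<le> (1 + e * Re z)\<^sup>2 + (e * Im z)\<^sup>2"
            using zc e by (intro add_right_mono power_mono) auto
          also have "\<dots> = (norm (1 + of_real e * z))\<^sup>2" by (simp add: cmod_power2)
          finally show ?thesis .
        qed
        then have "e * R \<le> norm (1 + of_real e * z)" by (rule power2_le_imp_le) simp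
        then have "norm (g z) \<le> C / (e * R)" unfolding g_def norm_divide
          using bdd[OF zc(1)] e R C0 by (intro frac_le) auto
        also have "\<dots> \<le> M" using CR R e by (simp add: field_simps)
        finally show ?thesis .
      qed
    qed
    then show ?thesis by (simp add: g_def norm_divide)
  qed
  have "((\<lambda>e. norm (f z0) / norm (1 + of_real e * z0)) \<longlongrightarrow> norm (f z0) / norm (1 + of_real 0 * z0)) (at_right 0)"
    by (intro tendsto_intros) auto
  then have "norm (f z0) / norm (1 + of_real 0 * z0) \<le> M"
    using est
    by (intro tendsto_upperbound[of _ _ "at_right (0::real)"])
       (auto simp: eventually_at_right[of 0 1] intro!: exI[of _ 1])
  then show ?thesis by simp
qed

text \<open>Each quadrant is a rotated copy of the sector, which gives boundedness in the half-plane; the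
  bound on the ray then disappears from the conclusion.\<close>

lemma Phragmen_Lindelof_half_plane:
  assumes hol: "f holomorphic_on {z. 0 < Re z}"
    and cont: "continuous_on {z. 0 \<le> Re z} f"
    and growth: "\<And>z. 0 \<le> Re z \<Longrightarrow> norm (f z) \<le> C * exp (C * norm z)"
    and ray: "\<And>x. 0 \<le> x \<Longrightarrow> norm (f (of_real x)) \<le> B"
    and bound: "\<And>z. Re z = 0 \<Longrightarrow> norm (f z) \<le> M"
    and M: "0 < M" and z0: "0 \<le> Re z0"
  shows "norm (f z0) \<le> M"
proof -
  define N where "N = max B M"
  have N: "0 < N" "B \<le> N" "M \<le> N" using M by (auto simp: N_def)
  define k where "k = 1 / sqrt 2"
  have k: "0 < k" "k * k = 1 / 2" by (simp_all add: k_def)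
  have quad: "norm (f (u * z)) \<le> N"
    if u: "u = Complex k (t * k)" and t: "t = 1 \<or> t = -1" and z: "\<bar>Im z\<bar> \<le> Re z" for u z t
  proof (rule Phragmen_Lindelof_sector[where f = "\<lambda>z. f (u * z)"])
    have "(norm u)\<^sup>2 = 1" using u t k unfolding cmod_power2 by (auto simp: power2_eq_square)
    then have nu: "norm u = 1" using norm_ge_zero[of u] unfolding power2_eq_1_iff by linarith
    have Reu: "Re (u * z) = k * (Re z - t * Im z)" and Imu: "Im (u * z) = k * (t * Re z + Im z)" for z
      using u by (simp_all add: algebra_simps)
    have Reu0: "0 \<le> Re (u * z)" if "\<bar>Im z\<bar> \<le> Re z" for z
      unfolding Reu using k that t by (auto intro!: mult_nonneg_nonneg)
    have Reu1: "0 < Re (u * z)" if "\<bar>Im z\<bar> < Re z" for z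
      unfolding Reu using k that t by (auto intro!: mult_pos_pos)
    show "(\<lambda>z. f (u * z)) holomorphic_on {z. \<bar>Im z\<bar> < Re z}"
      by (rule holomorphic_on_compose_gen[OF _ hol, unfolded o_def])
         (use Reu1 in \<open>auto intro!: holomorphic_intros simp del: times_complex.sel\<close>)
    show "continuous_on {z. \<bar>Im z\<bar> \<le> Re z} (\<lambda>z. f (u * z))"
      by (rule continuous_on_compose2[OF cont])
         (use Reu0 in \<open>auto intro!: continuous_intros simp del: times_complex.sel\<close>)
    show "norm (f (u * z)) \<le> C * exp (C * norm z)" if "\<bar>Im z\<bar> \<le> Re z" for z
      using growth[OF Reu0[OF that]] nu by (simp add: norm_mult)
    show "norm (f (u * z)) \<le> N" if z: "\<bar>Im z\<bar> = Re z" for z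
    proof -
      have "t * Re z + Im z = 0 \<or> Re z - t * Im z = 0"
        using t z by (auto simp: abs_if split: if_splits)
      then have "Im (u * z) = 0 \<or> Re (u * z) = 0" unfolding Reu Imu by auto
      then show ?thesis
      proof
        assume a: "Im (u * z) = 0"
        then have "u * z = of_real (Re (u * z))" by (simp add: complex_eq_iff)
        then show ?thesis using ray[of "Re (u * z)"] Reu0[of z] z N by (metis order_refl order_trans)
      next
        assume "Re (u * z) = 0"
        then show ?thesis using bound N by (meson order_trans)
      qed
    qed
    show "0 < N" by (rule N)
    show "\<bar>Im z\<bar> \<le> Re z" by (rule z)
  qed
  have bdd: "norm (f z) \<le> N" if z: "0 \<le> Re z" for z
  proof -
    define t :: real where "t = (if 0 \<le> Im z then 1 else -1)"
    have t: "t = 1 \<or> t = -1" by (auto simp: t_def)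
    let ?u = "Complex k (t * k)" and ?v = "Complex k (- t * k)"
    have "?u * ?v = 1" using t k by (auto simp: complex_eq_iff)
    then have 1: "?u * (?v * z) = z" by (simp flip: mult.assoc)
    have "\<bar>Im (?v * z)\<bar> \<le> Re (?v * z)"
    proof -
      have "\<bar>Im z - t * Re z\<bar> \<le> Re z + t * Im z" using z by (auto simp: t_def)
      then have "k * \<bar>Im z - t * Re z\<bar> \<le> k * (Re z + t * Im z)" using k by simp
      then have "\<bar>k * (Im z - t * Re z)\<bar> \<le> k * (Re z + t * Im z)" using k by (simp add: abs_mult)
      then show ?thesis by (simp add: algebra_simps)
    qed
    then have "norm (f (?u * (?v * z))) \<le> N" by (rule quad[OF refl t])
    then show ?thesis unfolding 1 .
  qed
  show ?thesis
    by (rule Phragmen_Lindelof_bounded[OF hol cont bdd bound M z0])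
qed

section \<open>A holomorphic majorant of the weight in the half-plane\<close>

lemma weight_facts:
  assumes "admissible_weight \<omega>"
  shows weight_nonneg: "\<And>x. 0 \<le> x \<Longrightarrow> 0 \<le> \<omega> x"
    and weight_mono: "\<And>x y. 0 \<le> x \<Longrightarrow> x \<le> y \<Longrightarrow> \<omega> x \<le> \<omega> y"
    and weight_continuous: "continuous_on {0..} \<omega>"
  using assms by (auto simp: admissible_weight_def mono_on_def)

lemma weight_sublinear:
  assumes w: "admissible_weight \<omega>" and e: "0 < e"
  shows "\<forall>\<^sub>F x in at_top. \<omega> x \<le> e * x"
proof -
  have "\<omega> \<in> o[at_top](\<lambda>x. x)" using w by (simp add: admissible_weight_def)
  then have "\<forall>\<^sub>F x in at_top. norm (\<omega> x) \<le> e * norm x" using e by (rule landau_o.smallD)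
  then show ?thesis using eventually_ge_at_top[of 0] by eventually_elim auto
qed

lemma weight_le_linear:
  assumes w: "admissible_weight \<omega>"
  shows "\<exists>A\<ge>0. \<forall>x\<ge>0. \<omega> x \<le> A + x"
proof -
  obtain X where X: "\<And>x. X \<le> x \<Longrightarrow> \<omega> x \<le> 1 * x"
    using weight_sublinear[OF w zero_less_one] by (auto simp: eventually_at_top_linorder)
  have "\<omega> x \<le> \<omega> \<bar>X\<bar> + x" if "0 \<le> x" for x
  proof (cases "X \<le> x")
    case True then show ?thesis using X[OF True] weight_nonneg[OF w, of "\<bar>X\<bar>"] by simp
  next
    case False then show ?thesis using weight_mono[OF w, of x "\<bar>X\<bar>"] that by simp
  qed
  then show ?thesis using weight_nonneg[OF w, of "\<bar>X\<bar>"] by auto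
qed

text \<open>The weight is majorized, up to constants, by the real part of a function that is holomorphic across the boundary
  of the right half-plane.  It is a sum of the functions \<open>w / (w + s)\<close>, each of which has nonnegative
  real part, is of order \<open>w / s\<close> for small \<open>w\<close> and has real part at least \<open>1/4\<close> once \<open>\<bar>w\<bar> \<ge> s\<close>.  The
  coefficients are the increments of the weight over dyadic intervals.\<close>

definition weight_increment :: "(real \<Rightarrow> real) \<Rightarrow> nat \<Rightarrow> real" where
  "weight_increment \<omega> n = \<omega> (2 ^ Suc n) - \<omega> (2 ^ n)"

text \<open>The series converges for \<open>Re w > - 1/2\<close>.\<close>

definition weight_majorant :: "(real \<Rightarrow> real) \<Rightarrow> complex \<Rightarrow> complex" where
  "weight_majorant \<omega> w = (\<Sum>n. of_real (weight_increment \<omega> n) * (w / (w + 2 ^ n)))"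

lemma weight_increment_nonneg:
  assumes "admissible_weight \<omega>"
  shows "0 \<le> weight_increment \<omega> n"
  unfolding weight_increment_def using weight_mono[OF assms, of "2 ^ n" "2 ^ Suc n"] by simp

text \<open>The convergence of \<open>\<integral> \<omega>(x) / x\<^sup>2\<close> enters the argument only here.\<close>

lemma summable_weight_dyadic:
  assumes w: "admissible_weight \<omega>"
  shows "summable (\<lambda>n. \<omega> (2 ^ n) / 2 ^ n)"
proof (rule bounded_imp_summable)
  let ?g = "\<lambda>x. \<omega> x / x\<^sup>2"
  have si: "set_integrable lborel {1..} ?g" using w by (simp add: admissible_weight_def)
  have int1: "?g integrable_on {1..}" using set_borel_integral_eq_integral(1)[OF si] .
  have cont: "continuous_on {a..b} ?g" if "1 \<le> a" for a b :: real
    using that by (intro continuous_intros continuous_on_subset[OF weight_continuous[OF w]]) auto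
  have int: "?g integrable_on {a..b}" if "1 \<le> a" for a b :: real
    by (intro integrable_continuous_real cont that)
  have step: "\<omega> (2 ^ n) / 2 ^ n / 4 \<le> integral {2 ^ n..2 ^ Suc n} ?g" for n
  proof -
    have p1: "(1::real) \<le> 2 ^ n" by simp
    have "integral {2 ^ n..2 ^ Suc n} (\<lambda>x::real. \<omega> (2 ^ n) / (2 ^ Suc n)\<^sup>2) \<le> integral {2 ^ n..2 ^ Suc n} ?g"
    proof (rule integral_le)
      show "?g integrable_on {2 ^ n..2 ^ Suc n}" by (rule int[OF p1])
      fix x :: real assume x: "x \<in> {2 ^ n..2 ^ Suc n}"
      have "1 \<le> x" using x p1 unfolding atLeastAtMost_iff by linarith
      then have x0: "0 < x" by simp
      show "\<omega> (2 ^ n) / (2 ^ Suc n)\<^sup>2 \<le> \<omega> x / x\<^sup>2"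
        using x x0 weight_mono[OF w, of "2 ^ n" x] weight_nonneg[OF w, of x]
        by (intro frac_le power_mono) auto
    qed (rule integrable_const_ivl)
    also have "integral {2 ^ n..2 ^ Suc n} (\<lambda>x::real. \<omega> (2 ^ n) / (2 ^ Suc n)\<^sup>2) = \<omega> (2 ^ n) / 2 ^ n / 4"
      by (simp add: power2_eq_square field_simps)
    finally show ?thesis .
  qed
  have part: "(\<Sum>k<n. \<omega> (2 ^ k) / 2 ^ k / 4) \<le> integral {1..2 ^ n} ?g" for n
  proof (induction n)
    case (Suc n)
    have "integral {1..2 ^ n} ?g + integral {2 ^ n..2 ^ Suc n} ?g = integral {1..2 ^ Suc n} ?g"
      by (rule Henstock_Kurzweil_Integration.integral_combine) (auto intro!: int self_le_power)
    then show ?case using Suc step[of n] by simp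
  qed simp
  show "0 \<le> \<omega> (2 ^ n) / 2 ^ n" for n using weight_nonneg[OF w, of "2 ^ n"] by simp
  show "(\<Sum>k\<le>n. \<omega> (2 ^ k) / 2 ^ k) \<le> 4 * integral {1..} ?g" for n
  proof -
    have "(\<Sum>k<Suc n. \<omega> (2 ^ k) / 2 ^ k / 4) \<le> integral {1..2 ^ Suc n} ?g" by (rule part)
    also have "\<dots> \<le> integral {1..} ?g"
      using weight_nonneg[OF w] by (intro integral_subset_le int int1) auto
    finally have "(\<Sum>k\<le>n. \<omega> (2 ^ k) / 2 ^ k) / 4 \<le> integral {1..} ?g"
      unfolding sum_divide_distrib[symmetric] lessThan_Suc_atMost .
    then show ?thesis by simp
  qed
qed

lemma summable_weight_increment:
  assumes w: "admissible_weight \<omega>"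
  shows "summable (\<lambda>n. weight_increment \<omega> n / 2 ^ n)"
proof (rule summable_comparison_test'[where N = 0])
  have "summable (\<lambda>n. \<omega> (2 ^ Suc n) / 2 ^ Suc n)"
    using summable_weight_dyadic[OF w] by (subst summable_Suc_iff)
  then show "summable (\<lambda>n. 2 * (\<omega> (2 ^ Suc n) / 2 ^ Suc n))" by (rule summable_mult)
  show "norm (weight_increment \<omega> n / 2 ^ n) \<le> 2 * (\<omega> (2 ^ Suc n) / 2 ^ Suc n)" for n
    using weight_increment_nonneg[OF w, of n] weight_nonneg[OF w, of "2 ^ n"]
    by (simp add: weight_increment_def divide_right_mono)
qed

lemma norm_add_power2_ge:
  assumes "- 1/2 < Re w"
  shows "2 ^ n / 2 \<le> norm (w + 2 ^ n)" and "w + 2 ^ n \<noteq> 0"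
proof -
  have "(2::complex) ^ n = of_real (2 ^ n)" by simp
  then have R: "Re (w + 2 ^ n) = Re w + 2 ^ n" by (metis Re_complex_of_real plus_complex.sel(1))
  have "(1::real) \<le> 2 ^ n" by simp
  then have "2 ^ n / 2 \<le> Re (w + 2 ^ n)" using assms unfolding R by linarith
  then show 1: "2 ^ n / 2 \<le> norm (w + 2 ^ n)" using complex_Re_le_cmod order_trans by blast
  have "(0::real) < 2 ^ n / 2" by simp
  then have "0 < norm (w + 2 ^ n)" using 1 by (rule less_le_trans)
  then show "w + 2 ^ n \<noteq> 0" by (simp only: zero_less_norm_iff not_False_eq_True)
qed

lemma weight_majorant_term_bound:
  assumes w: "admissible_weight \<omega>" and z: "- 1/2 < Re z"
  shows "norm (of_real (weight_increment \<omega> n) * (z / (z + 2 ^ n))) \<le> 2 * norm z * (weight_increment \<omega> n / 2 ^ n)"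
proof -
  have "norm (z / (z + 2 ^ n)) \<le> norm z / (2 ^ n / 2)"
    unfolding norm_divide by (intro divide_left_mono norm_add_power2_ge z mult_pos_pos)
      (use norm_add_power2_ge[OF z, of n] in auto)
  then have "weight_increment \<omega> n * norm (z / (z + 2 ^ n)) \<le> weight_increment \<omega> n * (norm z / (2 ^ n / 2))"
    using weight_increment_nonneg[OF w, of n] by (rule mult_left_mono)
  moreover have "norm (of_real a * q) = a * norm q" if "0 \<le> a" for a and q :: complex
    using that by (simp add: norm_mult)
  ultimately have "norm (of_real (weight_increment \<omega> n) * (z / (z + 2 ^ n))) \<le> weight_increment \<omega> n * (norm z / (2 ^ n / 2))"
    using weight_increment_nonneg[OF w, of n] by metis
  then show ?thesis by (simp add: mult_ac)
qed

lemma weight_majorant_sums: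
  assumes w: "admissible_weight \<omega>" and z: "- 1/2 < Re z"
  shows "(\<lambda>n. of_real (weight_increment \<omega> n) * (z / (z + 2 ^ n))) sums weight_majorant \<omega> z"
  unfolding weight_majorant_def
  by (intro summable_sums summable_comparison_test'[where N = 0,
        OF summable_mult[OF summable_weight_increment[OF w]] weight_majorant_term_bound[OF w z]])

lemma weight_majorant_holomorphic:
  assumes w: "admissible_weight \<omega>"
  shows "weight_majorant \<omega> holomorphic_on {z. - 1/2 < Re z}"
proof -
  let ?S = "{z. - 1/2 < Re z}"
  let ?f = "\<lambda>n z. of_real (weight_increment \<omega> n) * (z / (z + 2 ^ n))"
  have S: "open ?S" by (intro open_Collect_less continuous_intros)
  have hol: "?f n holomorphic_on ?S" for n
    using norm_add_power2_ge(2) by (intro holomorphic_intros) auto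
  obtain g g' where g: "\<And>x. x \<in> ?S \<Longrightarrow> (\<lambda>n. ?f n x) sums g x"
    "\<And>x. x \<in> ?S \<Longrightarrow> (g has_field_derivative g' x) (at x)"
  proof -
    have "\<exists>g g'. \<forall>x\<in>?S. ((\<lambda>n. ?f n x) sums g x) \<and> ((\<lambda>n. deriv (?f n) x) sums g' x) \<and>
        (g has_field_derivative g' x) (at x)"
    proof (rule series_and_derivative_comparison_local[OF S])
      show "(?f n has_field_derivative deriv (?f n) x) (at x)" if "x \<in> ?S" for n x
        using hol S that by (rule holomorphic_derivI)
      fix x assume x: "x \<in> ?S"
      show "\<exists>d h. 0 < d \<and> summable h \<and> (\<forall>\<^sub>F n in sequentially. \<forall>y\<in>ball x d \<inter> ?S. norm (?f n y) \<le> h n)"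
      proof (intro exI[of _ 1] exI[of _ "\<lambda>n. 2 * (norm x + 1) * (weight_increment \<omega> n / 2 ^ n)"] conjI
          always_eventually allI ballI)
        show "summable (\<lambda>n. 2 * (norm x + 1) * (weight_increment \<omega> n / 2 ^ n))"
          by (intro summable_mult summable_weight_increment w)
        fix n y assume y: "y \<in> ball x 1 \<inter> ?S"
        have "norm y \<le> norm x + 1" using y norm_triangle_ineq2[of y x] by (auto simp: dist_norm norm_minus_commute)
        then have "2 * norm y * (weight_increment \<omega> n / 2 ^ n) \<le> 2 * (norm x + 1) * (weight_increment \<omega> n / 2 ^ n)"
          using weight_increment_nonneg[OF w, of n] by (intro mult_right_mono) auto
        then show "norm (?f n y) \<le> 2 * (norm x + 1) * (weight_increment \<omega> n / 2 ^ n)"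
          using weight_majorant_term_bound[OF w, of y n] y by force
      qed simp
    qed
    then show ?thesis using that by blast
  qed
  have "g holomorphic_on ?S" using g(2) S by (auto simp: holomorphic_on_open)
  moreover have "g z = weight_majorant \<omega> z" if "z \<in> ?S" for z
    using g(1)[OF that] weight_majorant_sums[OF w, of z] that sums_unique2 by blast
  ultimately show ?thesis by (rule holomorphic_transform)
qed

lemma Re_divide_add_ge:
  assumes "0 \<le> Re z" "0 < s"
  shows "0 \<le> Re (z / (z + of_real s))" and "s \<le> norm z \<Longrightarrow> 1/4 \<le> Re (z / (z + of_real s))"
proof -
  have nz: "z + of_real s \<noteq> 0"
  proof
    assume "z + of_real s = 0"
    then have "Re z + s = 0" by (metis Re_complex_of_real plus_complex.sel(1) zero_complex.sel(1))
    then show False using assms by simp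
  qed
  have eq: "Re (z / (z + of_real s)) = ((norm z)\<^sup>2 + s * Re z) / (norm (z + of_real s))\<^sup>2"
    by (simp add: Re_divide cmod_power2 add_divide_distrib[symmetric]) (simp add: power2_eq_square algebra_simps)
  show "0 \<le> Re (z / (z + of_real s))" unfolding eq using assms by simp
  show "1/4 \<le> Re (z / (z + of_real s))" if "s \<le> norm z"
  proof -
    have "norm (z + of_real s) \<le> norm z + s" using norm_triangle_ineq[of z "of_real s"] assms by simp
    also have "\<dots> \<le> 2 * norm z" using that by simp
    finally have "(norm (z + of_real s))\<^sup>2 \<le> (2 * norm z)\<^sup>2" by (intro power_mono) auto
    then have "(norm (z + of_real s))\<^sup>2 \<le> 4 * ((norm z)\<^sup>2 + s * Re z)"
      using mult_nonneg_nonneg[of s "Re z"] assms by (simp add: power_mult_distrib distrib_left add_increasing2)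
    moreover have "0 < (norm (z + of_real s))\<^sup>2" using nz by simp
    ultimately show ?thesis unfolding eq by (simp add: field_simps)
  qed
qed

lemma weight_majorant_Re_sums:
  assumes w: "admissible_weight \<omega>" and z: "0 \<le> Re z"
  shows "(\<lambda>n. weight_increment \<omega> n * Re (z / (z + of_real (2 ^ n)))) sums Re (weight_majorant \<omega> z)"
proof -
  have "(\<lambda>n. Re (of_real (weight_increment \<omega> n) * (z / (z + 2 ^ n)))) sums Re (weight_majorant \<omega> z)"
    by (rule sums_Re[OF weight_majorant_sums[OF w]]) (use z in simp)
  moreover have "Re (of_real a * q) = a * Re q" for a q by simp
  ultimately show ?thesis by (simp only: of_real_power of_real_numeral)
qed

lemma weight_majorant_Re_nonneg:
  assumes w: "admissible_weight \<omega>" and z: "0 \<le> Re z"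
  shows "0 \<le> Re (weight_majorant \<omega> z)"
  by (rule sums_le[OF _ sums_zero weight_majorant_Re_sums[OF w z]])
     (intro mult_nonneg_nonneg weight_increment_nonneg w Re_divide_add_ge(1) z, simp)

lemma weight_le_majorant:
  assumes w: "admissible_weight \<omega>" and z: "0 \<le> Re z"
  shows "\<omega> (norm z) \<le> \<omega> 1 + 4 * Re (weight_majorant \<omega> z)"
proof (cases "1 \<le> norm z")
  case False
  then show ?thesis using weight_mono[OF w, of "norm z" 1] weight_majorant_Re_nonneg[OF w z] by simp
next
  case True
  obtain N where N: "2 ^ N \<le> norm z" "norm z < 2 ^ Suc N"
  proof -
    obtain m where "norm z < 2 ^ m" using real_arch_pow[of 2 "norm z"] by auto
    then have ex: "\<exists>m. norm z < 2 ^ m" ..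
    define m where "m = (LEAST m. norm z < 2 ^ m)"
    have m: "norm z < 2 ^ m" unfolding m_def by (rule LeastI_ex[OF ex])
    have "m \<noteq> 0" using m True by (intro notI) simp
    then obtain N where mN: "m = Suc N" by (cases m) auto
    then have "\<not> norm z < 2 ^ N" unfolding m_def using not_less_Least[of N "\<lambda>m. norm z < 2 ^ m"] by simp
    then show ?thesis using that[of N] m mN by simp
  qed
  let ?t = "\<lambda>n. weight_increment \<omega> n * Re (z / (z + of_real (2 ^ n)))"
  have t0: "0 \<le> ?t n" for n
    by (intro mult_nonneg_nonneg weight_increment_nonneg w Re_divide_add_ge(1) z) simp
  have "(\<Sum>n<Suc N. weight_increment \<omega> n * (1/4)) \<le> (\<Sum>n<Suc N. ?t n)"
  proof (intro sum_mono mult_left_mono weight_increment_nonneg w Re_divide_add_ge(2) z)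
    fix n assume "n \<in> {..<Suc N}"
    then have "(2::real) ^ n \<le> 2 ^ N" by (intro power_increasing) auto
    then show "2 ^ n \<le> norm z" using N by linarith
  qed simp
  also have "\<dots> \<le> (\<Sum>n. ?t n)"
    using weight_majorant_Re_sums[OF w z] t0 by (intro sum_le_suminf) (auto simp: sums_iff)
  also have "\<dots> = Re (weight_majorant \<omega> z)" using weight_majorant_Re_sums[OF w z] by (simp add: sums_iff)
  finally have "(\<Sum>n<Suc N. weight_increment \<omega> n) \<le> 4 * Re (weight_majorant \<omega> z)"
    unfolding sum_distrib_right[symmetric] by linarith
  moreover have "(\<Sum>n<Suc N. weight_increment \<omega> n) = \<omega> (2 ^ Suc N) - \<omega> (2 ^ 0)"
    unfolding weight_increment_def by (rule sum_lessThan_telescope)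
  moreover have "\<omega> (norm z) \<le> \<omega> (2 ^ Suc N)" using N by (intro weight_mono[OF w]) auto
  ultimately show ?thesis by simp
qed

lemma weight_majorant_sublinear:
  assumes w: "admissible_weight \<omega>" and e: "0 < e"
  shows "\<forall>\<^sub>F y in at_top. Re (weight_majorant \<omega> (of_real y)) \<le> e * y"
proof -
  let ?a = "weight_increment \<omega>"
  have sm: "summable (\<lambda>n. ?a n / 2 ^ n)" by (rule summable_weight_increment[OF w])
  obtain N where N: "norm (\<Sum>i. ?a (i + N) / 2 ^ (i + N)) < e / 2"
    using suminf_exist_split[OF _ sm, of "e / 2"] e by auto
  \<comment> \<open>the terms below \<open>N\<close> stay bounded, the remaining ones contribute at most \<open>e / 2 * y\<close>\<close>
  let ?A = "\<Sum>n<N. ?a n"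
  have A0: "0 \<le> ?A" by (intro sum_nonneg weight_increment_nonneg w)
  have "Re (weight_majorant \<omega> (of_real y)) \<le> e * y" if y: "max 1 (2 * ?A / e) \<le> y" for y
  proof -
    have y0: "0 < y" "2 * ?A / e \<le> y" using y by auto
    let ?t = "\<lambda>n. ?a n * (y / (y + 2 ^ n))"
    have "Re (of_real y / (of_real y + of_real (2 ^ n)) :: complex) = y / (y + 2 ^ n)" for n
      by (metis Re_complex_of_real of_real_add of_real_divide)
    then have S: "?t sums Re (weight_majorant \<omega> (of_real y))"
      using weight_majorant_Re_sums[OF w, of "of_real y"] y0 by simp
    have "(\<Sum>n. ?t n) = (\<Sum>n. ?t (n + N)) + (\<Sum>n<N. ?t n)"
      using S by (intro suminf_split_initial_segment) (auto simp: sums_iff)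
    moreover have "(\<Sum>n<N. ?t n) \<le> ?A"
    proof (rule sum_mono)
      fix n
      have "y / (y + 2 ^ n) \<le> 1" using y0 by (simp add: add_pos_pos)
      then show "?t n \<le> ?a n" using weight_increment_nonneg[OF w, of n] mult_left_mono[of "y / (y + 2 ^ n)" 1 "?a n"] by simp
    qed
    moreover have "(\<Sum>n. ?t (n + N)) \<le> (\<Sum>n. y * (?a (n + N) / 2 ^ (n + N)))"
    proof (rule suminf_le)
      fix n
      have "y / (y + 2 ^ (n + N)) \<le> y / 2 ^ (n + N)" using y0 by (intro divide_left_mono mult_pos_pos add_pos_pos) auto
      then have "?t (n + N) \<le> ?a (n + N) * (y / 2 ^ (n + N))"
        by (intro mult_left_mono weight_increment_nonneg w)
      then show "?t (n + N) \<le> y * (?a (n + N) / 2 ^ (n + N))" by (simp add: mult.commute)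
    next
      show "summable (\<lambda>n. ?t (n + N))" using S summable_ignore_initial_segment sums_summable by blast
      show "summable (\<lambda>n. y * (?a (n + N) / 2 ^ (n + N)))"
        by (intro summable_mult summable_ignore_initial_segment[OF sm])
    qed
    moreover have "(\<Sum>n. y * (?a (n + N) / 2 ^ (n + N))) = y * (\<Sum>n. ?a (n + N) / 2 ^ (n + N))"
      by (intro suminf_mult summable_ignore_initial_segment[OF sm])
    moreover have "y * (\<Sum>n. ?a (n + N) / 2 ^ (n + N)) \<le> y * (e / 2)" using N y0 by (intro mult_left_mono) auto
    moreover have "?A \<le> e / 2 * y" using y0 e by (simp add: field_simps)
    ultimately show ?thesis using S by (simp add: sums_iff algebra_simps)
  qed
  then show ?thesis unfolding eventually_at_top_linorder by blast
qed

section \<open>Indicators and growth in the upper half-plane\<close>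

text \<open>Quantifying over real \<open>d > D\<close> includes the case \<open>D = -\<infinity>\<close> and needs no exception at the zeros
  of \<open>\<phi>\<close>.\<close>

lemma indicator_le_iff:
  "indicator_fun \<phi> \<theta> \<le> D \<longleftrightarrow>
    (\<forall>d. D < ereal d \<longrightarrow> (\<forall>\<^sub>F t in at_top. norm (\<phi> (of_real t * cis \<theta>)) \<le> exp (d * t)))"
    (is "?L \<longleftrightarrow> ?R")
proof -
  let ?X = "\<lambda>t::real. if \<phi> (of_real t * cis \<theta>) = 0 then -\<infinity>
     else ereal (ln (norm (\<phi> (of_real t * cis \<theta>))) / t)"
  have X: "?X t \<le> ereal d \<longleftrightarrow> norm (\<phi> (of_real t * cis \<theta>)) \<le> exp (d * t)" if "0 < t" for t d
  proof (cases "\<phi> (of_real t * cis \<theta>) = 0")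
    case False
    then have "ln (norm (\<phi> (of_real t * cis \<theta>))) \<le> d * t \<longleftrightarrow> norm (\<phi> (of_real t * cis \<theta>)) \<le> exp (d * t)"
      by (metis exp_le_cancel_iff exp_ln zero_less_norm_iff)
    then show ?thesis using False that by (simp add: divide_le_eq)
  qed simp
  have ev: "(\<forall>\<^sub>F t in at_top. ?X t \<le> ereal d) \<longleftrightarrow> (\<forall>\<^sub>F t in at_top. norm (\<phi> (of_real t * cis \<theta>)) \<le> exp (d * t))" for d
    by (rule eventually_cong[OF eventually_gt_at_top[of 0]]) (use X in auto)
  have "?L \<longleftrightarrow> (\<forall>y>D. \<forall>\<^sub>F t in at_top. ?X t < y)"
    unfolding indicator_fun_def by (rule Limsup_le_iff)
  also have "\<dots> \<longleftrightarrow> (\<forall>d. D < ereal d \<longrightarrow> (\<forall>\<^sub>F t in at_top. ?X t \<le> ereal d))"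
  proof (intro iffI allI impI)
    fix d assume "\<forall>y>D. \<forall>\<^sub>F t in at_top. ?X t < y" "D < ereal d"
    then have "\<forall>\<^sub>F t in at_top. ?X t < ereal d" by blast
    then show "\<forall>\<^sub>F t in at_top. ?X t \<le> ereal d" by (rule eventually_mono) simp
  next
    fix y assume a: "\<forall>d. D < ereal d \<longrightarrow> (\<forall>\<^sub>F t in at_top. ?X t \<le> ereal d)" and y: "D < y"
    obtain d where d: "D < ereal d" "ereal d < y" using ereal_dense2[OF y] by blast
    then have "\<forall>\<^sub>F t in at_top. ?X t \<le> ereal d" using a by blast
    then show "\<forall>\<^sub>F t in at_top. ?X t < y" by (rule eventually_mono) (use d in \<open>auto intro: le_less_trans\<close>)
  qed
  finally show ?thesis unfolding ev .
qed

text \<open>The crucial point is that the majorant involves only \<open>M\<close>, \<open>d\<close> and the weight.  It is therefore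
  uniform over bounded families with a common bound \<open>d\<close> for the indicator, although the growth along
  the imaginary axis that defines the indicator is not uniform.\<close>

lemma majorized_in_upper_half_plane:
  assumes w: "admissible_weight \<omega>" and hol: "f holomorphic_on UNIV"
    and M: "0 < M" and c: "0 \<le> c"
    and bnd: "\<And>z. norm (f z) \<le> M * exp (\<omega> (norm z) + c * \<bar>Im z\<bar>)"
    and ind: "\<And>e. 0 < e \<Longrightarrow> \<forall>\<^sub>F y in at_top. norm (f (\<i> * of_real y)) \<le> exp ((d + e) * y)"
    and z: "0 \<le> Im z"
  shows "norm (f z) \<le> M * exp (\<omega> 1) * exp (d * Im z + 4 * Re (weight_majorant \<omega> (- \<i> * z)))"
proof -
  define F where "F = weight_majorant \<omega>"
  have est: "norm (f z) \<le> M * exp (\<omega> 1) * exp ((d + e) * Im z + 4 * Re (F (- \<i> * z)))" if e: "0 < e" for e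
  proof -
    \<comment> \<open>rotated to the right half-plane, where \<open>q\<close> is bounded by \<open>M * exp (\<omega> 1)\<close> on the boundary\<close>
    define q where "q = (\<lambda>v. f (\<i> * v) * exp (- of_real (d + e) * v - 4 * F v))"
    have nq: "norm (q v) = norm (f (\<i> * v)) * exp (- (d + e) * Re v - 4 * Re (F v))" for v
      by (simp add: q_def norm_mult)
    have F0: "0 \<le> Re (F v)" if "0 \<le> Re v" for v
      unfolding F_def by (rule weight_majorant_Re_nonneg[OF w that])
    have "(\<lambda>v. f (\<i> * v)) holomorphic_on UNIV"
      by (rule holomorphic_on_compose_gen[OF _ hol, unfolded o_def]) (auto intro!: holomorphic_intros)
    then have fi: "(\<lambda>v. f (\<i> * v)) holomorphic_on {z. - 1/2 < Re z}"
      by (rule holomorphic_on_subset) auto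
    have holq: "q holomorphic_on {z. - 1/2 < Re z}"
      unfolding q_def F_def by (intro holomorphic_intros fi weight_majorant_holomorphic w)
    obtain A where A: "0 \<le> A" "\<And>x. 0 \<le> x \<Longrightarrow> \<omega> x \<le> A + x" using weight_le_linear[OF w] by blast
    define C where "C = max (M * exp A) (1 + c + \<bar>d + e\<bar>)"
    have C: "M * exp A \<le> C" "1 + c + \<bar>d + e\<bar> \<le> C" by (auto simp: C_def)
    have contq: "continuous_on {0..X} (\<lambda>x::real. norm (q (of_real x)))" for X
      by (intro continuous_intros continuous_on_compose2[OF holomorphic_on_imp_continuous_on[OF holq]]) auto
    obtain X where X: "\<And>y. X \<le> y \<Longrightarrow> norm (f (\<i> * of_real y)) \<le> exp ((d + e) * y)"
      using ind[OF e] unfolding eventually_at_top_linorder by blast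
    have "bdd_above ((\<lambda>x::real. norm (q (of_real x))) ` {0..X})"
      by (intro bounded_imp_bdd_above compact_imp_bounded compact_continuous_image contq compact_Icc)
    then obtain B where B: "\<And>x. x \<in> {0..X} \<Longrightarrow> norm (q (of_real x)) \<le> B"
      unfolding bdd_above_def by blast
    have "norm (q (- \<i> * z)) \<le> M * exp (\<omega> 1)"
    proof (rule Phragmen_Lindelof_half_plane[where f = q])
      show "q holomorphic_on {z. 0 < Re z}" by (rule holomorphic_on_subset[OF holq]) auto
      show "continuous_on {z. 0 \<le> Re z} q"
        by (rule continuous_on_subset[OF holomorphic_on_imp_continuous_on[OF holq]]) auto
      show "norm (q v) \<le> C * exp (C * norm v)" if v: "0 \<le> Re v" for v
      proof -
        have "norm (f (\<i> * v)) \<le> M * exp (\<omega> (norm v) + c * \<bar>Re v\<bar>)" using bnd[of "\<i> * v"] by (simp add: norm_mult)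
        also have "\<dots> \<le> M * exp ((A + norm v) + c * norm v)"
          using M c A abs_Re_le_cmod[of v] by (auto intro!: mult_left_mono add_mono)
        finally have 1: "norm (f (\<i> * v)) \<le> M * exp ((A + norm v) + c * norm v)" .
        have "- (d + e) * Re v \<le> \<bar>d + e\<bar> * norm v"
        proof -
          have "- (d + e) * Re v \<le> \<bar>d + e\<bar> * \<bar>Re v\<bar>" by (metis abs_ge_self abs_minus_cancel abs_mult)
          also have "\<dots> \<le> \<bar>d + e\<bar> * norm v" by (intro mult_left_mono abs_Re_le_cmod) simp
          finally show ?thesis .
        qed
        then have 2: "exp (- (d + e) * Re v - 4 * Re (F v)) \<le> exp (\<bar>d + e\<bar> * norm v)"
          using F0[OF v] by simp
        have "norm (q v) \<le> (M * exp ((A + norm v) + c * norm v)) * exp (\<bar>d + e\<bar> * norm v)"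
          unfolding nq using M by (intro mult_mono 1 2) auto
        also have "\<dots> = M * exp A * exp ((1 + c + \<bar>d + e\<bar>) * norm v)"
          by (simp add: mult_exp_exp algebra_simps)
        also have "\<dots> \<le> C * exp (C * norm v)"
          using C M by (intro mult_mono C) (auto intro!: mult_right_mono order_trans[OF _ C(1)])
        finally show ?thesis .
      qed
      show "norm (q (of_real x)) \<le> max B 1" if x: "0 \<le> x" for x
      proof (cases "x \<le> X")
        case True then show ?thesis using B[of x] x by simp
      next
        case False
        have "norm (q (of_real x)) \<le> exp ((d + e) * x) * exp (- (d + e) * x)"
          unfolding nq using X[of x] False F0[of "of_real x"] x by (intro mult_mono) auto
        then have "norm (q (of_real x)) \<le> 1" by (simp add: mult_exp_exp algebra_simps)
        then show ?thesis by simp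
      qed
      show "norm (q v) \<le> M * exp (\<omega> 1)" if v: "Re v = 0" for v
      proof -
        have "norm (f (\<i> * v)) \<le> M * exp (\<omega> (norm v))" using bnd[of "\<i> * v"] v by (simp add: norm_mult)
        also have "\<dots> \<le> M * exp (\<omega> 1 + 4 * Re (F v))"
          using weight_le_majorant[OF w, of v] v M by (simp add: F_def)
        finally have "norm (q v) \<le> M * exp (\<omega> 1 + 4 * Re (F v)) * exp (- 4 * Re (F v))"
          unfolding nq using v by (simp add: mult_right_mono)
        then show ?thesis by (simp add: mult_exp_exp mult.assoc)
      qed
      show "0 < M * exp (\<omega> 1)" using M by simp
      show "0 \<le> Re (- \<i> * z)" using z by simp
    qed
    then have "norm (f z) * exp (- ((d + e) * Im z + 4 * Re (F (- \<i> * z)))) \<le> M * exp (\<omega> 1)"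
      unfolding nq by (simp add: algebra_simps)
    moreover have "x \<le> K * exp E" if "x * exp (- E) \<le> K" for x K E :: real
      using that by (simp add: exp_minus field_simps)
    ultimately show ?thesis by blast
  qed
  have "((\<lambda>e. M * exp (\<omega> 1) * exp ((d + e) * Im z + 4 * Re (F (- \<i> * z)))) \<longlongrightarrow>
      M * exp (\<omega> 1) * exp ((d + 0) * Im z + 4 * Re (F (- \<i> * z)))) (at_right 0)"
    by (intro tendsto_intros)
  then have "norm (f z) \<le> M * exp (\<omega> 1) * exp ((d + 0) * Im z + 4 * Re (F (- \<i> * z)))"
    using est
    by (intro tendsto_lowerbound[of _ _ "at_right (0::real)"])
       (auto simp: eventually_at_right[of 0 1] intro!: exI[of _ 1])
  then show ?thesis by (simp add: F_def)
qed

section \<open>Bounding quotients of holomorphic functions in discs\<close>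

lemma factor_out_zero:
  assumes f: "f holomorphic_on S" and S: "open S" "connected S" and b: "b \<in> S" and nz: "\<exists>w\<in>S. f w \<noteq> 0"
  obtains h where "h holomorphic_on S" "h b \<noteq> 0" "\<And>w. w \<in> S \<Longrightarrow> f w = (w - b) ^ nat (zorder f b) * h w"
proof -
  define n where "n = nat (zorder f b)"
  obtain r where r: "0 < r" "cball b r \<subseteq> S" "zor_poly f b holomorphic_on cball b r"
    "\<And>w. w \<in> cball b r \<Longrightarrow> f w = zor_poly f b w * (w - b) ^ n \<and> zor_poly f b w \<noteq> 0"
    using zorder_exist_zero[OF f S b nz] unfolding n_def by blast
  define h where "h w = (if w \<in> ball b r then zor_poly f b w else f w / (w - b) ^ n)" for w
  have 1: "h w = f w / (w - b) ^ n" if "w \<in> S - {b}" for w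
  proof (cases "w \<in> ball b r")
    case True
    then have "f w = zor_poly f b w * (w - b) ^ n" using r(4)[of w] by (auto simp: less_imp_le)
    then show ?thesis using that True by (simp add: h_def)
  qed (simp add: h_def)
  have "zor_poly f b holomorphic_on ball b r" by (rule holomorphic_on_subset[OF r(3)]) auto
  then have "h holomorphic_on ball b r" by (rule holomorphic_transform) (simp add: h_def)
  moreover have "(\<lambda>w. f w / (w - b) ^ n) holomorphic_on S - {b}"
    by (intro holomorphic_intros holomorphic_on_subset[OF f]) auto
  then have "h holomorphic_on S - {b}" by (rule holomorphic_transform) (simp add: 1)
  ultimately have "h holomorphic_on ball b r \<union> (S - {b})"
    using S by (intro holomorphic_on_Un) auto
  then have "h holomorphic_on S" by (rule holomorphic_on_subset) (use r in auto)
  moreover have "h b \<noteq> 0" using r by (auto simp: h_def)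
  moreover have "f w = (w - b) ^ n * h w" if "w \<in> S" for w
  proof (cases "w = b")
    case True
    then show ?thesis using r(4)[of b] r(1) by (simp add: h_def)
  next
    case False
    then show ?thesis using 1[of w] that by simp
  qed
  ultimately show ?thesis using that unfolding n_def by blast
qed

lemma Blaschke_denominator_ge:
  assumes "norm x \<le> \<rho>" "norm d \<le> \<rho>"
  shows "\<rho> * norm (x - d) \<le> norm (of_real (\<rho>\<^sup>2) - cnj d * x)"
proof (rule power2_le_imp_le)
  have "(norm (of_real (\<rho>\<^sup>2) - cnj d * x))\<^sup>2 - (\<rho> * norm (x - d))\<^sup>2 = (\<rho>\<^sup>2 - (norm x)\<^sup>2) * (\<rho>\<^sup>2 - (norm d)\<^sup>2)"
    by (simp add: cmod_power2 power_mult_distrib) (simp add: power2_eq_square algebra_simps)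
  moreover have "0 \<le> (\<rho>\<^sup>2 - (norm x)\<^sup>2) * (\<rho>\<^sup>2 - (norm d)\<^sup>2)"
    using assms by (intro mult_nonneg_nonneg) (auto intro!: power_mono)
  ultimately show "(\<rho> * norm (x - d))\<^sup>2 \<le> (norm (of_real (\<rho>\<^sup>2) - cnj d * x))\<^sup>2" by linarith
qed simp

lemma Blaschke_denominator_eq:
  assumes "norm x = \<rho>"
  shows "norm (of_real (\<rho>\<^sup>2) - cnj d * x) = \<rho> * norm (x - d)"
proof -
  have "of_real (\<rho>\<^sup>2) - cnj d * x = cnj (x - d) * x"
    using complex_norm_square[of x] assms by (simp add: algebra_simps)
  then show ?thesis using assms by (simp add: norm_mult flip: complex_cnj_diff)
qed

text \<open>Dividing \<open>f\<close> and \<open>\<theta> * f\<close> by the Blaschke product of the zeros of \<open>f\<close> in the disc does not change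
  the quotient \<open>\<theta>\<close>, and by the maximum principle it preserves the bounds.\<close>

lemma divide_out_zeros_in_disc:
  assumes S: "open S" "connected S" and ball: "cball p \<rho> \<subseteq> S" and rho: "0 < \<rho>"
    and a: "a \<in> ball p \<rho>" and \<theta>: "\<theta> holomorphic_on S"
    and f: "f holomorphic_on S" "f a \<noteq> 0"
    and fM: "\<And>z. z \<in> cball p \<rho> \<Longrightarrow> norm (f z) \<le> M"
    and gN: "\<And>z. z \<in> cball p \<rho> \<Longrightarrow> norm (\<theta> z * f z) \<le> N"
  shows "\<exists>s. s holomorphic_on S \<and> norm (f a) \<le> norm (s a) \<and>
     (\<forall>z\<in>ball p \<rho>. s z \<noteq> 0) \<and> (\<forall>z\<in>cball p \<rho>. norm (s z) \<le> M \<and> norm (\<theta> z * s z) \<le> N)"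
  using f fM gN
proof (induction "card {z \<in> ball p \<rho>. f z = 0}" arbitrary: f rule: less_induct)
  case less
  have aS: "a \<in> S" using a ball by auto
  show ?case
  proof (cases "\<exists>b\<in>ball p \<rho>. f b = 0")
    case False
    then show ?thesis using less.prems by (intro exI[of _ f]) auto
  next
    case True
    then obtain b where b: "b \<in> ball p \<rho>" "f b = 0" by blast
    then have bS: "b \<in> S" using ball by auto
    have "\<not> f constant_on S"
      using aS bS b(2) less.prems(2) unfolding constant_on_def by metis
    then have fin: "finite {z \<in> cball p \<rho>. f z = 0}"
      using holomorphic_compact_finite_zeros[OF less.prems(1) S compact_cball ball] by blast
    obtain h where h: "h holomorphic_on S" "h b \<noteq> 0"
      "\<And>w. w \<in> S \<Longrightarrow> f w = (w - b) ^ nat (zorder f b) * h w"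
      using factor_out_zero[OF less.prems(1) S bS] aS less.prems(2) by blast
    define n where "n = nat (zorder f b)"
    define d where "d = b - p"
    \<comment> \<open>\<open>(z - b) / \<beta> z\<close> is the Blaschke factor of the disc vanishing at \<open>b\<close>\<close>
    define \<beta> where "\<beta> z = (of_real (\<rho>\<^sup>2) - cnj d * (z - p)) / of_real \<rho>" for z
    define f1 where "f1 = (\<lambda>z. \<beta> z ^ n * h z)"
    have d: "norm d < \<rho>" using b by (simp add: d_def dist_norm norm_minus_commute)
    have fh: "f w = (w - b) ^ n * h w" if "w \<in> S" for w using h(3)[OF that] by (simp add: n_def)
    have \<beta>hol: "\<beta> holomorphic_on S" unfolding \<beta>_def using rho by (intro holomorphic_intros) auto
    have f1hol: "f1 holomorphic_on S" unfolding f1_def by (intro holomorphic_intros \<beta>hol h)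
    have \<beta>ge: "norm (z - b) \<le> norm (\<beta> z)" if "z \<in> cball p \<rho>" for z
      using Blaschke_denominator_ge[of "z - p" \<rho> d] that d rho
      by (simp add: \<beta>_def norm_divide field_simps dist_norm norm_minus_commute d_def)
    have \<beta>eq: "norm (\<beta> z) = norm (z - b)" if "dist p z = \<rho>" for z
      using Blaschke_denominator_eq[of "z - p" \<rho> d] that rho
      by (simp add: \<beta>_def norm_divide field_simps dist_norm norm_minus_commute d_def)
    have \<beta>nz: "\<beta> z \<noteq> 0" if "z \<in> ball p \<rho>" for z
    proof
      assume "\<beta> z = 0"
      then have e: "of_real (\<rho>\<^sup>2) = cnj d * (z - p)" using rho by (simp add: \<beta>_def)
      have "\<rho>\<^sup>2 = norm d * norm (z - p)"
        using arg_cong[OF e, of norm] by (simp add: norm_mult norm_power)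
      also have "\<dots> \<le> norm d * \<rho>" using that by (intro mult_left_mono) (auto simp: dist_norm norm_minus_commute)
      also have "\<dots> < \<rho> * \<rho>" using d rho by simp
      finally show False by (simp add: power2_eq_square)
    qed
    have nf: "norm (f z) = norm (z - b) ^ n * norm (h z)" if "z \<in> S" for z
      by (simp add: fh[OF that] norm_mult norm_power)
    have nf1: "norm (f1 z) = norm (\<beta> z) ^ n * norm (h z)" for z
      by (simp add: f1_def norm_mult norm_power)
    have sphere: "norm (f1 z) = norm (f z)" if "dist p z = \<rho>" for z
    proof -
      have "z \<in> S" using that ball by auto
      then show ?thesis using nf nf1 \<beta>eq[OF that] by simp
    qed
    have fa: "norm (f a) \<le> norm (f1 a)"
      using a unfolding nf1 nf[OF aS] by (intro mult_right_mono power_mono \<beta>ge) auto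
    have maxmod: "norm (k z) \<le> B"
      if k: "k holomorphic_on S" and B: "\<And>z. dist p z = \<rho> \<Longrightarrow> norm (k z) \<le> B" and z: "z \<in> cball p \<rho>" for k B z
    proof (rule maximum_modulus_frontier[where S = "cball p \<rho>" and f = k and \<xi> = z])
      show "k holomorphic_on interior (cball p \<rho>)"
        using ball interior_subset by (intro holomorphic_on_subset[OF k]) blast
      show "continuous_on (closure (cball p \<rho>)) k"
        using ball by (auto intro: continuous_on_subset[OF holomorphic_on_imp_continuous_on[OF k]])
      show "norm (k z) \<le> B" if "z \<in> frontier (cball p \<rho>)" for z
        using that rho B by (simp add: frontier_cball sphere_def)
    qed (use z in auto)
    have "\<exists>s. s holomorphic_on S \<and> norm (f1 a) \<le> norm (s a) \<and>
     (\<forall>z\<in>ball p \<rho>. s z \<noteq> 0) \<and> (\<forall>z\<in>cball p \<rho>. norm (s z) \<le> M \<and> norm (\<theta> z * s z) \<le> N)"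
    proof (rule less.hyps[OF _ f1hol])
      have f1z: "f z = 0" if "z \<in> ball p \<rho>" "f1 z = 0" for z
      proof -
        have "h z = 0" using that \<beta>nz[OF that(1)] by (simp add: f1_def)
        moreover have "z \<in> S" using that(1) ball by (auto intro: less_imp_le)
        ultimately show ?thesis using fh[of z] by simp
      qed
      moreover have "f1 b \<noteq> 0" using h(2) \<beta>nz[OF b(1)] by (simp add: f1_def)
      ultimately have "{z \<in> ball p \<rho>. f1 z = 0} \<subset> {z \<in> ball p \<rho>. f z = 0}" using b by blast
      then show "card {z \<in> ball p \<rho>. f1 z = 0} < card {z \<in> ball p \<rho>. f z = 0}"
        by (intro psubset_card_mono finite_subset[OF _ fin]) auto
      show "f1 a \<noteq> 0" using fa less.prems(2) by auto
      show "norm (f1 z) \<le> M" if "z \<in> cball p \<rho>" for z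
        by (rule maxmod[OF f1hol _ that]) (use sphere less.prems(3) in auto)
      show "norm (\<theta> z * f1 z) \<le> N" if "z \<in> cball p \<rho>" for z
        by (rule maxmod[OF holomorphic_on_mult[OF \<theta> f1hol] _ that])
           (use sphere less.prems(4) in \<open>auto simp: norm_mult\<close>)
    qed
    then show ?thesis using fa order_trans by blast
  qed
qed

lemma Re_Cayley_bounds:
  fixes u :: complex
  assumes u: "norm u \<le> t" and t: "t < 1"
  shows "Re ((1 + u) / (1 - u)) \<le> (1 + t) / (1 - t)" "(1 - t) / (1 + t) \<le> Re ((1 + u) / (1 - u))"
proof -
  have t0: "0 \<le> t" using u norm_ge_zero order_trans by blast
  define m where "m = norm u"
  have m: "0 \<le> m" "m \<le> t" "m < 1" using u t by (auto simp: m_def)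
  have up: "norm (1 + u) \<le> 1 + m" "norm (1 - u) \<le> 1 + m"
    using norm_triangle_ineq[of 1 u] norm_triangle_ineq4[of 1 u] by (auto simp: m_def)
  have low: "1 - m \<le> norm (1 - u)" using norm_triangle_ineq2[of 1 u] by (simp add: m_def)
  have pos: "0 < norm (1 - u)" using low m by linarith
  have "Re ((1 + u) / (1 - u)) \<le> norm ((1 + u) / (1 - u))" by (rule complex_Re_le_cmod)
  also have "\<dots> \<le> (1 + t) / (1 - t)" unfolding norm_divide using up low m t t0 by (intro frac_le) auto
  finally show "Re ((1 + u) / (1 - u)) \<le> (1 + t) / (1 - t)" .
  have eq: "Re ((1 + u) / (1 - u)) = (1 - m\<^sup>2) / (norm (1 - u))\<^sup>2"
    by (simp add: Re_divide cmod_power2 m_def add_divide_distrib[symmetric])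
       (simp add: power2_eq_square algebra_simps)
  have "(1 - t) / (1 + t) \<le> (1 - m) / (1 + m)" using m t by (simp add: field_simps)
  also have "\<dots> = ((1 - m) * (1 + m)) / ((1 + m) * (1 + m))" using m by simp
  also have "\<dots> = (1 - m\<^sup>2) / (1 + m)\<^sup>2" by (simp add: power2_eq_square algebra_simps)
  also have "\<dots> \<le> (1 - m\<^sup>2) / (norm (1 - u))\<^sup>2"
    using m up pos by (intro divide_left_mono power_mono mult_pos_pos) (auto simp: power_le_one)
  finally show "(1 - t) / (1 + t) \<le> Re ((1 + u) / (1 - u))" unfolding eq .
qed

text \<open>Harnack's inequality for the positive harmonic function \<open>ln (M / \<bar>s\<bar>)\<close>, obtained from the Schwarz
  lemma applied to the Cayley transform of a logarithm of \<open>s / M\<close>.\<close>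

lemma Harnack_ln_norm:
  assumes hol: "s holomorphic_on ball p \<rho>" and rho: "0 < \<rho>"
    and nz: "\<And>z. z \<in> ball p \<rho> \<Longrightarrow> s z \<noteq> 0"
    and bd: "\<And>z. z \<in> ball p \<rho> \<Longrightarrow> norm (s z) < M"
    and z: "z \<in> ball p \<rho>"
  defines "K \<equiv> (\<rho> + dist p z) / (\<rho> - dist p z)"
  shows "ln (M / norm (s z)) \<le> K * ln (M / norm (s p))" "ln (M / norm (s p)) \<le> K * ln (M / norm (s z))"
proof -
  have M: "0 < M" by (rule le_less_trans[OF norm_ge_zero bd[of p]]) (use rho in simp)
  define \<sigma> where "\<sigma> \<zeta> = s (p + of_real \<rho> * \<zeta>) / of_real M" for \<zeta>
  have in_ball: "p + of_real \<rho> * \<zeta> \<in> ball p \<rho>" if "norm \<zeta> < 1" for \<zeta>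
    using that rho by (simp add: dist_norm norm_mult)
  have hol\<sigma>: "\<sigma> holomorphic_on ball 0 1"
    unfolding \<sigma>_def using in_ball M
    by (intro holomorphic_intros holomorphic_on_compose_gen[OF _ hol, unfolded o_def]) auto
  have nz\<sigma>: "\<sigma> \<zeta> \<noteq> 0" if "\<zeta> \<in> ball 0 1" for \<zeta> using nz[OF in_ball] M that by (simp add: \<sigma>_def)
  have "simply_connected (ball (0::complex) 1)" by (intro convex_imp_simply_connected convex_ball)
  then obtain G where G: "G holomorphic_on ball 0 1" "\<And>\<zeta>. \<zeta> \<in> ball 0 1 \<Longrightarrow> \<sigma> \<zeta> = exp (G \<zeta>)"
    using simply_connected_eq_holomorphic_log[OF open_ball] hol\<sigma> nz\<sigma> by metis
  have lnG: "ln (M / norm (s (p + of_real \<rho> * \<zeta>))) = - Re (G \<zeta>)" if "norm \<zeta> < 1" for \<zeta>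
  proof -
    have "norm (\<sigma> \<zeta>) = exp (Re (G \<zeta>))" using G(2)[of \<zeta>] that by simp
    moreover have "norm (\<sigma> \<zeta>) = norm (s (p + of_real \<rho> * \<zeta>)) / M" using M by (simp add: \<sigma>_def norm_divide)
    ultimately have "norm (s (p + of_real \<rho> * \<zeta>)) = M * exp (Re (G \<zeta>))" using M by (simp add: field_simps)
    then have "M / norm (s (p + of_real \<rho> * \<zeta>)) = exp (- Re (G \<zeta>))" using M by (simp add: exp_minus field_simps)
    then show ?thesis by simp
  qed
  have neg: "Re (G \<zeta>) < 0" if "norm \<zeta> < 1" for \<zeta>
  proof -
    have "1 < M / norm (s (p + of_real \<rho> * \<zeta>))"
      using bd[OF in_ball[OF that]] nz[OF in_ball[OF that]] by simp
    then have "0 < ln (M / norm (s (p + of_real \<rho> * \<zeta>)))" by simp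
    then show ?thesis using lnG[OF that] by simp
  qed
  define \<gamma> where "\<gamma> = G 0"
  define u where "u \<zeta> = (G \<zeta> - \<gamma>) / (G \<zeta> + cnj \<gamma>)" for \<zeta>
  have \<gamma>: "Re \<gamma> < 0" using neg[of 0] by (simp add: \<gamma>_def)
  have den: "G \<zeta> + cnj \<gamma> \<noteq> 0" if "norm \<zeta> < 1" for \<zeta>
  proof
    assume "G \<zeta> + cnj \<gamma> = 0"
    then have "Re (G \<zeta> + cnj \<gamma>) = 0" by (simp only: zero_complex.sel)
    then show False using neg[OF that] \<gamma> by simp
  qed
  have u1: "norm (u \<zeta>) < 1" if "norm \<zeta> < 1" for \<zeta>
  proof -
    have "(norm (G \<zeta> + cnj \<gamma>))\<^sup>2 - (norm (G \<zeta> - \<gamma>))\<^sup>2 = 4 * (Re (G \<zeta>) * Re \<gamma>)"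
      unfolding cmod_power2 by (simp add: power2_eq_square algebra_simps)
    moreover have "0 < Re (G \<zeta>) * Re \<gamma>" using neg[OF that] \<gamma> by (rule mult_neg_neg)
    ultimately have "(norm (G \<zeta> - \<gamma>))\<^sup>2 < (norm (G \<zeta> + cnj \<gamma>))\<^sup>2" by linarith
    then have "norm (G \<zeta> - \<gamma>) < norm (G \<zeta> + cnj \<gamma>)" by (rule power2_less_imp_less) simp
    moreover have "0 < norm (G \<zeta> + cnj \<gamma>)" using den[OF that] by simp
    ultimately show ?thesis unfolding u_def norm_divide by simp
  qed
  have holu: "u holomorphic_on ball 0 1"
    unfolding u_def using den by (intro holomorphic_intros G) auto
  have Schwarz: "norm (u \<zeta>) \<le> norm \<zeta>" if "norm \<zeta> < 1" for \<zeta>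
    by (rule Schwarz_Lemma(1)[OF holu _ u1 that]) (simp_all add: u_def \<gamma>_def)
  define \<zeta> where "\<zeta> = (z - p) / of_real \<rho>"
  define t where "t = norm \<zeta>"
  have t: "t = dist p z / \<rho>" using rho by (simp add: t_def \<zeta>_def norm_divide dist_norm norm_minus_commute)
  have t1: "0 \<le> t" "t < 1" using z rho unfolding t by auto
  have z\<zeta>: "p + of_real \<rho> * \<zeta> = z" using rho by (simp add: \<zeta>_def)
  have K: "K = (1 + t) / (1 - t)" unfolding K_def t using rho z by (simp add: field_simps)
  have ut: "norm (u \<zeta>) \<le> t" using Schwarz[of \<zeta>] t1 by (simp add: t_def)
  then have u1': "norm (u \<zeta>) < 1" using t1 by simp
  then have nu: "1 - u \<zeta> \<noteq> 0" by auto
  have "u \<zeta> * (G \<zeta> + cnj \<gamma>) = G \<zeta> - \<gamma>" using den[of \<zeta>] t1 by (simp add: u_def t_def)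
  then have "G \<zeta> * (1 - u \<zeta>) = of_real (Re \<gamma>) * (1 + u \<zeta>) + \<i> * of_real (Im \<gamma>) * (1 - u \<zeta>)"
    by (simp add: algebra_simps complex_eq_iff)
  then have "G \<zeta> = of_real (Re \<gamma>) * ((1 + u \<zeta>) / (1 - u \<zeta>)) + \<i> * of_real (Im \<gamma>)"
    using nu by (simp add: divide_simps)
  moreover have "Re (of_real x * q + \<i> * of_real y) = x * Re q" for x y and q :: complex by simp
  ultimately have ReG: "Re (G \<zeta>) = Re \<gamma> * Re ((1 + u \<zeta>) / (1 - u \<zeta>))" by metis
  note C = Re_Cayley_bounds[OF ut t1(2)]
  have v: "ln (M / norm (s z)) = - Re (G \<zeta>)" "ln (M / norm (s p)) = - Re \<gamma>"
    using lnG[of \<zeta>] lnG[of 0] t1 z\<zeta> by (auto simp: t_def \<gamma>_def)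
  have g0: "0 \<le> - Re \<gamma>" using \<gamma> by simp
  show "ln (M / norm (s z)) \<le> K * ln (M / norm (s p))"
    unfolding v ReG K using mult_left_mono[OF C(1) g0] by (simp add: mult.commute)
  have "- Re \<gamma> * ((1 - t) / (1 + t)) \<le> - Re (G \<zeta>)"
    unfolding ReG using mult_left_mono[OF C(2) g0] by simp
  then have "(1 + t) / (1 - t) * (- Re \<gamma> * ((1 - t) / (1 + t))) \<le> (1 + t) / (1 - t) * (- Re (G \<zeta>))"
    using t1 by (intro mult_left_mono) auto
  moreover have "(1 + t) / (1 - t) * (- Re \<gamma> * ((1 - t) / (1 + t))) = - Re \<gamma>"
    using t1 by (simp add: nonzero_divide_eq_eq)
  ultimately show "ln (M / norm (s p)) \<le> K * ln (M / norm (s z))"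
    unfolding v K by simp
qed

text \<open>A lower bound for \<open>f\<close> at one point \<open>a\<close> of a disc controls the quotient in the whole disc.  The
  factor \<open>2 * M\<close> in place of \<open>M\<close> makes the inequality required by \<open>Harnack_ln_norm\<close> strict.\<close>

lemma norm_quotient_le:
  assumes S: "open S" "connected S" and ball: "cball p \<rho> \<subseteq> S" and rho: "0 < \<rho>"
    and a: "a \<in> ball p \<rho>" and z: "z \<in> ball p \<rho>" and \<theta>: "\<theta> holomorphic_on S"
    and f: "f holomorphic_on S" "f a \<noteq> 0"
    and fM: "\<And>z. z \<in> cball p \<rho> \<Longrightarrow> norm (f z) \<le> M"
    and gN: "\<And>z. z \<in> cball p \<rho> \<Longrightarrow> norm (\<theta> z * f z) \<le> N"
  defines "K \<equiv> \<lambda>z. (\<rho> + dist p z) / (\<rho> - dist p z)"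
  shows "norm (\<theta> z) \<le> N / (2 * M) * exp (K z * (K a * ln (2 * M / norm (f a))))"
proof -
  obtain s where s: "s holomorphic_on S" "norm (f a) \<le> norm (s a)" "\<And>z. z \<in> ball p \<rho> \<Longrightarrow> s z \<noteq> 0"
     "\<And>z. z \<in> cball p \<rho> \<Longrightarrow> norm (s z) \<le> M" "\<And>z. z \<in> cball p \<rho> \<Longrightarrow> norm (\<theta> z * s z) \<le> N"
    using divide_out_zeros_in_disc[OF S ball rho a \<theta> f fM gN] by blast
  have "norm (s a) \<le> M" using s(4)[of a] a by simp
  moreover have "0 < norm (f a)" using f(2) by simp
  ultimately have M: "0 < M" using s(2) by linarith
  have hs: "s holomorphic_on ball p \<rho>" by (rule holomorphic_on_subset[OF s(1)]) (use ball in auto)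
  have bd: "norm (s z) < 2 * M" if "z \<in> ball p \<rho>" for z using s(4)[of z] that M by auto
  note H = Harnack_ln_norm[OF hs rho s(3) bd]
  have K0: "0 \<le> K w" if "w \<in> ball p \<rho>" for w using that rho by (simp add: K_def)
  have "ln (2 * M / norm (s z)) \<le> K z * ln (2 * M / norm (s p))" unfolding K_def by (rule H(1)[OF _ _ z])
  also have "\<dots> \<le> K z * (K a * ln (2 * M / norm (s a)))"
    unfolding K_def using K0[OF z] by (intro mult_left_mono H(2)[OF _ _ a]) (auto simp: K_def)
  also have "\<dots> \<le> K z * (K a * ln (2 * M / norm (f a)))"
  proof (intro mult_left_mono K0 z a)
    show "ln (2 * M / norm (s a)) \<le> ln (2 * M / norm (f a))"
      using s(2) s(3)[OF a] f(2) M by (intro ln_mono divide_left_mono) auto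
  qed
  finally have v: "ln (2 * M / norm (s z)) \<le> K z * (K a * ln (2 * M / norm (f a)))" .
  have sz: "0 < norm (s z)" using s(3)[OF z] by simp
  have N0: "0 \<le> N" using order_trans[OF norm_ge_zero s(5)[of z]] z by simp
  have "norm (\<theta> z) * norm (s z) \<le> N" using s(5)[of z] z by (simp add: norm_mult)
  then have "norm (\<theta> z) \<le> N / norm (s z)" using sz by (simp add: field_simps)
  also have "\<dots> = N / (2 * M) * (2 * M / norm (s z))" using M sz by simp
  also have "\<dots> = N / (2 * M) * exp (ln (2 * M / norm (s z)))" using M sz by simp
  also have "\<dots> \<le> N / (2 * M) * exp (K z * (K a * ln (2 * M / norm (f a))))"
    using v N0 M by (intro mult_left_mono) auto
  finally show ?thesis .
qed

section \<open>Entire quotients of minimal type\<close>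

text \<open>The growth condition common to all steps \<open>P\<^sub>k\<close>, with an arbitrary exponential type and with the
  factor \<open>r\<^sub>k\<close> replaced by \<open>1\<close>.\<close>

definition Cartwright_bounded :: "(real \<Rightarrow> real) \<Rightarrow> (complex \<Rightarrow> complex) \<Rightarrow> bool" where
  "Cartwright_bounded \<omega> f \<longleftrightarrow> f holomorphic_on UNIV \<and>
     (\<exists>M c. 0 < M \<and> 0 \<le> c \<and> (\<forall>z. norm (f z) \<le> M * exp (\<omega> (norm z) + c * \<bar>Im z\<bar>)))"

lemma Cartwright_bounded_uminus:
  assumes "Cartwright_bounded \<omega> f"
  shows "Cartwright_bounded \<omega> (\<lambda>z. f (- z))"
proof -
  obtain M c where f: "f holomorphic_on UNIV" "0 < M" "0 \<le> c" "\<And>z. norm (f z) \<le> M * exp (\<omega> (norm z) + c * \<bar>Im z\<bar>)"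
    using assms unfolding Cartwright_bounded_def by blast
  have "(\<lambda>z. f (- z)) holomorphic_on UNIV"
    by (rule holomorphic_on_compose_gen[OF _ f(1), unfolded o_def]) (auto intro!: holomorphic_intros)
  moreover have "norm (f (- z)) \<le> M * exp (\<omega> (norm z) + c * \<bar>Im z\<bar>)" for z
    using f(4)[of "- z"] by simp
  ultimately show ?thesis using f(2,3) unfolding Cartwright_bounded_def by blast
qed

lemma indicator_fun_uminus: "indicator_fun (\<lambda>z. f (- z)) (pi / 2) = indicator_fun f (- pi / 2)"
proof -
  have "- (of_real t * cis (pi / 2)) = of_real t * cis (- pi / 2)" for t
    by (simp add: complex_eq_iff)
  then show ?thesis unfolding indicator_fun_def by (simp only:)
qed

lemma indicator_fun_upper_le_iff:
  "indicator_fun f (pi / 2) \<le> D \<longleftrightarrow>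
    (\<forall>d. D < ereal d \<longrightarrow> (\<forall>\<^sub>F t in at_top. norm (f (\<i> * of_real t)) \<le> exp (d * t)))"
proof -
  have "of_real t * cis (pi / 2) = \<i> * of_real t" for t :: real by (simp add: mult.commute)
  then show ?thesis unfolding indicator_le_iff by (simp only:)
qed

lemma indicator_fun_upper_le_ereal_iff:
  "indicator_fun f (pi / 2) \<le> ereal d \<longleftrightarrow>
    (\<forall>e>0. \<forall>\<^sub>F t in at_top. norm (f (\<i> * of_real t)) \<le> exp ((d + e) * t))"
  unfolding indicator_fun_upper_le_iff
proof (intro iffI allI impI)
  fix e :: real assume "\<forall>da. ereal d < ereal da \<longrightarrow> (\<forall>\<^sub>F t in at_top. norm (f (\<i> * of_real t)) \<le> exp (da * t))" "0 < e"
  then show "\<forall>\<^sub>F t in at_top. norm (f (\<i> * of_real t)) \<le> exp ((d + e) * t)" by simp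
next
  fix d' assume "\<forall>e>0. \<forall>\<^sub>F t in at_top. norm (f (\<i> * of_real t)) \<le> exp ((d + e) * t)" "ereal d < ereal d'"
  then have "\<forall>\<^sub>F t in at_top. norm (f (\<i> * of_real t)) \<le> exp ((d + (d' - d)) * t)" by (metis diff_gt_0_iff_gt less_ereal.simps(1))
  then show "\<forall>\<^sub>F t in at_top. norm (f (\<i> * of_real t)) \<le> exp (d' * t)" by simp
qed

lemma indicator_fun_upper_frequently:
  assumes "ereal d < indicator_fun f (pi / 2)"
  shows "\<exists>\<^sub>F t in at_top. exp (d * t) \<le> norm (f (\<i> * of_real t))"
proof -
  obtain d' where d': "d < d'" "\<not> (\<forall>\<^sub>F t in at_top. norm (f (\<i> * of_real t)) \<le> exp (d' * t))"
    using assms unfolding not_le[symmetric] indicator_fun_upper_le_iff by auto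
  have "\<exists>\<^sub>F t in at_top. \<not> norm (f (\<i> * of_real t)) \<le> exp (d' * t)"
    using d'(2) unfolding frequently_def by simp
  then have "\<exists>\<^sub>F t in at_top. 0 \<le> t \<and> \<not> norm (f (\<i> * of_real t)) \<le> exp (d' * t)"
    using eventually_ge_at_top by (rule frequently_eventually_conj)
  then show ?thesis
  proof (rule frequently_elim1)
    fix t :: real assume t: "0 \<le> t \<and> \<not> norm (f (\<i> * of_real t)) \<le> exp (d' * t)"
    have "d * t \<le> d' * t" using d'(1) t by (intro mult_right_mono) auto
    then have "exp (d * t) \<le> exp (d' * t)" by simp
    then show "exp (d * t) \<le> norm (f (\<i> * of_real t))" using t by linarith
  qed
qed

text \<open>If the indicator were \<open>-\<infinity>\<close>, then \<open>f\<close> would be majorized with every real \<open>d\<close> and hence vanish.\<close>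

lemma indicator_upper_finite:
  assumes w: "admissible_weight \<omega>" and f: "Cartwright_bounded \<omega> f" and nz: "f \<noteq> (\<lambda>z. 0)"
  shows "\<exists>d. indicator_fun f (pi / 2) = ereal d"
proof -
  obtain M c where M: "f holomorphic_on UNIV" "0 < M" "0 \<le> c" "\<And>z. norm (f z) \<le> M * exp (\<omega> (norm z) + c * \<bar>Im z\<bar>)"
    using f unfolding Cartwright_bounded_def by blast
  have "indicator_fun f (pi / 2) \<le> ereal c"
    unfolding indicator_fun_upper_le_ereal_iff
  proof (intro allI impI)
    fix e :: real assume e: "0 < e"
    have "\<forall>\<^sub>F t in at_top. \<omega> t \<le> e / 2 * t" using e by (intro weight_sublinear w) simp
    moreover have "\<forall>\<^sub>F t in at_top. max 0 (2 * ln M / e) \<le> t" by (rule eventually_ge_at_top)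
    ultimately show "\<forall>\<^sub>F t in at_top. norm (f (\<i> * of_real t)) \<le> exp ((c + e) * t)"
    proof eventually_elim
      case (elim t)
      have t: "0 \<le> t" "ln M \<le> e / 2 * t" using elim e by (auto simp: field_simps)
      have "norm (f (\<i> * of_real t)) \<le> M * exp (\<omega> t + c * t)" using M(4)[of "\<i> * of_real t"] t by (simp add: norm_mult)
      also have "\<dots> = exp (ln M + (\<omega> t + c * t))" using M(2) by (simp add: exp_add)
      also have "\<dots> \<le> exp ((c + e) * t)" using t elim by (simp add: algebra_simps)
      finally show ?case .
    qed
  qed
  moreover have "indicator_fun f (pi / 2) \<noteq> -\<infinity>"
  proof
    assume inf: "indicator_fun f (pi / 2) = -\<infinity>"
    have zero: "f z = 0" if z: "0 < Im z" for z
    proof (rule ccontr)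
      assume "f z \<noteq> 0"
      then have fz: "0 < norm (f z)" by simp
      define L where "L = M * exp (\<omega> 1) * exp (4 * Re (weight_majorant \<omega> (- \<i> * z)))"
      have L: "0 < L" using M(2) by (simp add: L_def)
      define d where "d = (ln (norm (f z) / L) - 1) / Im z"
      have "indicator_fun f (pi / 2) \<le> ereal d" by (simp add: inf)
      then have "norm (f z) \<le> M * exp (\<omega> 1) * exp (d * Im z + 4 * Re (weight_majorant \<omega> (- \<i> * z)))"
        unfolding indicator_fun_upper_le_ereal_iff
        by (intro majorized_in_upper_half_plane[OF w M(1-3)] M(4)) (use z in auto)
      also have "\<dots> = L * exp (d * Im z)" by (simp add: L_def exp_add)
      also have "\<dots> = norm (f z) * exp (- 1)"
      proof -
        have "d * Im z = ln (norm (f z) / L) - 1" using z by (simp add: d_def)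
        then have "exp (d * Im z) = norm (f z) / L * exp (- 1)"
          using fz L by (simp only: diff_conv_add_uminus exp_add) simp
        then show ?thesis using L by simp
      qed
      also have "\<dots> < norm (f z) * 1" using fz by (intro mult_strict_left_mono) auto
      finally show False by simp
    qed
    have "f z = 0" for z
    proof (rule analytic_continuation[OF M(1) open_UNIV connected_UNIV, of "{z. 0 < Im z}" \<i>])
      show "\<i> islimpt {z. 0 < Im z}"
        by (rule interior_limit_point) (simp add: interior_open open_Collect_less continuous_intros)
    qed (use zero in auto)
    then show False using nz by auto
  qed
  ultimately show ?thesis by (cases "indicator_fun f (pi / 2)") auto
qed

text \<open>After multiplication by exponentials and by the majorant of the weight, \<open>f\<close> and \<open>\<theta> * f\<close> are bounded
  in the half-plane.  At some distant point \<open>a\<close> of the imaginary axis \<open>f\<close> is almost as large as its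
  indicator permits.  For every \<open>T \<ge> \<bar>a\<bar>\<close> the disc of radius \<open>T\<close> about \<open>\<i> * T\<close>, which touches the
  real axis at \<open>0\<close>, contains \<open>a\<close>, and its Harnack constant at \<open>a\<close> is of order \<open>T / \<bar>a\<bar>\<close>.  So a single
  point yields the estimate at all larger distances.\<close>

lemma quotient_in_upper_sector:
  assumes w: "admissible_weight \<omega>" and \<theta>: "\<theta> holomorphic_on UNIV"
    and f: "Cartwright_bounded \<omega> f" and g: "Cartwright_bounded \<omega> (\<lambda>z. \<theta> z * f z)"
    and nz: "f \<noteq> (\<lambda>z. 0)" and e: "0 < e"
    and ind: "indicator_fun (\<lambda>z. \<theta> z * f z) (pi / 2) \<le> indicator_fun f (pi / 2) + ereal e"
  shows "\<exists>R. \<forall>z. \<bar>Re z\<bar> \<le> Im z \<longrightarrow> R \<le> norm z \<longrightarrow> norm (\<theta> z) \<le> exp (55 * e * norm z)"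
proof -
  obtain d where d: "indicator_fun f (pi / 2) = ereal d" using indicator_upper_finite[OF w f nz] by blast
  obtain M1 c1 where f1: "f holomorphic_on UNIV" "0 < M1" "0 \<le> c1" "\<And>z. norm (f z) \<le> M1 * exp (\<omega> (norm z) + c1 * \<bar>Im z\<bar>)"
    using f unfolding Cartwright_bounded_def by blast
  obtain M2 c2 where g2: "(\<lambda>z. \<theta> z * f z) holomorphic_on UNIV" "0 < M2" "0 \<le> c2"
      "\<And>z. norm (\<theta> z * f z) \<le> M2 * exp (\<omega> (norm z) + c2 * \<bar>Im z\<bar>)"
    using g unfolding Cartwright_bounded_def by blast
  define M where "M = max M1 M2 * exp (\<omega> 1)"
  have M: "0 < M" "M1 * exp (\<omega> 1) \<le> M" "M2 * exp (\<omega> 1) \<le> M" using f1(2) by (auto simp: M_def)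
  define F where "F z = weight_majorant \<omega> (- \<i> * z)" for z
  define S where "S = {z. - 1/2 < Im z}"
  have S: "open S" "connected S" unfolding S_def
    by (intro open_Collect_less continuous_intros, intro convex_connected convex_halfspace_Im_gt)
  have FS: "F holomorphic_on S" unfolding F_def S_def
    by (rule holomorphic_on_compose_gen[OF _ weight_majorant_holomorphic[OF w], unfolded o_def])
       (auto intro!: holomorphic_intros)
  define fh where "fh z = f z * exp (\<i> * of_real d * z - 4 * F z)" for z
  define th where "th z = \<theta> z * exp (\<i> * of_real e * z)" for z
  have nfh: "norm (fh z) = norm (f z) * exp (- d * Im z - 4 * Re (F z))" for z
    by (simp add: fh_def norm_mult)
  have nth: "norm (th z) = norm (\<theta> z) * exp (- e * Im z)" for z by (simp add: th_def norm_mult)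
  have fhM: "norm (fh z) \<le> M" if z: "0 \<le> Im z" for z
  proof -
    have "indicator_fun f (pi / 2) \<le> ereal d" by (simp add: d)
    then have "norm (f z) \<le> M1 * exp (\<omega> 1) * exp (d * Im z + 4 * Re (F z))"
      unfolding indicator_fun_upper_le_ereal_iff F_def
      by (intro majorized_in_upper_half_plane[OF w f1(1-3)] f1(4)) (use z in auto)
    then have "norm (fh z) \<le> M1 * exp (\<omega> 1) * exp (d * Im z + 4 * Re (F z)) * exp (- d * Im z - 4 * Re (F z))"
      unfolding nfh by (rule mult_right_mono) simp
    also have "\<dots> = M1 * exp (\<omega> 1) * (exp (d * Im z + 4 * Re (F z)) * exp (- d * Im z - 4 * Re (F z)))"
      by (rule mult.assoc)
    also have "\<dots> = M1 * exp (\<omega> 1)" unfolding mult_exp_exp by simp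
    finally show ?thesis using M(2) by linarith
  qed
  have ghM: "norm (th z * fh z) \<le> M" if z: "0 \<le> Im z" for z
  proof -
    have "indicator_fun (\<lambda>z. \<theta> z * f z) (pi / 2) \<le> ereal (d + e)" using ind by (simp add: d)
    then have "norm (\<theta> z * f z) \<le> M2 * exp (\<omega> 1) * exp ((d + e) * Im z + 4 * Re (F z))"
      unfolding indicator_fun_upper_le_ereal_iff F_def
      by (intro majorized_in_upper_half_plane[OF w g2(1-3)] g2(4)) (use z in auto)
    then have "norm (\<theta> z * f z) * exp (- (d + e) * Im z - 4 * Re (F z))
       \<le> M2 * exp (\<omega> 1) * exp ((d + e) * Im z + 4 * Re (F z)) * exp (- (d + e) * Im z - 4 * Re (F z))"
      by (rule mult_right_mono) simp
    also have "\<dots> = M2 * exp (\<omega> 1) * (exp ((d + e) * Im z + 4 * Re (F z)) * exp (- (d + e) * Im z - 4 * Re (F z)))"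
      by (rule mult.assoc)
    also have "\<dots> = M2 * exp (\<omega> 1)" unfolding mult_exp_exp by (simp add: algebra_simps)
    also have "norm (\<theta> z * f z) * exp (- (d + e) * Im z - 4 * Re (F z)) = norm (th z * fh z)"
    proof -
      have "exp (- (d + e) * Im z - 4 * Re (F z)) = exp (- e * Im z) * exp (- d * Im z - 4 * Re (F z))"
        unfolding mult_exp_exp by (simp add: algebra_simps)
      then show ?thesis unfolding norm_mult nth nfh by simp
    qed
    finally show ?thesis using M(3) by linarith
  qed
  \<comment> \<open>a point of the imaginary axis where \<open>f\<close> is nearly as large as its indicator permits\<close>
  have "ereal (d - e) < indicator_fun f (pi / 2)" using e by (simp add: d)
  then have "\<exists>\<^sub>F t in at_top. exp ((d - e) * t) \<le> norm (f (\<i> * of_real t))"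
    by (rule indicator_fun_upper_frequently)
  moreover have "\<forall>\<^sub>F t in at_top. Re (weight_majorant \<omega> (of_real t)) \<le> e / 4 * t"
    using e by (intro weight_majorant_sublinear w) simp
  then have "\<forall>\<^sub>F t in at_top. Re (weight_majorant \<omega> (of_real t)) \<le> e / 4 * t \<and> max 1 (ln (2 * M) / e) \<le> t"
    using eventually_ge_at_top by (rule eventually_conj)
  ultimately have "\<exists>\<^sub>F t in at_top. (Re (weight_majorant \<omega> (of_real t)) \<le> e / 4 * t \<and> max 1 (ln (2 * M) / e) \<le> t)
      \<and> exp ((d - e) * t) \<le> norm (f (\<i> * of_real t))"
    by (rule frequently_eventually_conj)
  then obtain R where R: "exp ((d - e) * R) \<le> norm (f (\<i> * of_real R))"
      "Re (weight_majorant \<omega> (of_real R)) \<le> e / 4 * R" "1 \<le> R" "ln (2 * M) / e \<le> R"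
    by (auto dest!: frequently_ex)
  define a where "a = \<i> * complex_of_real R"
  have Fa: "F a = weight_majorant \<omega> (of_real R)" by (simp add: F_def a_def)
  have fha: "exp (- 2 * e * R) \<le> norm (fh a)"
  proof -
    have "exp (- 2 * e * R) \<le> exp ((d - e) * R + (- d * R - 4 * Re (F a)))"
      using R(2) unfolding Fa by (simp add: algebra_simps)
    also have "\<dots> = exp ((d - e) * R) * exp (- d * R - 4 * Re (F a))" by (rule exp_add)
    also have "\<dots> \<le> norm (f a) * exp (- d * Im a - 4 * Re (F a))"
      using R(1) by (simp add: a_def)
    finally show ?thesis unfolding nfh .
  qed
  have fha0: "0 < norm (fh a)" using fha exp_gt_zero less_le_trans by blast
  have lnfha: "ln (2 * M / norm (fh a)) \<le> 3 * e * R"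
  proof -
    have "- 2 * e * R \<le> ln (norm (fh a))" using fha fha0 by (simp add: ln_ge_iff)
    moreover have "ln (2 * M) \<le> e * R" using R(4) e by (simp add: field_simps)
    ultimately show ?thesis using M fha0 by (simp add: ln_div)
  qed
  have "norm (\<theta> z) \<le> exp (55 * e * norm z)" if z: "\<bar>Re z\<bar> \<le> Im z" and zR: "R \<le> norm z" for z
  proof -
    \<comment> \<open>\<open>z\<close> lies well inside the disc because of \<open>\<bar>Re z\<bar> \<le> Im z\<close>\<close>
    define T where "T = norm z"
    define p where "p = \<i> * complex_of_real T"
    have T: "R \<le> T" "1 \<le> T" using zR R(3) by (auto simp: T_def)
    have Im0: "0 \<le> Im v" if "v \<in> cball p T" for v
      using that abs_Im_le_cmod[of "p - v"] by (auto simp: dist_norm p_def)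
    have ballS: "cball p T \<subseteq> S" using Im0 by (force simp: S_def)
    have dpa: "dist p a = T - R"
      using T by (simp add: p_def a_def dist_norm right_diff_distrib[symmetric] norm_mult flip: of_real_diff)
    have dpz: "dist p z \<le> 78/100 * T"
    proof (rule power2_le_imp_le)
      have T2: "T\<^sup>2 = (Re z)\<^sup>2 + (Im z)\<^sup>2" by (simp add: T_def cmod_power2)
      have "(Re z)\<^sup>2 \<le> (Im z)\<^sup>2" using z by (simp add: abs_le_square_iff[symmetric])
      then have "49 * (Re z)\<^sup>2 \<le> 51 * (Im z)\<^sup>2" using zero_le_power2[of "Im z"] by linarith
      then have "(7/10 * T)\<^sup>2 \<le> (Im z)\<^sup>2" using T2 by (simp add: power_mult_distrib power_divide)
      then have "7/10 * T \<le> Im z" by (rule power2_le_imp_le) (use z in auto)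
      then have "T * (7/10 * T) \<le> T * Im z" using T by (intro mult_left_mono) auto
      moreover have "(dist p z)\<^sup>2 = T\<^sup>2 + T\<^sup>2 - 2 * (T * Im z)"
        unfolding dist_norm cmod_power2 T2 by (simp add: p_def power2_eq_square algebra_simps)
           (simp add: T2[unfolded power2_eq_square])
      moreover have "0 \<le> T * T" by simp
      moreover have "(78/100 * T)\<^sup>2 = 6084/10000 * (T * T)" "T * (7/10 * T) = 7/10 * (T * T)" "T\<^sup>2 = T * T"
        by (simp_all add: power2_eq_square)
      ultimately show "(dist p z)\<^sup>2 \<le> (78/100 * T)\<^sup>2" by linarith
    qed (use T in auto)
    define K where "K v = (T + dist p v) / (T - dist p v)" for v
    have "norm (th z) \<le> M / (2 * M) * exp (K z * (K a * ln (2 * M / norm (fh a))))"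
      unfolding K_def
    proof (rule norm_quotient_le[OF S ballS])
      show "0 < T" using T by simp
      show "a \<in> ball p T" using dpa T R by simp
      show "z \<in> ball p T" using dpz T by simp
      show "th holomorphic_on S" unfolding th_def
        by (intro holomorphic_intros holomorphic_on_subset[OF \<theta>]) auto
      show "fh holomorphic_on S" unfolding fh_def
        by (intro holomorphic_intros FS holomorphic_on_subset[OF f1(1)]) auto
      show "fh a \<noteq> 0" using fha0 by auto
    qed (use Im0 fhM ghM in auto)
    also have "\<dots> \<le> 1 * exp (54 * e * T)"
    proof (rule mult_mono[OF _ iffD2[OF exp_le_cancel_iff]])
      have "K z \<le> (T + 78/100 * T) / (T - 78/100 * T)"
        unfolding K_def using dpz T by (intro frac_le) auto
      also have "\<dots> \<le> 9" using T by (simp add: field_simps)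
      finally have Kz: "K z \<le> 9" .
      have Kz0: "0 \<le> K z" unfolding K_def using dpz T by auto
      have Ka: "K a = (2 * T - R) / R" using T by (simp add: K_def dpa)
      have Ka0: "0 \<le> K a" unfolding Ka using T R by simp
      have "K a \<le> 2 * T / R" unfolding Ka using T R by (intro divide_right_mono) auto
      then have Ka1: "K a * (3 * e * R) \<le> 2 * T / R * (3 * e * R)" using e R by (intro mult_right_mono) auto
      have "K a * ln (2 * M / norm (fh a)) \<le> K a * (3 * e * R)" using lnfha Ka0 by (rule mult_left_mono)
      also have "\<dots> \<le> 2 * T / R * (3 * e * R)" by (rule Ka1)
      also have "\<dots> = 6 * e * T" using R by simp
      finally have "K z * (K a * ln (2 * M / norm (fh a))) \<le> K z * (6 * e * T)" using Kz0 by (rule mult_left_mono)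
      also have "\<dots> \<le> 9 * (6 * e * T)" using Kz e T by (intro mult_right_mono) auto
      finally show "K z * (K a * ln (2 * M / norm (fh a))) \<le> 54 * e * T" by simp
    qed (use M in auto)
    finally have "norm (th z) \<le> exp (54 * e * T)" by simp
    then have "norm (\<theta> z) * exp (- e * Im z) * exp (e * Im z) \<le> exp (54 * e * T) * exp (e * Im z)"
      unfolding nth by (rule mult_right_mono) simp
    moreover have "norm (\<theta> z) * exp (- e * Im z) * exp (e * Im z) = norm (\<theta> z)"
      by (simp add: mult.assoc mult_exp_exp)
    moreover have "exp (54 * e * T) * exp (e * Im z) \<le> exp (55 * e * T)"
    proof -
      have "Im z \<le> T" using abs_Im_le_cmod[of z] by (simp add: T_def)
      then have "e * Im z \<le> e * T" using e by (intro mult_left_mono) auto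
      moreover have "55 * e * T = 54 * e * T + e * T" by (simp add: algebra_simps)
      ultimately have "54 * e * T + e * Im z \<le> 55 * e * T" by linarith
      then show ?thesis unfolding mult_exp_exp by simp
    qed
    ultimately have "norm (\<theta> z) \<le> exp (55 * e * T)" by linarith
    then show ?thesis by (simp add: T_def)
  qed
  then show ?thesis by blast
qed

lemma quotient_exponential_type:
  assumes w: "admissible_weight \<omega>" and \<theta>: "\<theta> holomorphic_on UNIV"
    and f: "Cartwright_bounded \<omega> f" and g: "Cartwright_bounded \<omega> (\<lambda>z. \<theta> z * f z)"
    and nz: "f \<noteq> (\<lambda>z. 0)"
  shows "\<exists>C. \<forall>z. norm (\<theta> z) \<le> C * exp (C * norm z)"
proof -
  obtain M1 c1 where f1: "f holomorphic_on UNIV" "0 < M1" "0 \<le> c1" "\<And>z. norm (f z) \<le> M1 * exp (\<omega> (norm z) + c1 * \<bar>Im z\<bar>)"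
    using f unfolding Cartwright_bounded_def by blast
  obtain M2 c2 where g2: "(\<lambda>z. \<theta> z * f z) holomorphic_on UNIV" "0 < M2" "0 \<le> c2"
      "\<And>z. norm (\<theta> z * f z) \<le> M2 * exp (\<omega> (norm z) + c2 * \<bar>Im z\<bar>)"
    using g unfolding Cartwright_bounded_def by blast
  obtain A where A: "0 \<le> A" "\<And>x. 0 \<le> x \<Longrightarrow> \<omega> x \<le> A + x" using weight_le_linear[OF w] by blast
  define M c where "M = max M1 M2" and "c = max c1 c2"
  have M: "0 < M" "M1 \<le> M" "M2 \<le> M" "0 \<le> c" "c1 \<le> c" "c2 \<le> c" using f1 by (auto simp: M_def c_def)
  obtain p where p: "f p \<noteq> 0" using nz by auto
  define L where "L = ln (2 * M / norm (f p)) + A"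
  define B where "B = \<bar>L\<bar> + (1 + c) * (3 * norm p + 2)"
  have B0: "0 \<le> B" using M by (simp add: B_def)
  have bd: "norm (\<theta> z) \<le> exp (3 * (B + 2 * (1 + c) * norm z))" for z
  proof -
    define \<rho> where "\<rho> = 2 * (norm z + norm p + 1)"
    have rho: "0 < \<rho>" by (simp add: \<rho>_def add_nonneg_pos)
    define E where "E = A + (1 + c) * (norm p + \<rho>)"
    have expo: "exp (\<omega> (norm v) + c' * \<bar>Im v\<bar>) \<le> exp E" if v: "v \<in> cball p \<rho>" and c': "0 \<le> c'" "c' \<le> c" for v c'
    proof -
      have nv: "norm v \<le> norm p + \<rho>"
        using v norm_triangle_ineq2[of v p] by (simp add: dist_norm norm_minus_commute)
      have "\<omega> (norm v) \<le> A + norm v" by (intro A) simp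
      moreover have "c' * \<bar>Im v\<bar> \<le> c * norm v" using c' by (intro mult_mono abs_Im_le_cmod) auto
      moreover have "(1 + c) * norm v \<le> (1 + c) * (norm p + \<rho>)" using nv M by (intro mult_left_mono) auto
      ultimately have "\<omega> (norm v) + c' * \<bar>Im v\<bar> \<le> E" by (simp add: E_def algebra_simps)
      then show ?thesis by simp
    qed
    define K where "K v = (\<rho> + dist p v) / (\<rho> - dist p v)" for v
    have dz: "dist p z \<le> \<rho> / 2"
      using norm_triangle_ineq4[of p z] by (simp add: dist_norm \<rho>_def)
    have "norm (\<theta> z) \<le> (M * exp E) / (2 * (M * exp E)) * exp (K z * (K p * ln (2 * (M * exp E) / norm (f p))))"
      unfolding K_def
    proof (rule norm_quotient_le[OF open_UNIV connected_UNIV _ rho _ _ \<theta> f1(1) p])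
      show "z \<in> ball p \<rho>" using dz rho by simp
      fix v assume v: "v \<in> cball p \<rho>"
      have "norm (f v) \<le> M1 * exp (\<omega> (norm v) + c1 * \<bar>Im v\<bar>)" by (rule f1)
      also have "\<dots> \<le> M * exp E" using M f1 by (intro mult_mono expo v) auto
      finally show "norm (f v) \<le> M * exp E" .
      have "norm (\<theta> v * f v) \<le> M2 * exp (\<omega> (norm v) + c2 * \<bar>Im v\<bar>)" by (rule g2)
      also have "\<dots> \<le> M * exp E" using M g2 by (intro mult_mono expo v) auto
      finally show "norm (\<theta> v * f v) \<le> M * exp E" .
    qed (use rho in auto)
    also have "\<dots> \<le> 1 * exp (3 * (B + 2 * (1 + c) * norm z))"
    proof (rule mult_mono[OF _ iffD2[OF exp_le_cancel_iff]])
      have Kp: "K p = 1" using rho by (simp add: K_def)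
      have "K z \<le> (\<rho> + \<rho> / 2) / (\<rho> - \<rho> / 2)" unfolding K_def using dz rho by (intro frac_le) auto
      also have "\<dots> = 3" using rho by (simp add: field_simps)
      finally have Kz: "K z \<le> 3" .
      have Kz0: "0 \<le> K z" unfolding K_def using dz rho by auto
      have "ln (2 * (M * exp E) / norm (f p)) = ln (2 * M / norm (f p)) + E"
        using M p by (simp add: ln_div ln_mult)
      also have "\<dots> \<le> B + 2 * (1 + c) * norm z"
        by (simp add: B_def L_def E_def \<rho>_def algebra_simps)
      finally have "K z * ln (2 * (M * exp E) / norm (f p)) \<le> K z * (B + 2 * (1 + c) * norm z)"
        using Kz0 by (rule mult_left_mono)
      also have "\<dots> \<le> 3 * (B + 2 * (1 + c) * norm z)"
        using Kz B0 M by (intro mult_right_mono) auto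
      finally show "K z * (K p * ln (2 * (M * exp E) / norm (f p))) \<le> 3 * (B + 2 * (1 + c) * norm z)"
        by (simp add: Kp)
    qed (use M in auto)
    finally show ?thesis by simp
  qed
  define C where "C = max (exp (3 * B)) (6 * (1 + c))"
  have "norm (\<theta> z) \<le> C * exp (C * norm z)" for z
  proof -
    have "norm (\<theta> z) \<le> exp (3 * B) * exp (6 * (1 + c) * norm z)"
      using bd[of z] unfolding mult_exp_exp by (simp add: algebra_simps)
    also have "\<dots> \<le> C * exp (C * norm z)"
      by (intro mult_mono) (auto simp: C_def le_max_iff_disj intro!: mult_right_mono)
    finally show ?thesis .
  qed
  then show ?thesis by blast
qed

text \<open>The sectors about the imaginary axis have angle \<open>\<pi>/2\<close>; the Phragmen--Lindelof principle covers the
  two complementary ones.\<close>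

lemma minimal_typeI:
  assumes hol: "\<theta> holomorphic_on UNIV" and C: "\<And>z. norm (\<theta> z) \<le> C * exp (C * norm z)"
    and sector: "\<And>e. 0 < e \<Longrightarrow> \<exists>R. \<forall>z. \<bar>Re z\<bar> \<le> \<bar>Im z\<bar> \<longrightarrow> R \<le> norm z \<longrightarrow> norm (\<theta> z) \<le> exp (e * norm z)"
  shows "minimal_type \<theta>"
  unfolding minimal_type_def
proof (intro conjI allI impI hol)
  fix e' :: real assume e': "0 < e'"
  define e where "e = e' / 2"
  have e: "0 < e" "e' = 2 * e" using e' by (auto simp: e_def)
  obtain R where R: "\<And>z. \<bar>Re z\<bar> \<le> \<bar>Im z\<bar> \<Longrightarrow> R \<le> norm z \<Longrightarrow> norm (\<theta> z) \<le> exp (e * norm z)"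
    using sector[OF e(1)] by blast
  have "bounded (\<theta> ` cball 0 \<bar>R\<bar>)"
    by (intro compact_imp_bounded compact_continuous_image compact_cball
        continuous_on_subset[OF holomorphic_on_imp_continuous_on[OF hol]]) auto
  then obtain B where B: "0 < B" "\<And>z. z \<in> cball 0 \<bar>R\<bar> \<Longrightarrow> norm (\<theta> z) \<le> B"
    by (auto simp: bounded_pos)
  define M where "M = max B 1"
  have M: "0 < M" "B \<le> M" "1 \<le> M" by (auto simp: M_def)
  have C0: "0 \<le> C" using order_trans[OF norm_ge_zero C[of 0]] by simp
  have near: "norm (\<theta> z) \<le> M * exp (e * norm z)" if "\<bar>Re z\<bar> \<le> \<bar>Im z\<bar>" for z
  proof (cases "R \<le> norm z")
    case True
    have "norm (\<theta> z) \<le> 1 * exp (e * norm z)" using R[OF that True] by simp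
    also have "\<dots> \<le> M * exp (e * norm z)" using M by (intro mult_right_mono) auto
    finally show ?thesis .
  next
    case False
    then have "norm (\<theta> z) \<le> B" by (intro B) auto
    also have "\<dots> \<le> M * 1" using M by simp
    also have "\<dots> \<le> M * exp (e * norm z)" using M e by (intro mult_left_mono) auto
    finally show ?thesis .
  qed
  have right: "norm (\<tau> z) \<le> M * exp (2 * e * norm z)"
    if \<tau>: "\<tau> holomorphic_on UNIV" "\<And>z. norm (\<tau> z) \<le> C * exp (C * norm z)"
      "\<And>z. \<bar>Re z\<bar> \<le> \<bar>Im z\<bar> \<Longrightarrow> norm (\<tau> z) \<le> M * exp (e * norm z)" and z: "\<bar>Im z\<bar> \<le> Re z" for \<tau> z
  proof -
    define g where "g z = \<tau> z * exp (- of_real (2 * e) * z)" for z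
    have ng: "norm (g z) = norm (\<tau> z) * exp (- 2 * e * Re z)" for z by (simp add: g_def norm_mult)
    have hg: "g holomorphic_on UNIV" unfolding g_def by (intro holomorphic_intros \<tau>)
    have "norm (g z) \<le> M"
    proof (rule Phragmen_Lindelof_sector[where f = g and C = C])
      show "g holomorphic_on {z. \<bar>Im z\<bar> < Re z}" by (rule holomorphic_on_subset[OF hg]) auto
      show "continuous_on {z. \<bar>Im z\<bar> \<le> Re z} g"
        by (rule continuous_on_subset[OF holomorphic_on_imp_continuous_on[OF hg]]) auto
      show "norm (g v) \<le> C * exp (C * norm v)" if "\<bar>Im v\<bar> \<le> Re v" for v
      proof -
        have "norm (g v) \<le> (C * exp (C * norm v)) * 1"
          unfolding ng using that e C0 by (intro mult_mono \<tau>) auto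
        then show ?thesis by simp
      qed
      show "norm (g v) \<le> M" if v: "\<bar>Im v\<bar> = Re v" for v
      proof -
        have "norm v \<le> 2 * Re v" using cmod_le[of v] v by simp
        then have "e * norm v \<le> 2 * e * Re v" using e by simp
        then have "exp (e * norm v) * exp (- 2 * e * Re v) \<le> 1" by (simp add: mult_exp_exp)
        then have "M * (exp (e * norm v) * exp (- 2 * e * Re v)) \<le> M * 1" using M by (intro mult_left_mono) auto
        moreover have "norm (g v) \<le> M * exp (e * norm v) * exp (- 2 * e * Re v)"
          unfolding ng using v by (intro mult_right_mono \<tau>(3)) auto
        ultimately show ?thesis by (simp add: mult.assoc)
      qed
    qed (use M z in auto)
    then have "norm (\<tau> z) * exp (- 2 * e * Re z) * exp (2 * e * Re z) \<le> M * exp (2 * e * Re z)"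
      unfolding ng by (rule mult_right_mono) simp
    then have "norm (\<tau> z) \<le> M * exp (2 * e * Re z)" by (simp add: mult.assoc mult_exp_exp)
    also have "\<dots> \<le> M * exp (2 * e * norm z)" using M e complex_Re_le_cmod[of z] by (intro mult_left_mono) auto
    finally show ?thesis .
  qed
  have "norm (\<theta> z) \<le> M * exp (e' * norm z)" for z
  proof -
    consider "\<bar>Re z\<bar> \<le> \<bar>Im z\<bar>" | "\<bar>Im z\<bar> \<le> Re z" | "\<bar>Im z\<bar> \<le> - Re z" by linarith
    then show ?thesis
    proof cases
      case 1
      have "norm (\<theta> z) \<le> M * exp (e * norm z)" by (rule near[OF 1])
      also have "\<dots> \<le> M * exp (e' * norm z)" using M e by (intro mult_left_mono) (auto intro!: mult_right_mono)
      finally show ?thesis .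
    next
      case 2
      then show ?thesis using right[OF hol C near] e by simp
    next
      case 3
      have "(\<lambda>z. \<theta> (- z)) holomorphic_on UNIV"
        by (rule holomorphic_on_compose_gen[OF _ hol, unfolded o_def]) (auto intro!: holomorphic_intros)
      then have "norm (\<theta> (- (- z))) \<le> M * exp (2 * e * norm (- z))"
        by (rule right[where \<tau> = "\<lambda>z. \<theta> (- z)"])
           (use C[of "- _"] near[of "- _"] 3 in auto)
      then show ?thesis using e by simp
    qed
  qed
  then show "\<exists>C. \<forall>z. norm (\<theta> z) \<le> C * exp (e' * norm z)" by blast
qed

text \<open>An entire quotient is of minimal type as soon as, for both half-axes separately, divisors
  can be chosen whose indicator is not exceeded by much by that of the dividend.\<close>

lemma quotient_minimal_type:
  assumes w: "admissible_weight \<omega>" and \<theta>: "\<theta> holomorphic_on UNIV"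
    and cb: "\<And>f. f \<in> J \<Longrightarrow> Cartwright_bounded \<omega> f \<and> Cartwright_bounded \<omega> (\<lambda>z. \<theta> z * f z)"
    and upper: "\<And>e. 0 < e \<Longrightarrow> \<exists>f\<in>J. f \<noteq> (\<lambda>z. 0) \<and>
      indicator_fun (\<lambda>z. \<theta> z * f z) (pi / 2) \<le> indicator_fun f (pi / 2) + ereal e"
    and lower: "\<And>e. 0 < e \<Longrightarrow> \<exists>f\<in>J. f \<noteq> (\<lambda>z. 0) \<and>
      indicator_fun (\<lambda>z. \<theta> z * f z) (- pi / 2) \<le> indicator_fun f (- pi / 2) + ereal e"
  shows "minimal_type \<theta>"
proof -
  obtain f where "f \<in> J" "f \<noteq> (\<lambda>z. 0)" using upper[of 1] by auto
  then obtain C where C: "\<And>z. norm (\<theta> z) \<le> C * exp (C * norm z)"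
    using quotient_exponential_type[OF w \<theta>] cb by blast
  show ?thesis
  proof (rule minimal_typeI[OF \<theta> C])
    fix e :: real assume e: "0 < e"
    define d where "d = e / 55"
    have d: "0 < d" "55 * d = e" using e by (auto simp: d_def)
    obtain f where f: "f \<in> J" "f \<noteq> (\<lambda>z. 0)"
      "indicator_fun (\<lambda>z. \<theta> z * f z) (pi / 2) \<le> indicator_fun f (pi / 2) + ereal d"
      using upper[OF d(1)] by blast
    obtain R1 where R1: "\<And>z. \<bar>Re z\<bar> \<le> Im z \<Longrightarrow> R1 \<le> norm z \<Longrightarrow> norm (\<theta> z) \<le> exp (e * norm z)"
      using quotient_in_upper_sector[OF w \<theta> _ _ f(2) d(1) f(3)] cb[OF f(1)] unfolding d(2) by blast
    obtain h where h: "h \<in> J" "h \<noteq> (\<lambda>z. 0)"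
      "indicator_fun (\<lambda>z. \<theta> z * h z) (- pi / 2) \<le> indicator_fun h (- pi / 2) + ereal d"
      using lower[OF d(1)] by blast
    have "(\<lambda>z. h (- z)) \<noteq> (\<lambda>z. 0)"
    proof
      assume "(\<lambda>z. h (- z)) = (\<lambda>z. 0)"
      then have "h (- (- z)) = 0" for z by meson
      then show False using h(2) by auto
    qed
    moreover have "(\<lambda>z. \<theta> (- z)) holomorphic_on UNIV"
      by (rule holomorphic_on_compose_gen[OF _ \<theta>, unfolded o_def]) (auto intro!: holomorphic_intros)
    moreover have "indicator_fun (\<lambda>z. \<theta> (- z) * h (- z)) (pi / 2) \<le> indicator_fun (\<lambda>z. h (- z)) (pi / 2) + ereal d"
      using h(3) indicator_fun_uminus[of "\<lambda>z. \<theta> z * h z"] indicator_fun_uminus[of h] by simp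
    ultimately obtain R2 where R2: "\<And>z. \<bar>Re z\<bar> \<le> Im z \<Longrightarrow> R2 \<le> norm z \<Longrightarrow> norm (\<theta> (- z)) \<le> exp (e * norm z)"
      using quotient_in_upper_sector[OF w, of "\<lambda>z. \<theta> (- z)" "\<lambda>z. h (- z)" d] d cb[OF h(1)]
        Cartwright_bounded_uminus[of \<omega> h] Cartwright_bounded_uminus[of \<omega> "\<lambda>z. \<theta> z * h z"] by auto
    have "norm (\<theta> z) \<le> exp (e * norm z)" if "\<bar>Re z\<bar> \<le> \<bar>Im z\<bar>" "max R1 R2 \<le> norm z" for z
      using R1[of z] R2[of "- z"] that by (cases "0 \<le> Im z") auto
    then show "\<exists>R. \<forall>z. \<bar>Re z\<bar> \<le> \<bar>Im z\<bar> \<longrightarrow> R \<le> norm z \<longrightarrow> norm (\<theta> z) \<le> exp (e * norm z)" by blast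
  qed
qed

section \<open>Closed sets in the inductive limit\<close>

lemma zorder_ge_iff:
  assumes f: "f holomorphic_on UNIV" and nz: "f \<noteq> (\<lambda>z. 0)"
  shows "n \<le> nat (zorder f \<mu>) \<longleftrightarrow> (\<forall>j<n. (deriv ^^ j) f \<mu> = 0)"
proof -
  have "\<exists>m. (deriv ^^ m) f \<mu> \<noteq> 0"
  proof (rule ccontr)
    assume "\<not> ?thesis"
    then have d: "(deriv ^^ m) f \<mu> = 0" for m by blast
    have "f z = 0" for z
      using holomorphic_fun_eq_const_on_connected[OF f open_UNIV connected_UNIV d, of z] d[of 0] by simp
    then show False using nz by auto
  qed
  then have ex: "\<exists>m. (deriv ^^ m) f \<mu> \<noteq> 0" .
  define m where "m = (LEAST m. (deriv ^^ m) f \<mu> \<noteq> 0)"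
  have m: "(deriv ^^ m) f \<mu> \<noteq> 0" unfolding m_def by (rule LeastI_ex[OF ex])
  have l: "(deriv ^^ j) f \<mu> = 0" if "j < m" for j using not_less_Least[of j] that unfolding m_def by blast
  have z: "zorder f \<mu> = int m"
    by (rule zorder_zero_eqI[OF f open_UNIV]) (use m l in auto)
  show "n \<le> nat (zorder f \<mu>) \<longleftrightarrow> (\<forall>j<n. (deriv ^^ j) f \<mu> = 0)"
    unfolding z nat_int using m l by (meson less_le_trans not_le)
qed

lemma indicator_le_max:
  assumes le: "\<And>e. 0 < e \<Longrightarrow> \<exists>C. \<forall>z. norm (g z) \<le> C * exp (e * norm z) * (norm (f1 z) + norm (f2 z))"
    and f1: "indicator_fun f1 \<theta> \<le> D" and f2: "indicator_fun f2 \<theta> \<le> D"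
  shows "indicator_fun g \<theta> \<le> D"
  unfolding indicator_le_iff
proof (intro allI impI)
  fix d' assume d': "D < ereal d'"
  obtain d where d: "D < ereal d" "d < d'" using ereal_dense2[OF d'] by auto
  define e where "e = (d' - d) / 2"
  have e: "0 < e" "d' = d + 2 * e" using d by (simp_all add: e_def field_simps)
  obtain C where C: "\<And>z. norm (g z) \<le> C * exp (e * norm z) * (norm (f1 z) + norm (f2 z))"
    using le[OF e(1)] by blast
  have "\<forall>\<^sub>F t in at_top. norm (f1 (of_real t * cis \<theta>)) \<le> exp (d * t)"
    "\<forall>\<^sub>F t in at_top. norm (f2 (of_real t * cis \<theta>)) \<le> exp (d * t)"
    using f1 f2 d unfolding indicator_le_iff by auto
  moreover have "\<forall>\<^sub>F t in at_top. max 0 (2 * \<bar>C\<bar> / e) \<le> t" by (rule eventually_ge_at_top)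
  ultimately show "\<forall>\<^sub>F t in at_top. norm (g (of_real t * cis \<theta>)) \<le> exp (d' * t)"
  proof eventually_elim
    case (elim t)
    have t0: "0 \<le> t" "2 * \<bar>C\<bar> / e \<le> t" using elim(3) by simp_all
    then have t: "0 \<le> t" "2 * \<bar>C\<bar> \<le> e * t" using e(1) by (simp_all add: pos_divide_le_eq mult.commute)
    have nt: "norm (of_real t * cis \<theta>) = t" using t by (simp add: norm_mult)
    have "norm (g (of_real t * cis \<theta>)) \<le> C * exp (e * t) * (norm (f1 (of_real t * cis \<theta>)) + norm (f2 (of_real t * cis \<theta>)))"
      using C[of "of_real t * cis \<theta>"] unfolding nt .
    also have "\<dots> \<le> \<bar>C\<bar> * exp (e * t) * (exp (d * t) + exp (d * t))"
      using elim by (intro mult_mono add_mono) auto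
    also have "\<dots> = (2 * \<bar>C\<bar>) * (exp (e * t) * exp (d * t))" by simp
    also have "\<dots> \<le> exp (e * t) * (exp (e * t) * exp (d * t))"
    proof (rule mult_right_mono)
      show "2 * \<bar>C\<bar> \<le> exp (e * t)" using t(2) exp_ge_add_one_self[of "e * t"] by linarith
    qed simp
    also have "\<dots> = exp (d' * t)" unfolding mult_exp_exp e(2) by (simp add: algebra_simps)
    finally show ?case .
  qed
qed

lemma indicator_fun_zero: "indicator_fun (\<lambda>z. 0) \<theta> \<le> D"
  unfolding indicator_le_iff by simp

text \<open>Bounds for the indicator survive limits of bounded sequences, by the uniformity of the majorant
  in \<open>majorized_in_upper_half_plane\<close>.\<close>

lemma indicator_upper_limit:
  assumes w: "admissible_weight \<omega>" and hol: "\<And>n. f n holomorphic_on UNIV"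
    and M: "0 < M" "0 \<le> c" "\<And>n z. norm (f n z) \<le> M * exp (\<omega> (norm z) + c * \<bar>Im z\<bar>)"
    and ind: "\<And>n. indicator_fun (f n) (pi / 2) \<le> D"
    and lim: "\<And>z. (\<lambda>n. f n z) \<longlonglongrightarrow> g z"
  shows "indicator_fun g (pi / 2) \<le> D"
  unfolding indicator_fun_upper_le_iff
proof (intro allI impI)
  fix d' assume d': "D < ereal d'"
  obtain d where d: "D < ereal d" "d < d'" using ereal_dense2[OF d'] by auto
  define e where "e = (d' - d) / 5"
  have e: "0 < e" "d' = d + 5 * e" using d by (simp_all add: e_def field_simps)
  define L where "L = M * exp (\<omega> 1)"
  have L: "0 < L" using M by (simp add: L_def)
  have gb: "norm (g z) \<le> L * exp (d * Im z + 4 * Re (weight_majorant \<omega> (- \<i> * z)))" if z: "0 \<le> Im z" for z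
  proof (rule tendsto_upperbound[OF tendsto_norm[OF lim]])
    have "norm (f n z) \<le> L * exp (d * Im z + 4 * Re (weight_majorant \<omega> (- \<i> * z)))" for n
    proof -
      have "indicator_fun (f n) (pi / 2) \<le> ereal d" using ind[of n] d(1) by (simp add: order_trans less_imp_le)
      then show ?thesis unfolding indicator_fun_upper_le_ereal_iff L_def
        by (intro majorized_in_upper_half_plane[OF w hol M(1,2)] M(3)) (use z in auto)
    qed
    then show "\<forall>\<^sub>F n in sequentially. norm (f n z) \<le> L * exp (d * Im z + 4 * Re (weight_majorant \<omega> (- \<i> * z)))"
      by simp
  qed simp
  have "\<forall>\<^sub>F y in at_top. Re (weight_majorant \<omega> (of_real y)) \<le> e * y" by (rule weight_majorant_sublinear[OF w e(1)])
  moreover have "\<forall>\<^sub>F t in at_top. max 0 (ln L / e) \<le> t" by (rule eventually_ge_at_top)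
  ultimately show "\<forall>\<^sub>F t in at_top. norm (g (\<i> * of_real t)) \<le> exp (d' * t)"
  proof eventually_elim
    case (elim t)
    have t: "0 \<le> t" "ln L \<le> e * t" using elim e by (auto simp: field_simps)
    have "norm (g (\<i> * of_real t)) \<le> L * exp (d * t + 4 * Re (weight_majorant \<omega> (of_real t)))"
      using gb[of "\<i> * of_real t"] t by simp
    also have "\<dots> = exp (ln L + (d * t + 4 * Re (weight_majorant \<omega> (of_real t))))"
      using L by (simp add: exp_add)
    also have "\<dots> \<le> exp (d' * t)" using t elim by (simp add: e(2) algebra_simps)
    finally show ?case .
  qed
qed

lemma poly_le_exp_weight:
  assumes w: "admissible_weight \<omega>" and e: "0 < e"
  shows "\<exists>C\<ge>0. \<forall>z::complex. norm (poly p z) \<le> C * exp (e * \<omega> (norm z))"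
  using e
proof (induction p arbitrary: e)
  case 0
  then show ?case by (intro exI[of _ 0]) simp
next
  case (pCons a p)
  define d where "d = e / 2"
  have d: "0 < d" "e = d + d" using pCons by (auto simp: d_def)
  obtain C1 where C1: "0 \<le> C1" "\<And>z. norm (poly p z) \<le> C1 * exp (d * \<omega> (norm z))"
    using pCons.IH[OF d(1)] by blast
  have "(\<lambda>x. ln x) \<in> o[at_top](\<omega>)" using w by (simp add: admissible_weight_def)
  then have "\<forall>\<^sub>F x in at_top. norm (ln x) \<le> d * norm (\<omega> x)" using d(1) by (rule landau_o.smallD)
  then obtain X where X: "\<And>x. X \<le> x \<Longrightarrow> norm (ln x) \<le> d * norm (\<omega> x)"
    unfolding eventually_at_top_linorder by blast
  define C2 where "C2 = max 1 X"
  have C2: "1 \<le> C2" by (simp add: C2_def)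
  have x: "norm z \<le> C2 * exp (d * \<omega> (norm z))" for z :: complex
  proof (cases "C2 \<le> norm z")
    case True
    then have "1 \<le> norm z" "X \<le> norm z" by (auto simp: C2_def)
    then have "ln (norm z) \<le> d * \<omega> (norm z)"
      using X[of "norm z"] weight_nonneg[OF w, of "norm z"] by simp
    then have "norm z \<le> exp (d * \<omega> (norm z))" using \<open>1 \<le> norm z\<close>
      by (metis exp_le_cancel_iff exp_ln less_le_trans zero_less_one)
    also have "\<dots> \<le> C2 * exp (d * \<omega> (norm z))" using C2 by simp
    finally show ?thesis .
  next
    case False
    have "C2 * 1 \<le> C2 * exp (d * \<omega> (norm z))"
      using C2 d weight_nonneg[OF w, of "norm z"] by (intro mult_left_mono) auto
    then show ?thesis using False by simp
  qed
  have "norm (poly (pCons a p) z) \<le> (norm a + C2 * C1) * exp (e * \<omega> (norm z))" for z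
  proof -
    have "norm (poly (pCons a p) z) \<le> norm a + norm z * norm (poly p z)"
      using norm_triangle_ineq[of a "z * poly p z"] by (simp add: norm_mult)
    also have "\<dots> \<le> norm a * exp (e * \<omega> (norm z)) + (C2 * exp (d * \<omega> (norm z))) * (C1 * exp (d * \<omega> (norm z)))"
    proof (intro add_mono mult_mono x C1)
      have "norm a * 1 \<le> norm a * exp (e * \<omega> (norm z))"
        using pCons.prems weight_nonneg[OF w, of "norm z"] by (intro mult_left_mono) auto
      then show "norm a \<le> norm a * exp (e * \<omega> (norm z))" by simp
    qed (use C2 in auto)
    also have "\<dots> = (norm a + C2 * C1) * exp (e * \<omega> (norm z))"
    proof -
      have "exp (e * \<omega> (norm z)) = exp (d * \<omega> (norm z)) * exp (d * \<omega> (norm z))"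
        unfolding mult_exp_exp by (simp add: d(2) distrib_right)
      then show ?thesis by (simp only: distrib_right mult_ac)
    qed
    finally show ?thesis .
  qed
  then show ?case using C1 C2 by (intro exI[of _ "norm a + C2 * C1"]) auto
qed

text \<open>The data defining the steps \<open>P\<^sub>k\<close> and their inductive limit.\<close>

locale weighted_space =
  fixes \<omega> :: "real \<Rightarrow> real" and r c :: "nat \<Rightarrow> real"
  assumes weight: "admissible_weight \<omega>"
    and c: "incseq c" "\<And>k. 0 < c k"
    and r: "incseq r" "\<And>k. 0 < r k" "\<And>k. r k < 1" "r \<longlonglongrightarrow> 1"
begin

text \<open>The logarithm of the weight of the step \<open>P\<^sub>k\<close>.\<close>

abbreviation wt :: "nat \<Rightarrow> complex \<Rightarrow> real" where
  "wt k z \<equiv> r k * \<omega> (norm z) + c k * \<bar>Im z\<bar>"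

lemma wt_nonneg: "0 \<le> wt k z"
  using c r weight_nonneg[OF weight, of "norm z"] by (intro add_nonneg_nonneg mult_nonneg_nonneg) (auto intro: less_imp_le)

lemma wt_mono: "j \<le> k \<Longrightarrow> wt j z \<le> wt k z"
  using c(1) r(1) weight_nonneg[OF weight, of "norm z"]
  by (intro add_mono mult_right_mono) (auto simp: incseq_def)

lemma Pk_quot_le_iff: "Pk_quot \<omega> r c k f z \<le> B \<longleftrightarrow> norm (f z) \<le> B * exp (wt k z)"
proof -
  have "Pk_quot \<omega> r c k f z = norm (f z) / exp (wt k z)"
    unfolding Pk_quot_def by (simp add: exp_minus[symmetric] divide_inverse del: exp_add)
  then show ?thesis by (simp add: divide_le_eq)
qed

lemma Pk_iff: "f \<in> Pk \<omega> r c k \<longleftrightarrow> f holomorphic_on UNIV \<and> (\<exists>B. \<forall>z. norm (f z) \<le> B * exp (wt k z))"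
  unfolding Pk_def bdd_above_def by (auto simp: Pk_quot_le_iff)

lemma Pk_norm_bound:
  assumes "f \<in> Pk \<omega> r c k"
  shows "norm (f z) \<le> Pk_norm \<omega> r c k f * exp (wt k z)"
  unfolding Pk_quot_le_iff[symmetric] Pk_norm_def
  using assms by (intro cSUP_upper) (auto simp: Pk_def)

lemma Pk_norm_le:
  assumes "\<And>z. norm (f z) \<le> B * exp (wt k z)"
  shows "Pk_norm \<omega> r c k f \<le> B"
  unfolding Pk_norm_def by (rule cSUP_least) (auto simp: Pk_quot_le_iff assms)

lemma Pk_norm_nonneg:
  assumes "f \<in> Pk \<omega> r c k"
  shows "0 \<le> Pk_norm \<omega> r c k f"
proof -
  have "0 \<le> Pk_norm \<omega> r c k f * exp (wt k 0)" using order_trans[OF norm_ge_zero Pk_norm_bound[OF assms]] .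
  then show ?thesis by (simp add: zero_le_mult_iff)
qed

lemma Pk_holomorphic: "f \<in> Pk \<omega> r c k \<Longrightarrow> f holomorphic_on UNIV"
  by (simp add: Pk_iff)

lemma Pk_incl: "f \<in> Pk \<omega> r c j \<Longrightarrow> j \<le> k \<Longrightarrow> f \<in> Pk \<omega> r c k"
  using Pk_mono[of \<omega> r c j k] weight_nonneg[OF weight] r(1) c(1) by blast

lemma Pk_lin:
  assumes "f \<in> Pk \<omega> r c k" "g \<in> Pk \<omega> r c k"
  shows "(\<lambda>z. \<alpha> * f z + \<beta> * g z) \<in> Pk \<omega> r c k"
    and "Pk_norm \<omega> r c k (\<lambda>z. \<alpha> * f z + \<beta> * g z) \<le> norm \<alpha> * Pk_norm \<omega> r c k f + norm \<beta> * Pk_norm \<omega> r c k g"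
proof -
  have b: "norm (\<alpha> * f z + \<beta> * g z) \<le> (norm \<alpha> * Pk_norm \<omega> r c k f + norm \<beta> * Pk_norm \<omega> r c k g) * exp (wt k z)" for z
  proof -
    have "norm (\<alpha> * f z + \<beta> * g z) \<le> norm \<alpha> * norm (f z) + norm \<beta> * norm (g z)"
      using norm_triangle_ineq[of "\<alpha> * f z" "\<beta> * g z"] by (simp add: norm_mult)
    also have "\<dots> \<le> norm \<alpha> * (Pk_norm \<omega> r c k f * exp (wt k z)) + norm \<beta> * (Pk_norm \<omega> r c k g * exp (wt k z))"
      by (intro add_mono mult_left_mono Pk_norm_bound assms) auto
    finally show ?thesis by (simp add: algebra_simps)
  qed
  then show "(\<lambda>z. \<alpha> * f z + \<beta> * g z) \<in> Pk \<omega> r c k"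
    using assms unfolding Pk_iff by (auto intro!: holomorphic_intros)
  show "Pk_norm \<omega> r c k (\<lambda>z. \<alpha> * f z + \<beta> * g z) \<le> norm \<alpha> * Pk_norm \<omega> r c k f + norm \<beta> * Pk_norm \<omega> r c k g"
    by (rule Pk_norm_le[OF b])
qed

lemma Pa_common:
  assumes "f \<in> Pa \<omega> r c" "g \<in> Pa \<omega> r c"
  obtains k where "f \<in> Pk \<omega> r c k" "g \<in> Pk \<omega> r c k"
proof -
  obtain i j where "f \<in> Pk \<omega> r c i" "g \<in> Pk \<omega> r c j" using assms unfolding Pa_def by blast
  then show ?thesis using that[of "max i j"] Pk_incl by (meson max.cobounded1 max.cobounded2)
qed

lemma Pa_lin:
  assumes "f \<in> Pa \<omega> r c" "g \<in> Pa \<omega> r c"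
  shows "(\<lambda>z. \<alpha> * f z + \<beta> * g z) \<in> Pa \<omega> r c"
  using Pa_common[OF assms] Pk_lin(1) unfolding Pa_def by (metis UN_I UNIV_I)

lemma Pa_holomorphic: "f \<in> Pa \<omega> r c \<Longrightarrow> f holomorphic_on UNIV"
  unfolding Pa_def using Pk_holomorphic by blast

lemma Pk_bound_Cartwright:
  assumes "\<And>z. norm (f z) \<le> B * exp (wt k z)"
  shows "norm (f z) \<le> max B 1 * exp (\<omega> (norm z) + c k * \<bar>Im z\<bar>)"
proof -
  have "r k * \<omega> (norm z) \<le> 1 * \<omega> (norm z)"
    using r(3)[of k] weight_nonneg[OF weight, of "norm z"] by (intro mult_right_mono) auto
  then have "exp (wt k z) \<le> exp (\<omega> (norm z) + c k * \<bar>Im z\<bar>)" by simp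
  then have "B * exp (wt k z) \<le> max B 1 * exp (\<omega> (norm z) + c k * \<bar>Im z\<bar>)"
    by (intro mult_mono) auto
  then show ?thesis using assms[of z] by linarith
qed

lemma Pa_Cartwright:
  assumes "f \<in> Pa \<omega> r c"
  shows "Cartwright_bounded \<omega> f"
proof -
  obtain k B where "f holomorphic_on UNIV" "\<And>z. norm (f z) \<le> B * exp (wt k z)"
    using assms unfolding Pa_def by (auto simp: Pk_iff)
  then have "f holomorphic_on UNIV \<and> 0 < max B 1 \<and> 0 \<le> c k \<and>
      (\<forall>z. norm (f z) \<le> max B 1 * exp (\<omega> (norm z) + c k * \<bar>Im z\<bar>))"
    using Pk_bound_Cartwright[of f B k] c(2)[of k] by (simp add: less_max_iff_disj less_imp_le)
  then show ?thesis unfolding Cartwright_bounded_def by blast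
qed

lemma larger_r: obtains k' where "k \<le> k'" "r k < r k'"
proof -
  have "\<forall>\<^sub>F n in sequentially. r k < r n" by (rule order_tendstoD(1)[OF r(4) r(3)])
  then obtain N where "\<And>n. N \<le> n \<Longrightarrow> r k < r n" unfolding eventually_sequentially by blast
  then show ?thesis by (metis max.cobounded1 max.cobounded2 that)
qed

lemma Pa_poly_mult:
  assumes "f \<in> Pa \<omega> r c"
  shows "(\<lambda>z. poly p z * f z) \<in> Pa \<omega> r c"
proof -
  obtain k B where f: "f holomorphic_on UNIV" "\<And>z. norm (f z) \<le> B * exp (wt k z)"
    using assms unfolding Pa_def by (auto simp: Pk_iff)
  obtain k' where k': "k \<le> k'" "r k < r k'" by (rule larger_r)
  obtain C where C: "0 \<le> C" "\<And>z. norm (poly p z) \<le> C * exp ((r k' - r k) * \<omega> (norm z))"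
    using poly_le_exp_weight[OF weight, of "r k' - r k"] k' by auto
  have "norm (poly p z * f z) \<le> (C * B) * exp (wt k' z)" for z
  proof -
    have B: "0 \<le> B" using order_trans[OF norm_ge_zero f(2)[of z]] by (simp add: zero_le_mult_iff)
    have "norm (poly p z * f z) \<le> (C * exp ((r k' - r k) * \<omega> (norm z))) * (B * exp (wt k z))"
      unfolding norm_mult using C B by (intro mult_mono C f) auto
    also have "\<dots> = (C * B) * exp ((r k' - r k) * \<omega> (norm z) + wt k z)" unfolding exp_add[of _ "wt k z"] by simp
    also have "\<dots> \<le> (C * B) * exp (wt k' z)"
    proof (intro mult_left_mono iffD2[OF exp_le_cancel_iff])
      have "c k * \<bar>Im z\<bar> \<le> c k' * \<bar>Im z\<bar>" using c(1) k' by (intro mult_right_mono) (auto simp: incseq_def)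
      then show "(r k' - r k) * \<omega> (norm z) + wt k z \<le> wt k' z" by (simp add: algebra_simps)
    qed (use C B in auto)
    finally show ?thesis .
  qed
  then have "(\<lambda>z. poly p z * f z) \<in> Pk \<omega> r c k'"
    unfolding Pk_iff using f(1) by (auto intro!: holomorphic_intros exI[of _ "C * B"])
  then show ?thesis unfolding Pa_def by blast
qed

lemma Montel_Pk_ball:
  assumes hol: "\<And>m. f m holomorphic_on UNIV" and bd: "\<And>m z. norm (f m z) \<le> B * exp (wt k z)"
  obtains g \<sigma> where "strict_mono (\<sigma> :: nat \<Rightarrow> nat)" "g holomorphic_on UNIV"
    "\<And>z. norm (g z) \<le> B * exp (wt k z)" "\<And>K. compact K \<Longrightarrow> uniform_limit K (\<lambda>m. f (\<sigma> m)) g sequentially"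
proof -
  have "\<exists>B'. \<forall>h\<in>range f. \<forall>z\<in>K. norm (h z) \<le> B'" if K: "compact K" "K \<subseteq> UNIV" for K
  proof -
    have "continuous_on UNIV (\<lambda>z::complex. \<omega> (norm z))"
      by (rule continuous_on_compose2[OF weight_continuous[OF weight]]) (auto intro!: continuous_intros)
    then have "continuous_on K (\<lambda>z. B * exp (wt k z))"
      by (intro continuous_intros) (auto intro: continuous_on_subset)
    then have "bdd_above ((\<lambda>z. B * exp (wt k z)) ` K)"
      by (intro bounded_imp_bdd_above compact_imp_bounded compact_continuous_image K)
    then obtain B' where "\<And>z. z \<in> K \<Longrightarrow> B * exp (wt k z) \<le> B'" unfolding bdd_above_def by blast
    then show ?thesis using bd order_trans by blast
  qed
  then obtain g \<sigma> where g: "g holomorphic_on UNIV" "strict_mono (\<sigma> :: nat \<Rightarrow> nat)"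
      "\<And>x. x \<in> UNIV \<Longrightarrow> ((\<lambda>n. f (\<sigma> n) x) \<longlongrightarrow> g x) sequentially"
      "\<And>K. \<lbrakk>compact K; K \<subseteq> UNIV\<rbrakk> \<Longrightarrow> uniform_limit K (f \<circ> \<sigma>) g sequentially"
    using Montel[OF open_UNIV, of "range f" f] hol by blast
  have "norm (g z) \<le> B * exp (wt k z)" for z
    by (rule tendsto_upperbound[OF tendsto_norm[OF g(3)]]) (use bd in auto)
  then show ?thesis using that[OF g(2,1)] g(4) by (simp add: o_def)
qed

lemma Montel_finitely_many:
  assumes "\<And>m j. j < n \<Longrightarrow> f m j holomorphic_on UNIV" "\<And>m j z. j < n \<Longrightarrow> norm (f m j z) \<le> B j * exp (wt j z)"
  shows "\<exists>\<sigma> g. strict_mono (\<sigma> :: nat \<Rightarrow> nat) \<and> (\<forall>j<n. g j holomorphic_on UNIV \<and> (\<forall>z. norm (g j z) \<le> B j * exp (wt j z)) \<and>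
     (\<forall>K. compact K \<longrightarrow> uniform_limit K (\<lambda>m. f (\<sigma> m) j) (g j) sequentially))"
  using assms
proof (induction n)
  case 0
  then show ?case by (intro exI[of _ id]) (simp add: strict_mono_def)
next
  case (Suc n)
  obtain \<sigma> g where s: "strict_mono (\<sigma> :: nat \<Rightarrow> nat)" and g: "\<And>j. j < n \<Longrightarrow> g j holomorphic_on UNIV \<and> (\<forall>z. norm (g j z) \<le> B j * exp (wt j z)) \<and>
     (\<forall>K. compact K \<longrightarrow> uniform_limit K (\<lambda>m. f (\<sigma> m) j) (g j) sequentially)"
  proof -
    have "\<exists>\<sigma> g. strict_mono (\<sigma> :: nat \<Rightarrow> nat) \<and> (\<forall>j<n. g j holomorphic_on UNIV \<and> (\<forall>z. norm (g j z) \<le> B j * exp (wt j z)) \<and>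
     (\<forall>K. compact K \<longrightarrow> uniform_limit K (\<lambda>m. f (\<sigma> m) j) (g j) sequentially))"
      by (rule Suc.IH) (use Suc.prems in simp_all)
    then show ?thesis using that by blast
  qed
  have fn: "\<And>m. f (\<sigma> m) n holomorphic_on UNIV" "\<And>m z. norm (f (\<sigma> m) n z) \<le> B n * exp (wt n z)"
    using Suc.prems by simp_all
  obtain h \<tau> where t: "strict_mono (\<tau> :: nat \<Rightarrow> nat)" and h: "h holomorphic_on UNIV"
    "\<And>z. norm (h z) \<le> B n * exp (wt n z)" "\<And>K. compact K \<Longrightarrow> uniform_limit K (\<lambda>m. f (\<sigma> (\<tau> m)) n) h sequentially"
    by (rule Montel_Pk_ball[of "\<lambda>m. f (\<sigma> m) n" "B n" n, OF fn]) blast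
  have sub: "filterlim \<tau> sequentially sequentially" using t by (rule filterlim_subseq)
  have "uniform_limit K (\<lambda>m. f (\<sigma> (\<tau> m)) j) (g j) sequentially" if "j < n" "compact K" for j K
  proof (rule uniform_limitI)
    fix e :: real assume "0 < e"
    have "uniform_limit K (\<lambda>m. f (\<sigma> m) j) (g j) sequentially" using g[OF that(1)] that(2) by blast
    then have "\<forall>\<^sub>F m in sequentially. \<forall>x\<in>K. dist (f (\<sigma> m) j x) (g j x) < e"
      using \<open>0 < e\<close> by (rule uniform_limitD)
    then show "\<forall>\<^sub>F m in sequentially. \<forall>x\<in>K. dist (f (\<sigma> (\<tau> m)) j x) (g j x) < e"
      using sub by (rule eventually_compose_filterlim)
  qed
  then show ?case using s t g h
    by (intro exI[of _ "\<sigma> \<circ> \<tau>"] exI[of _ "g(n := h)"])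
       (auto simp: less_Suc_eq o_def intro: strict_mono_o[unfolded o_def])
qed

text \<open>By Montel's theorem the balls of the steps are compact for locally uniform convergence.  Hence
  a set is closed in the inductive limit as soon as it is closed under limits of sequences that are
  bounded in one step and converge locally uniformly.  The neighbourhood of zero that keeps \<open>f\<close> away
  from the set consists of finite sums of elements of balls whose radii are chosen one after the
  other: if no radius were small enough for the next step, a limit of sums with radii \<open>1/(m+1)\<close> would
  contradict the choice of the previous ones.\<close>

lemma closedin_Pa_if_sequentially_closed:
  assumes sub: "K \<subseteq> Pa \<omega> r c"
    and seq: "\<And>k B f g. (\<And>n::nat. f n \<in> K) \<Longrightarrow> (\<And>n z. norm (f n z) \<le> B * exp (wt k z)) \<Longrightarrow>
       (\<And>S. compact S \<Longrightarrow> uniform_limit S f g sequentially) \<Longrightarrow> g \<in> Pa \<omega> r c \<Longrightarrow> g \<in> K"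
  shows "closedin (Pa_topology \<omega> r c) K"
proof -
  have top: "topspace (Pa_topology \<omega> r c) = Pa \<omega> r c"
    using weight_nonneg[OF weight] r(1) c(1) by (intro topspace_Pa_topology) auto
  have "\<exists>V. Pa_nhd0 \<omega> r c V \<and> (\<forall>g\<in>V. (\<lambda>z. f z + g z) \<in> Pa \<omega> r c - K)"
    if f: "f \<in> Pa \<omega> r c" "f \<notin> K" for f
  proof -
    obtain k0 Bf where f0: "f holomorphic_on UNIV" "\<And>z. norm (f z) \<le> Bf * exp (wt k0 z)"
      using f unfolding Pa_def by (auto simp: Pk_iff)
    define inball where "inball j e g \<longleftrightarrow> g holomorphic_on UNIV \<and> (\<forall>z. norm (g z) \<le> e * exp (wt j z))"
      for j and e :: real and g :: "complex \<Rightarrow> complex"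
    define avoids where "avoids n e \<longleftrightarrow> (\<forall>j<n. 0 < e j) \<and>
       (\<forall>g. (\<forall>j<n. inball j (e j) (g j)) \<longrightarrow> (\<lambda>z. f z + (\<Sum>j<n. g j z)) \<notin> K)" for n and e :: "nat \<Rightarrow> real"
    have step: "\<exists>e'. avoids (Suc n) e' \<and> (\<forall>j<n. e' j = e j)" if av: "avoids n e" for n e
    proof (rule ccontr)
      assume no: "\<not> ?thesis"
      have "\<exists>g. (\<forall>j<n. inball j (e j) (g j)) \<and> inball n (1 / Suc m) (g n) \<and> (\<lambda>z. f z + (\<Sum>j<Suc n. g j z)) \<in> K" for m
      proof -
        have "\<not> avoids (Suc n) (e(n := 1 / Suc m))" using no by auto
        then obtain g where g: "\<forall>j<Suc n. inball j ((e(n := 1 / Suc m)) j) (g j)" "(\<lambda>z. f z + (\<Sum>j<Suc n. g j z)) \<in> K"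
          using av unfolding avoids_def by (auto simp: less_Suc_eq)
        have "inball j (e j) (g j)" if "j < n" for j using g(1)[rule_format, of j] that by simp
        moreover have "inball n (1 / Suc m) (g n)" using g(1)[rule_format, of n] by simp
        ultimately show ?thesis using g(2) by blast
      qed
      then obtain G where G: "\<And>m j. j < n \<Longrightarrow> inball j (e j) (G m j)" "\<And>m. inball n (1 / Suc m) (G m n)"
          "\<And>m. (\<lambda>z. f z + (\<Sum>j<Suc n. G m j z)) \<in> K" by metis
      have "\<exists>\<sigma> g. strict_mono (\<sigma> :: nat \<Rightarrow> nat) \<and> (\<forall>j<n. g j holomorphic_on UNIV \<and> (\<forall>z. norm (g j z) \<le> e j * exp (wt j z)) \<and>
          (\<forall>K. compact K \<longrightarrow> uniform_limit K (\<lambda>m. G (\<sigma> m) j) (g j) sequentially))"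
        by (rule Montel_finitely_many) (use G(1) in \<open>auto simp: inball_def\<close>)
      then obtain \<sigma> g where s: "strict_mono (\<sigma> :: nat \<Rightarrow> nat)"
          and g: "\<And>j. j < n \<Longrightarrow> inball j (e j) (g j)"
          "\<And>j S. j < n \<Longrightarrow> compact S \<Longrightarrow> uniform_limit S (\<lambda>m. G (\<sigma> m) j) (g j) sequentially"
        unfolding inball_def by blast
      define k where "k = max k0 n"
      have wtk: "B * exp (wt j z) \<le> \<bar>B\<bar> * exp (wt k z)" if "j \<le> k" for B j z
      proof -
        have "B * exp (wt j z) \<le> \<bar>B\<bar> * exp (wt j z)" by (intro mult_right_mono) auto
        also have "\<dots> \<le> \<bar>B\<bar> * exp (wt k z)" using wt_mono[OF that, of z] by (intro mult_left_mono) auto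
        finally show ?thesis .
      qed
      have Gn: "norm (G m n z) \<le> 1 / Suc m * exp (wt n z)" for m z using G(2)[of m] by (simp add: inball_def)
      have ule0: "uniform_limit S (\<lambda>m. G (\<sigma> m) n) (\<lambda>z. 0) sequentially" if S: "compact S" for S
      proof -
        have "continuous_on UNIV (\<lambda>z::complex. \<omega> (norm z))"
          by (rule continuous_on_compose2[OF weight_continuous[OF weight]]) (auto intro!: continuous_intros)
        then have "continuous_on S (\<lambda>z. exp (wt n z))"
          by (intro continuous_intros) (auto intro: continuous_on_subset)
        then have "bdd_above ((\<lambda>z. exp (wt n z)) ` S)"
          by (intro bounded_imp_bdd_above compact_imp_bounded compact_continuous_image S)
        then obtain B where B: "\<And>z. z \<in> S \<Longrightarrow> exp (wt n z) \<le> B" unfolding bdd_above_def by blast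
        have "(\<lambda>m. 1 / real (Suc m) * B) \<longlonglongrightarrow> 0 * B"
          by (intro tendsto_mult tendsto_const LIMSEQ_inverse_real_of_nat[unfolded inverse_eq_divide])
        then have lim: "(\<lambda>m. 1 / real (Suc (\<sigma> m)) * B) \<longlonglongrightarrow> 0"
          using LIMSEQ_subseq_LIMSEQ[OF _ s] by (simp add: o_def)
        show ?thesis
        proof (rule uniform_limitI)
          fix d :: real assume "0 < d"
          then have "\<forall>\<^sub>F m in sequentially. 1 / real (Suc (\<sigma> m)) * B < d" by (rule order_tendstoD(2)[OF lim])
          then show "\<forall>\<^sub>F m in sequentially. \<forall>z\<in>S. dist (G (\<sigma> m) n z) 0 < d"
          proof eventually_elim
            case (elim m)
            show ?case
            proof
              fix z assume "z \<in> S"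
              then have "1 / real (Suc (\<sigma> m)) * exp (wt n z) \<le> 1 / real (Suc (\<sigma> m)) * B" by (intro mult_left_mono B) auto
              then show "dist (G (\<sigma> m) n z) 0 < d" using Gn[of "\<sigma> m" z] elim by simp
            qed
          qed
        qed
      qed
      have "(\<lambda>z. f z + (\<Sum>j<n. g j z)) \<in> K"
      proof (rule seq[where f = "\<lambda>m z. f z + (\<Sum>j<Suc n. G (\<sigma> m) j z)" and B = "\<bar>Bf\<bar> + (\<Sum>j<n. \<bar>e j\<bar>) + 1" and k = k])
        show "(\<lambda>z. f z + (\<Sum>j<Suc n. G (\<sigma> m) j z)) \<in> K" for m by (rule G)
        show "norm (f z + (\<Sum>j<Suc n. G (\<sigma> m) j z)) \<le> (\<bar>Bf\<bar> + (\<Sum>j<n. \<bar>e j\<bar>) + 1) * exp (wt k z)" for m z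
        proof -
          have "norm (f z) \<le> \<bar>Bf\<bar> * exp (wt k z)"
            using f0(2)[of z] wtk[of k0 Bf z] by (simp add: k_def)
          moreover have "norm (\<Sum>j<n. G (\<sigma> m) j z) \<le> (\<Sum>j<n. \<bar>e j\<bar> * exp (wt k z))"
          proof (rule sum_norm_le)
            fix j assume "j \<in> {..<n}"
            then have j: "j < n" "j \<le> k" by (auto simp: k_def)
            have "norm (G (\<sigma> m) j z) \<le> e j * exp (wt j z)" using G(1)[OF j(1)] by (simp add: inball_def)
            also have "\<dots> \<le> \<bar>e j\<bar> * exp (wt k z)" by (rule wtk[OF j(2)])
            finally show "norm (G (\<sigma> m) j z) \<le> \<bar>e j\<bar> * exp (wt k z)" .
          qed
          moreover have "norm (G (\<sigma> m) n z) \<le> 1 * exp (wt k z)"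
          proof -
            have "1 / real (Suc (\<sigma> m)) * exp (wt n z) \<le> 1 * exp (wt k z)"
              using wt_mono[of n k z] by (intro mult_mono) (auto simp: k_def)
            then show ?thesis using Gn[of "\<sigma> m" z] by linarith
          qed
          moreover have "norm (f z + (\<Sum>j<Suc n. G (\<sigma> m) j z)) \<le> norm (f z) + (norm (\<Sum>j<n. G (\<sigma> m) j z) + norm (G (\<sigma> m) n z))"
            unfolding sum.lessThan_Suc by (meson add_left_mono norm_triangle_ineq order_trans)
          ultimately show ?thesis by (simp add: algebra_simps sum_distrib_right)
        qed
        show "uniform_limit S (\<lambda>m z. f z + (\<Sum>j<Suc n. G (\<sigma> m) j z)) (\<lambda>z. f z + (\<Sum>j<n. g j z)) sequentially" if S: "compact S" for S
        proof -
          have "uniform_limit S (\<lambda>m z. \<Sum>j<N. G (\<sigma> m) j z) (\<lambda>z. \<Sum>j<N. g j z) sequentially" if "N \<le> n" for N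
            using that
          proof (induction N)
            case (Suc N)
            then show ?case unfolding sum.lessThan_Suc by (intro uniform_limit_add g(2) S) auto
          qed (simp add: uniform_limit_const)
          then have us: "uniform_limit S (\<lambda>m z. \<Sum>j<n. G (\<sigma> m) j z) (\<lambda>z. \<Sum>j<n. g j z) sequentially" by blast
          have "uniform_limit S (\<lambda>m z. f z + ((\<Sum>j<n. G (\<sigma> m) j z) + G (\<sigma> m) n z)) (\<lambda>z. f z + ((\<Sum>j<n. g j z) + 0)) sequentially"
            by (intro uniform_limit_add us uniform_limit_const ule0 S)
          then show ?thesis by simp
        qed
        have "(\<lambda>z. f z + (\<Sum>j<n. g j z)) \<in> Pk \<omega> r c k"
        proof -
          have "norm (f z + (\<Sum>j<n. g j z)) \<le> (\<bar>Bf\<bar> + (\<Sum>j<n. \<bar>e j\<bar>)) * exp (wt k z)" for z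
          proof -
            have "norm (f z) \<le> \<bar>Bf\<bar> * exp (wt k z)"
              using f0(2)[of z] wtk[of k0 Bf z] by (simp add: k_def)
            moreover have "norm (\<Sum>j<n. g j z) \<le> (\<Sum>j<n. \<bar>e j\<bar> * exp (wt k z))"
            proof (rule sum_norm_le)
              fix j assume "j \<in> {..<n}"
              then have j: "j < n" "j \<le> k" by (auto simp: k_def)
              have "norm (g j z) \<le> e j * exp (wt j z)" using g(1)[OF j(1)] by (simp add: inball_def)
              also have "\<dots> \<le> \<bar>e j\<bar> * exp (wt k z)" by (rule wtk[OF j(2)])
              finally show "norm (g j z) \<le> \<bar>e j\<bar> * exp (wt k z)" .
            qed
            ultimately show ?thesis using norm_triangle_ineq[of "f z" "\<Sum>j<n. g j z"]
              by (simp add: algebra_simps sum_distrib_right)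
          qed
          then show ?thesis unfolding Pk_iff using f0(1) g(1)
            by (auto intro!: holomorphic_intros exI[of _ "\<bar>Bf\<bar> + (\<Sum>j<n. \<bar>e j\<bar>)"] simp: inball_def)
        qed
        then show "(\<lambda>z. f z + (\<Sum>j<n. g j z)) \<in> Pa \<omega> r c" unfolding Pa_def by blast
      qed
      then show False using av g(1) unfolding avoids_def by blast
    qed
    have "\<exists>E. \<forall>n. avoids n (E n) \<and> (\<forall>j<n. E (Suc n) j = E n j)"
      by (rule dependent_nat_choice) (use f(2) step in \<open>auto simp: avoids_def\<close>)
    then obtain E where E: "\<And>n. avoids n (E n)" "\<And>n j. j < n \<Longrightarrow> E (Suc n) j = E n j" by blast
    define \<epsilon> where "\<epsilon> j = E (Suc j) j" for j
    have En: "E n j = \<epsilon> j" if "j < n" for n j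
      using that
    proof (induction n)
      case (Suc n)
      then show ?case by (cases "j = n") (auto simp: \<epsilon>_def E(2))
    qed simp
    have av: "(\<lambda>z. f z + (\<Sum>j<n. g j z)) \<notin> K" if "\<And>j. j < n \<Longrightarrow> inball j (\<epsilon> j) (g j)" for n g
      using E(1)[of n] that En[of _ n] unfolding avoids_def by simp
    have \<epsilon>: "0 < \<epsilon> j" for j using E(1)[of "Suc j"] unfolding avoids_def \<epsilon>_def by blast
    define V where "V = {v. \<exists>n g. (\<forall>j. inball j (\<epsilon> j) (g j)) \<and> v = (\<lambda>z. \<Sum>j<n. g j z) \<and> (\<forall>j\<ge>n. g j = (\<lambda>z. 0))}"
    have inball_Pa: "g \<in> Pa \<omega> r c" if "inball j e g" for j e g
      using that unfolding inball_def Pa_def by (auto simp: Pk_iff)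
    have VPa: "V \<subseteq> Pa \<omega> r c"
    proof
      fix v assume "v \<in> V"
      then obtain n g where g: "\<And>j. inball j (\<epsilon> j) (g j)" "v = (\<lambda>z. \<Sum>j<n. g j z)" unfolding V_def by blast
      have "(\<lambda>z. \<Sum>j<n. g j z) \<in> Pa \<omega> r c"
      proof (induction n)
        case 0
        have "inball 0 1 (\<lambda>z. 0)" by (simp add: inball_def)
        then show ?case using inball_Pa by simp
      next
        case (Suc n)
        then show ?case using Pa_lin[OF Suc inball_Pa[OF g(1)[of n]], of 1 1] by simp
      qed
      then show "v \<in> Pa \<omega> r c" using g(2) by simp
    qed
    have "Pa_nhd0 \<omega> r c V"
      unfolding Pa_nhd0_def
    proof (intro conjI allI ballI impI VPa)
      fix u v \<alpha> \<beta> assume uv: "u \<in> V" "v \<in> V" and ab: "norm (\<alpha>::complex) + norm (\<beta>::complex) \<le> 1"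
      obtain n g where g: "\<And>j. inball j (\<epsilon> j) (g j)" "u = (\<lambda>z. \<Sum>j<n. g j z)" "\<And>j. n \<le> j \<Longrightarrow> g j = (\<lambda>z. 0)"
        using uv(1) unfolding V_def by blast
      obtain m h where h: "\<And>j. inball j (\<epsilon> j) (h j)" "v = (\<lambda>z. \<Sum>j<m. h j z)" "\<And>j. m \<le> j \<Longrightarrow> h j = (\<lambda>z. 0)"
        using uv(2) unfolding V_def by blast
      have u: "u z = (\<Sum>j<max m n. g j z)" for z
        unfolding g(2) by (rule sum.mono_neutral_left) (auto simp: g(3))
      have v: "v z = (\<Sum>j<max m n. h j z)" for z
        unfolding h(2) by (rule sum.mono_neutral_left) (auto simp: h(3))
      have "(\<lambda>z. \<alpha> * u z + \<beta> * v z) = (\<lambda>z. \<Sum>j<max m n. \<alpha> * g j z + \<beta> * h j z)"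
        by (simp add: u v sum.distrib sum_distrib_left)
      moreover have "inball j (\<epsilon> j) (\<lambda>z. \<alpha> * g j z + \<beta> * h j z)" for j
        unfolding inball_def
      proof (intro conjI allI)
        show "(\<lambda>z. \<alpha> * g j z + \<beta> * h j z) holomorphic_on UNIV"
          using g(1)[of j] h(1)[of j] by (auto intro!: holomorphic_intros simp: inball_def)
        fix z
        have "norm (\<alpha> * g j z + \<beta> * h j z) \<le> norm \<alpha> * norm (g j z) + norm \<beta> * norm (h j z)"
          using norm_triangle_ineq[of "\<alpha> * g j z" "\<beta> * h j z"] by (simp add: norm_mult)
        also have "\<dots> \<le> norm \<alpha> * (\<epsilon> j * exp (wt j z)) + norm \<beta> * (\<epsilon> j * exp (wt j z))"
          using g(1)[of j] h(1)[of j] by (intro add_mono mult_left_mono) (auto simp: inball_def)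
        also have "\<dots> = (norm \<alpha> + norm \<beta>) * (\<epsilon> j * exp (wt j z))" by (simp add: algebra_simps)
        also have "\<dots> \<le> 1 * (\<epsilon> j * exp (wt j z))" using ab \<epsilon>[of j] by (intro mult_right_mono) auto
        finally show "norm (\<alpha> * g j z + \<beta> * h j z) \<le> \<epsilon> j * exp (wt j z)" by simp
      qed
      moreover have "(\<lambda>z. \<alpha> * g j z + \<beta> * h j z) = (\<lambda>z. 0)" if "max m n \<le> j" for j
        using g(3)[of j] h(3)[of j] that by simp
      ultimately show "(\<lambda>z. \<alpha> * u z + \<beta> * v z) \<in> V"
        unfolding V_def by (intro CollectI exI[of _ "max m n"] exI[of _ "\<lambda>j z. \<alpha> * g j z + \<beta> * h j z"]) blast
    next
      fix k
      have "g \<in> V" if g: "g \<in> Pk \<omega> r c k" "Pk_norm \<omega> r c k g < \<epsilon> k" for g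
      proof -
        have "norm (g z) \<le> \<epsilon> k * exp (wt k z)" for z
          by (rule order_trans[OF Pk_norm_bound[OF g(1)] mult_right_mono]) (use g(2) in auto)
        then have "inball j (\<epsilon> j) (if j = k then g else (\<lambda>z. 0))" for j
          using Pk_holomorphic[OF g(1)] \<epsilon>[of j] by (simp add: inball_def)
        moreover have "g = (\<lambda>z. \<Sum>j<Suc k. (if j = k then g else (\<lambda>z. 0)) z)"
          by (simp add: if_distrib[of "\<lambda>f. f _"])
        ultimately show ?thesis unfolding V_def
          by (intro CollectI exI[of _ "Suc k"] exI[of _ "\<lambda>j. if j = k then g else (\<lambda>z. 0)"]) auto
      qed
      then show "\<exists>\<epsilon>>0. \<forall>f\<in>Pk \<omega> r c k. Pk_norm \<omega> r c k f < \<epsilon> \<longrightarrow> f \<in> V" using \<epsilon>[of k] by blast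
    qed
    moreover have "(\<lambda>z. f z + v z) \<in> Pa \<omega> r c - K" if "v \<in> V" for v
      using that av Pa_lin[OF f(1) subsetD[OF VPa that], of 1 1] unfolding V_def by auto
    ultimately show ?thesis by blast
  qed
  then have "openin (Pa_topology \<omega> r c) (Pa \<omega> r c - K)"
    unfolding openin_Pa_topology by auto
  then show ?thesis unfolding closedin_def top using sub by blast
qed

end

section \<open>Submodules determined by zeros and indicators\<close>

lemma ereal_le_uminus_swap: "a \<le> - b \<longleftrightarrow> b \<le> - (a::ereal)"
  by (metis ereal_minus_le_minus ereal_uminus_uminus)

lemma indicator_minimal_type_mult:
  assumes \<rho>: "minimal_type \<rho>" and f: "indicator_fun f \<theta> \<le> D"
  shows "indicator_fun (\<lambda>z. \<rho> z * f z) \<theta> \<le> D"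
proof (rule indicator_le_max[OF _ f indicator_fun_zero])
  fix e :: real assume e: "0 < e"
  obtain C where C: "\<And>z. norm (\<rho> z) \<le> C * exp (e * norm z)"
    using \<rho> e unfolding minimal_type_def by blast
  show "\<exists>C. \<forall>z. norm (\<rho> z * f z) \<le> C * exp (e * norm z) * (norm (f z) + norm (0::complex))"
    unfolding norm_mult by (intro exI[of _ C]) (auto intro!: mult_right_mono C)
qed

lemma indicator_add_le:
  assumes "indicator_fun f \<theta> \<le> D" "indicator_fun g \<theta> \<le> D"
  shows "indicator_fun (\<lambda>z. f z + g z) \<theta> \<le> D"
proof (rule indicator_le_max[OF _ assms])
  fix e :: real assume e: "0 < e"
  have "norm (f z + g z) \<le> 1 * exp (e * norm z) * (norm (f z) + norm (g z))" for z
  proof -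
    have "1 * (norm (f z) + norm (g z)) \<le> exp (e * norm z) * (norm (f z) + norm (g z))"
      using e by (intro mult_right_mono) auto
    then show ?thesis using norm_triangle_ineq[of "f z" "g z"] by simp
  qed
  then show "\<exists>C. \<forall>z. norm (f z + g z) \<le> C * exp (e * norm z) * (norm (f z) + norm (g z))" by blast
qed

lemma deriv_mult_vanish:
  assumes "f holomorphic_on UNIV" "g holomorphic_on UNIV" "\<And>j. j < n \<Longrightarrow> (deriv ^^ j) f \<mu> = 0" "j < n"
  shows "(deriv ^^ j) (\<lambda>z. g z * f z) \<mu> = 0"
  unfolding higher_deriv_mult[OF assms(2,1) open_UNIV UNIV_I]
  using assms(3,4) by (intro sum.neutral ballI) auto

context weighted_space
begin

text \<open>All functions vanishing to order \<open>n \<mu>\<close> at \<open>\<mu>\<close> whose indicator segment lies in \<open>[l; u]\<close>, together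
  with the zero function.  Vanishing is expressed by derivatives, which covers the zero function and
  passes to limits.\<close>

definition zeros_indicator_module :: "(complex \<Rightarrow> nat) \<Rightarrow> ereal \<Rightarrow> ereal \<Rightarrow> (complex \<Rightarrow> complex) set" where
  "zeros_indicator_module n l u = {\<psi> \<in> Pa \<omega> r c. (\<forall>\<mu>. \<forall>j<n \<mu>. (deriv ^^ j) \<psi> \<mu> = 0) \<and>
     indicator_fun \<psi> (- pi / 2) \<le> - l \<and> indicator_fun \<psi> (pi / 2) \<le> u}"

lemma minimal_type_poly: "minimal_type (poly p)"
proof -
  obtain A where A: "0 \<le> A" "\<And>x. 0 \<le> x \<Longrightarrow> \<omega> x \<le> A + x" using weight_le_linear[OF weight] by blast
  have "\<exists>C. \<forall>z. norm (poly p z) \<le> C * exp (e * norm z)" if e: "0 < e" for e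
  proof -
    obtain C where C: "0 \<le> C" "\<And>z. norm (poly p z) \<le> C * exp (e * \<omega> (norm z))"
      using poly_le_exp_weight[OF weight e] by blast
    have "norm (poly p z) \<le> (C * exp (e * A)) * exp (e * norm z)" for z
    proof -
      have "e * \<omega> (norm z) \<le> e * (A + norm z)" using e by (intro mult_left_mono A) auto
      then have "C * exp (e * \<omega> (norm z)) \<le> C * exp (e * (A + norm z))" using C by (intro mult_left_mono) auto
      also have "\<dots> = (C * exp (e * A)) * exp (e * norm z)" by (simp add: distrib_left exp_add)
      finally show ?thesis using C(2)[of z] by linarith
    qed
    then show ?thesis by blast
  qed
  then show ?thesis unfolding minimal_type_def by (auto intro!: holomorphic_intros)
qed

lemma minimal_type_mult_mem:
  assumes "\<psi> \<in> zeros_indicator_module n l u" "minimal_type \<rho>" "(\<lambda>z. \<rho> z * \<psi> z) \<in> Pa \<omega> r c"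
  shows "(\<lambda>z. \<rho> z * \<psi> z) \<in> zeros_indicator_module n l u"
proof -
  have "\<rho> holomorphic_on UNIV" using assms(2) by (simp add: minimal_type_def)
  then show ?thesis using assms
    unfolding zeros_indicator_module_def
    by (auto intro!: indicator_minimal_type_mult deriv_mult_vanish[of \<psi> \<rho> "n _"] Pa_holomorphic)
qed

lemma indicator_module_seq_closed:
  assumes f: "\<And>n::nat. f n \<in> zeros_indicator_module m l u" and B: "\<And>n z. norm (f n z) \<le> B * exp (wt k z)"
    and lim: "\<And>S. compact S \<Longrightarrow> uniform_limit S f g sequentially" and g: "g \<in> Pa \<omega> r c"
  shows "g \<in> zeros_indicator_module m l u"
proof -
  have hol: "f n holomorphic_on UNIV" for n
    using f Pa_holomorphic unfolding zeros_indicator_module_def by blast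
  have pl: "(\<lambda>n. f n z) \<longlonglongrightarrow> g z" for z
    using tendsto_uniform_limitI[OF lim[of "{z}"], of z] by simp
  have bd: "norm (f n z) \<le> max B 1 * exp (\<omega> (norm z) + c k * \<bar>Im z\<bar>)" for n z
    by (rule Pk_bound_Cartwright) (rule B)
  have c0: "0 \<le> c k" using c(2)[of k] by simp
  have "(deriv ^^ j) g \<mu> = 0" if j: "j < m \<mu>" for \<mu> j
  proof -
    have "uniform_limit (ball \<mu> 1) f g sequentially"
      by (rule uniform_limit_on_subset[OF lim[OF compact_cball[of \<mu> 1]]]) auto
    then have "(\<lambda>n. (deriv ^^ j) (f n) \<mu>) \<longlonglongrightarrow> (deriv ^^ j) g \<mu>"
      by (rule higher_deriv_complex_uniform_limit)
         (auto intro!: always_eventually holomorphic_on_subset[OF hol])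
    moreover have "(deriv ^^ j) (f n) \<mu> = 0" for n
      using f[of n] j unfolding zeros_indicator_module_def by blast
    ultimately show ?thesis using LIMSEQ_unique[OF _ tendsto_const] by simp
  qed
  moreover have "indicator_fun g (pi / 2) \<le> u"
    by (rule indicator_upper_limit[OF weight hol _ c0 bd _ pl])
       (use f in \<open>auto simp: zeros_indicator_module_def less_max_iff_disj\<close>)
  moreover have "indicator_fun (\<lambda>z. g (- z)) (pi / 2) \<le> - l"
  proof (rule indicator_upper_limit[OF weight])
    show "(\<lambda>z. f n (- z)) holomorphic_on UNIV" for n
      by (rule holomorphic_on_compose_gen[OF _ hol, unfolded o_def]) (auto intro!: holomorphic_intros)
    show "norm (f n (- z)) \<le> max B 1 * exp (\<omega> (norm z) + c k * \<bar>Im z\<bar>)" for n z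
      using bd[of n "- z"] by simp
    show "indicator_fun (\<lambda>z. f n (- z)) (pi / 2) \<le> - l" for n
      unfolding indicator_fun_uminus using f[of n] by (simp add: zeros_indicator_module_def)
  qed (use c0 pl in \<open>auto simp: less_max_iff_disj\<close>)
  then have "indicator_fun g (- pi / 2) \<le> - l" unfolding indicator_fun_uminus .
  ultimately show ?thesis using g unfolding zeros_indicator_module_def by blast
qed

lemma closed_submodule_zeros_indicator_module:
  "closed_submodule \<omega> r c (zeros_indicator_module n l u)"
  unfolding closed_submodule_def
proof (intro conjI ballI allI)
  have z: "(\<lambda>z. 0) \<in> Pk \<omega> r c 0" unfolding Pk_iff by (auto intro!: exI[of _ 0])
  then show "(\<lambda>z. 0) \<in> zeros_indicator_module n l u"
    unfolding zeros_indicator_module_def Pa_def by (auto simp: indicator_fun_zero)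
  fix f assume f: "f \<in> zeros_indicator_module n l u"
  show "(\<lambda>z. f z + g z) \<in> zeros_indicator_module n l u" if g: "g \<in> zeros_indicator_module n l u" for g
  proof -
    have Pa: "f \<in> Pa \<omega> r c" "g \<in> Pa \<omega> r c" using f g by (auto simp: zeros_indicator_module_def)
    have "(\<lambda>z. f z + g z) \<in> Pa \<omega> r c" using Pa_lin[OF Pa, of 1 1] by simp
    moreover have "(deriv ^^ j) (\<lambda>z. f z + g z) \<mu> = 0" if "j < n \<mu>" for j \<mu>
      using higher_deriv_add[OF Pa_holomorphic[OF Pa(1)] Pa_holomorphic[OF Pa(2)] open_UNIV UNIV_I, of j \<mu>] f g that
      by (simp add: zeros_indicator_module_def)
    ultimately show ?thesis using f g
      unfolding zeros_indicator_module_def by (auto intro!: indicator_add_le)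
  qed
  show "(\<lambda>z. poly p z * f z) \<in> zeros_indicator_module n l u" for p
    by (rule minimal_type_mult_mem[OF f minimal_type_poly Pa_poly_mult])
       (use f in \<open>simp add: zeros_indicator_module_def\<close>)
next
  show "closedin (Pa_topology \<omega> r c) (zeros_indicator_module n l u)"
  proof (rule closedin_Pa_if_sequentially_closed)
    show "zeros_indicator_module n l u \<subseteq> Pa \<omega> r c" by (auto simp: zeros_indicator_module_def)
  qed (rule indicator_module_seq_closed)
qed

lemma closed_submodule_subset_Pa:
  assumes "closed_submodule \<omega> r c J"
  shows "J \<subseteq> Pa \<omega> r c"
proof -
  have "topspace (Pa_topology \<omega> r c) = Pa \<omega> r c"
    using weight_nonneg[OF weight] r(1) c(1) by (intro topspace_Pa_topology) auto
  then show ?thesis using assms closedin_subset unfolding closed_submodule_def by blast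
qed

lemma zero_mult_le_zorder:
  assumes "\<phi> \<in> J" "\<phi> \<noteq> (\<lambda>z. 0)"
  shows "zero_mult J \<mu> \<le> nat (zorder \<phi> \<mu>)"
  unfolding zero_mult_def using assms by (intro cINF_lower) auto

lemma deriv_vanish_below_zero_mult:
  assumes J: "J \<subseteq> Pa \<omega> r c" and \<phi>: "\<phi> \<in> J" and j: "j < zero_mult J \<mu>"
  shows "(deriv ^^ j) \<phi> \<mu> = 0"
proof (cases "\<phi> = (\<lambda>z. 0)")
  case False
  have "\<phi> holomorphic_on UNIV" using J \<phi> Pa_holomorphic by blast
  then show ?thesis
    using zorder_ge_iff[OF _ False, of "zero_mult J \<mu>" \<mu>] zero_mult_le_zorder[OF \<phi> False, of \<mu>] j by blast
qed simp

lemma subset_zeros_indicator_module: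
  assumes J: "J \<subseteq> Pa \<omega> r c"
  shows "J \<subseteq> zeros_indicator_module (zero_mult J) (ind_lower J) (ind_upper J)"
proof
  fix \<phi> assume \<phi>: "\<phi> \<in> J"
  have "indicator_fun \<phi> (- pi / 2) \<le> - ind_lower J"
  proof (cases "\<phi> = (\<lambda>z. 0)")
    case False
    then have "ind_lower J \<le> - indicator_fun \<phi> (- pi / 2)"
      unfolding ind_lower_def using \<phi> by (intro INF_lower) auto
    then show ?thesis by (simp add: ereal_le_uminus_swap)
  qed (simp add: indicator_fun_zero)
  moreover have "indicator_fun \<phi> (pi / 2) \<le> ind_upper J"
  proof (cases "\<phi> = (\<lambda>z. 0)")
    case False
    then show ?thesis unfolding ind_upper_def using \<phi> by (intro SUP_upper) auto
  qed (simp add: indicator_fun_zero)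
  ultimately show "\<phi> \<in> zeros_indicator_module (zero_mult J) (ind_lower J) (ind_upper J)"
    using deriv_vanish_below_zero_mult[OF J \<phi>] J \<phi> unfolding zeros_indicator_module_def by blast
qed

text \<open>The largest submodule with the same zero set and indicator segment as \<open>J\<close>.\<close>

lemma invariants_zeros_indicator_module:
  assumes J: "J \<subseteq> Pa \<omega> r c" and nz: "\<exists>\<phi>\<in>J. \<phi> \<noteq> (\<lambda>z. 0)"
  defines "K \<equiv> zeros_indicator_module (zero_mult J) (ind_lower J) (ind_upper J)"
  shows "zero_mult K = zero_mult J" "ind_lower K = ind_lower J" "ind_upper K = ind_upper J"
proof -
  have JK: "J - {\<lambda>z. 0} \<subseteq> K - {\<lambda>z. 0}" using subset_zeros_indicator_module[OF J] unfolding K_def by blast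
  have ne: "J - {\<lambda>z. 0} \<noteq> {}" using nz by blast
  show "zero_mult K = zero_mult J"
  proof
    fix \<mu>
    have "zero_mult K \<mu> \<le> zero_mult J \<mu>"
      unfolding zero_mult_def by (rule cINF_superset_mono[OF ne _ JK]) auto
    moreover have "zero_mult J \<mu> \<le> zero_mult K \<mu>"
      unfolding zero_mult_def[of K]
    proof (rule cINF_greatest)
      fix \<psi> assume "\<psi> \<in> K - {\<lambda>z. 0}"
      then have "\<psi> holomorphic_on UNIV" "\<psi> \<noteq> (\<lambda>z. 0)" "\<forall>j<zero_mult J \<mu>. (deriv ^^ j) \<psi> \<mu> = 0"
        using Pa_holomorphic by (auto simp: K_def zeros_indicator_module_def)
      then show "zero_mult J \<mu> \<le> nat (zorder \<psi> \<mu>)" using zorder_ge_iff by blast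
    qed (use ne JK in blast)
    ultimately show "zero_mult K \<mu> = zero_mult J \<mu>" by simp
  qed
  show "ind_lower K = ind_lower J"
  proof (rule antisym)
    show "ind_lower K \<le> ind_lower J" unfolding ind_lower_def by (rule INF_superset_mono[OF JK]) simp
    show "ind_lower J \<le> ind_lower K"
      unfolding ind_lower_def[of K]
      by (rule INF_greatest) (auto simp: K_def zeros_indicator_module_def ereal_le_uminus_swap)
  qed
  show "ind_upper K = ind_upper J"
  proof (rule antisym)
    show "ind_upper J \<le> ind_upper K" unfolding ind_upper_def by (rule SUP_subset_mono[OF JK]) simp
    show "ind_upper K \<le> ind_upper J"
      unfolding ind_upper_def[of K]
      by (rule SUP_least) (auto simp: K_def zeros_indicator_module_def)
  qed
qed

lemma closed_submodule_nonzero: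
  assumes "closed_submodule \<omega> r c J" "J \<noteq> {\<lambda>z. 0}"
  shows "\<exists>\<phi>\<in>J. \<phi> \<noteq> (\<lambda>z. 0)"
  using assms unfolding closed_submodule_def by blast

text \<open>Multiplication by a function of minimal type neither removes zeros nor raises the indicator.\<close>

lemma weakly_localisable_imp_J_gen_subset:
  assumes wl: "weakly_localisable \<omega> r c J" and \<phi>: "\<phi> \<in> J"
  shows "J_gen \<omega> r c \<phi> \<subseteq> J"
proof -
  have J: "closed_submodule \<omega> r c J" "J \<noteq> {\<lambda>z. 0}" using wl by (auto simp: weakly_localisable_def)
  note sub = closed_submodule_subset_Pa[OF J(1)] and nz = closed_submodule_nonzero[OF J]
  define K where "K = zeros_indicator_module (zero_mult J) (ind_lower J) (ind_upper J)"
  have JK: "J \<subseteq> K" unfolding K_def by (rule subset_zeros_indicator_module[OF sub])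
  have "K \<noteq> {\<lambda>z. 0}" using JK nz by blast
  then have "K = J"
    using wl JK invariants_zeros_indicator_module[OF sub nz]
      closed_submodule_zeros_indicator_module[of "zero_mult J" "ind_lower J" "ind_upper J"]
    unfolding weakly_localisable_def K_def by blast
  moreover have "J_gen \<omega> r c \<phi> \<subseteq> K"
    unfolding J_gen_def using minimal_type_mult_mem JK \<phi> unfolding K_def by blast
  ultimately show ?thesis by simp
qed

end

section \<open>The Hahn--Banach theorem\<close>

text \<open>Complex vector spaces of functions, with pointwise operations; real-valued functionals need to be
  sublinear on \<open>X\<close> only.\<close>

locale complex_function_space =
  fixes X :: "('a \<Rightarrow> complex) set"
  assumes lin: "\<And>f g \<alpha> \<beta>. f \<in> X \<Longrightarrow> g \<in> X \<Longrightarrow> (\<lambda>z. \<alpha> * f z + \<beta> * g z) \<in> X"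
begin

definition sublinear :: "(('a \<Rightarrow> complex) \<Rightarrow> real) \<Rightarrow> bool" where
  "sublinear q \<longleftrightarrow> (\<forall>f\<in>X. \<forall>g\<in>X. q (\<lambda>z. f z + g z) \<le> q f + q g) \<and>
     (\<forall>f\<in>X. \<forall>t>0. q (\<lambda>z. of_real t * f z) \<le> t * q f)"

lemma add_mem: "f \<in> X \<Longrightarrow> g \<in> X \<Longrightarrow> (\<lambda>z. f z + g z) \<in> X"
  using lin[of f g 1 1] by simp

lemma scale_mem: "f \<in> X \<Longrightarrow> (\<lambda>z. \<alpha> * f z) \<in> X"
  using lin[of f f \<alpha> 0] by simp

lemma sublinearD:
  assumes "sublinear q"
  shows "\<And>f g. f \<in> X \<Longrightarrow> g \<in> X \<Longrightarrow> q (\<lambda>z. f z + g z) \<le> q f + q g"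
    and "\<And>f t. f \<in> X \<Longrightarrow> 0 < t \<Longrightarrow> q (\<lambda>z. of_real t * f z) \<le> t * q f"
  using assms by (auto simp: sublinear_def)

lemma sublinear_zero:
  assumes q: "sublinear q" and X: "X \<noteq> {}"
  shows "q (\<lambda>z. 0) = 0"
proof -
  obtain f where "f \<in> X" using X by blast
  then have z: "(\<lambda>z. 0) \<in> X" using scale_mem[of f 0] by simp
  have "q (\<lambda>z. 0) \<le> q (\<lambda>z. 0) + q (\<lambda>z. 0)" using sublinearD(1)[OF q z z] by simp
  moreover have "q (\<lambda>z. 0) \<le> 1/2 * q (\<lambda>z. 0)" using sublinearD(2)[OF q z, of "1/2"] by simp
  ultimately show ?thesis by linarith
qed

lemma sublinear_scale:
  assumes q: "sublinear q" and f: "f \<in> X" and t: "0 \<le> t"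
  shows "q (\<lambda>z. of_real t * f z) = t * q f"
proof (cases "t = 0")
  case True
  then show ?thesis using sublinear_zero[OF q] f by auto
next
  case False
  then have t: "0 < t" using t by simp
  have "q (\<lambda>z. of_real (1/t) * (of_real t * f z)) \<le> 1/t * q (\<lambda>z. of_real t * f z)"
    using t by (intro sublinearD(2)[OF q] scale_mem f) auto
  moreover have "(\<lambda>z. of_real (1/t) * (of_real t * f z)) = f" using t by (simp add: fun_eq_iff)
  ultimately have "t * q f \<le> q (\<lambda>z. of_real t * f z)" using t by (simp add: field_simps)
  then show ?thesis using sublinearD(2)[OF q f t] by simp
qed

lemma sublinear_neg_le:
  assumes q: "sublinear q" and f: "f \<in> X"
  shows "- q (\<lambda>z. - f z) \<le> q f"
proof -
  have "(\<lambda>z. - f z) \<in> X" using scale_mem[OF f, of "-1"] by simp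
  then have "q (\<lambda>z. f z + - f z) \<le> q f + q (\<lambda>z. - f z)" by (rule sublinearD(1)[OF q f])
  moreover have "X \<noteq> {}" using f by blast
  ultimately show ?thesis using sublinear_zero[OF q] by simp
qed

text \<open>The largest sublinear functional below \<open>q\<close> whose value at \<open>- y\<close> is at most \<open>- q y\<close>; outside \<open>X\<close>
  it is set to \<open>0\<close>, so that functionals are determined by their values on \<open>X\<close>.\<close>

definition lowered :: "(('a \<Rightarrow> complex) \<Rightarrow> real) \<Rightarrow> ('a \<Rightarrow> complex) \<Rightarrow> ('a \<Rightarrow> complex) \<Rightarrow> real" where
  "lowered q y f = (if f \<in> X then INF t\<in>{0..}. q (\<lambda>z. f z + of_real t * y z) - t * q y else 0)"

lemma lowered_le:
  assumes q: "sublinear q" and y: "y \<in> X" and f: "f \<in> X" and t: "0 \<le> t"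
  shows "lowered q y f \<le> q (\<lambda>z. f z + of_real t * y z) - t * q y"
proof -
  have "- q (\<lambda>z. - f z) \<le> q (\<lambda>z. f z + of_real s * y z) - s * q y" if s: "0 \<le> s" for s
  proof -
    have m: "(\<lambda>z. f z + of_real s * y z) \<in> X" "(\<lambda>z. - f z) \<in> X"
      using add_mem[OF f scale_mem[OF y]] scale_mem[OF f, of "-1"] by simp_all
    have "(\<lambda>z. (f z + of_real s * y z) + - f z) = (\<lambda>z. of_real s * y z)" by simp
    then show ?thesis using sublinearD(1)[OF q m] sublinear_scale[OF q y s] by simp
  qed
  then have "bdd_below ((\<lambda>t. q (\<lambda>z. f z + of_real t * y z) - t * q y) ` {0..})"
    by (intro bdd_belowI2[of _ "- q (\<lambda>z. - f z)"]) auto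
  then show ?thesis unfolding lowered_def using f t by (auto intro: cINF_lower)
qed

lemma lowered_greatest:
  assumes "f \<in> X" "\<And>t. 0 \<le> t \<Longrightarrow> b \<le> q (\<lambda>z. f z + of_real t * y z) - t * q y"
  shows "b \<le> lowered q y f"
  unfolding lowered_def using assms by (auto intro!: cINF_greatest)

lemma sublinear_lowered:
  assumes q: "sublinear q" and y: "y \<in> X"
  shows "sublinear (lowered q y)"
  unfolding sublinear_def
proof (intro conjI ballI allI impI)
  fix f g assume f: "f \<in> X" and g: "g \<in> X"
  have "lowered q y (\<lambda>z. f z + g z) - (q (\<lambda>z. f z + of_real t * y z) - t * q y) \<le> lowered q y g" if t: "0 \<le> t" for t
  proof (rule lowered_greatest[OF g])
    fix s :: real assume s: "0 \<le> s"
    have "lowered q y (\<lambda>z. f z + g z) \<le> q (\<lambda>z. (f z + g z) + of_real (t + s) * y z) - (t + s) * q y"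
      using s t by (intro lowered_le q y add_mem f g) auto
    also have "(\<lambda>z. (f z + g z) + of_real (t + s) * y z) = (\<lambda>z. (f z + of_real t * y z) + (g z + of_real s * y z))"
      by (simp add: algebra_simps)
    also have "q \<dots> \<le> q (\<lambda>z. f z + of_real t * y z) + q (\<lambda>z. g z + of_real s * y z)"
      by (intro sublinearD(1)[OF q] add_mem f g scale_mem y)
    finally show "lowered q y (\<lambda>z. f z + g z) - (q (\<lambda>z. f z + of_real t * y z) - t * q y)
        \<le> q (\<lambda>z. g z + of_real s * y z) - s * q y" by (simp add: algebra_simps)
  qed
  then have "lowered q y (\<lambda>z. f z + g z) - lowered q y g \<le> lowered q y f"
    by (intro lowered_greatest[OF f]) (simp add: algebra_simps)
  then show "lowered q y (\<lambda>z. f z + g z) \<le> lowered q y f + lowered q y g" by simp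
next
  fix f and t :: real assume f: "f \<in> X" and t: "0 < t"
  have "lowered q y (\<lambda>z. of_real t * f z) / t \<le> lowered q y f"
  proof (rule lowered_greatest[OF f])
    fix s :: real assume s: "0 \<le> s"
    have "lowered q y (\<lambda>z. of_real t * f z) \<le> q (\<lambda>z. of_real t * f z + of_real (t * s) * y z) - (t * s) * q y"
      using s t by (intro lowered_le q y scale_mem f) auto
    also have "(\<lambda>z. of_real t * f z + of_real (t * s) * y z) = (\<lambda>z. of_real t * (f z + of_real s * y z))"
      by (simp add: algebra_simps)
    also have "q \<dots> = t * q (\<lambda>z. f z + of_real s * y z)"
      using t by (intro sublinear_scale q add_mem f scale_mem y) auto
    finally show "lowered q y (\<lambda>z. of_real t * f z) / t \<le> q (\<lambda>z. f z + of_real s * y z) - s * q y"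
      using t by (simp add: field_simps)
  qed
  then show "lowered q y (\<lambda>z. of_real t * f z) \<le> t * lowered q y f" using t by (simp add: field_simps)
qed

lemma lowered_le_self:
  assumes "sublinear q" "y \<in> X" "f \<in> X"
  shows "lowered q y f \<le> q f"
  using lowered_le[OF assms, of 0] by simp

text \<open>By Zorn's lemma there is a minimal sublinear functional below \<open>p\<close> with value at most \<open>- p x\<close> at
  \<open>- x\<close>.  It is additive, because lowering it along any direction does not change it.\<close>

lemma Hahn_Banach_real:
  assumes p: "sublinear p" and x: "x \<in> X"
  obtains s where "\<And>f g. f \<in> X \<Longrightarrow> g \<in> X \<Longrightarrow> s (\<lambda>z. f z + g z) = s f + s g"
    "\<And>f t. f \<in> X \<Longrightarrow> s (\<lambda>z. of_real t * f z) = t * s f" "\<And>f. f \<in> X \<Longrightarrow> s f \<le> p f" "p x \<le> s x"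
proof -
  define mx where "mx = (\<lambda>z. - x z)"
  have mx: "mx \<in> X" using scale_mem[OF x, of "-1"] by (simp add: mx_def)
  have ne: "X \<noteq> {}" using x by blast
  define A where "A = {q. sublinear q \<and> (\<forall>f\<in>X. q f \<le> p f) \<and> (\<forall>f. f \<notin> X \<longrightarrow> q f = 0) \<and> q mx \<le> - p x}"
  define P where "P a b \<longleftrightarrow> (\<forall>f. b f \<le> a f)" for a b :: "('a \<Rightarrow> complex) \<Rightarrow> real"
  have start: "lowered p x \<in> A"
  proof -
    have "lowered p x mx \<le> p (\<lambda>z. mx z + of_real 1 * x z) - 1 * p x" by (rule lowered_le[OF p x mx]) simp
    also have "(\<lambda>z. mx z + of_real 1 * x z) = (\<lambda>z. 0)" by (simp add: mx_def)
    finally have "lowered p x mx \<le> - p x" using sublinear_zero[OF p ne] by simp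
    then show ?thesis
      using sublinear_lowered[OF p x] lowered_le_self[OF p x] unfolding A_def by (auto simp: lowered_def)
  qed
  have "\<exists>m\<in>A. \<forall>a\<in>A. P m a \<longrightarrow> a = m"
  proof (rule predicate_Zorn)
    show "partial_order_on A (relation_of P A)"
      unfolding partial_order_on_def preorder_on_def refl_on_def trans_def antisym_def relation_of_def P_def
      by (auto simp: fun_eq_iff intro: order_trans antisym)
    fix C assume C: "C \<in> Chains (relation_of P A)"
    then have CA: "C \<subseteq> A" and ch: "\<And>a b. a \<in> C \<Longrightarrow> b \<in> C \<Longrightarrow> P a b \<or> P b a"
      unfolding Chains_def relation_of_def by auto
    show "\<exists>u\<in>A. \<forall>a\<in>C. P a u"
    proof (cases "C = {}")
      case True
      then show ?thesis using start by auto
    next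
      case False
      define u where "u f = (INF a\<in>C. a f)" for f
      have bdd: "bdd_below ((\<lambda>a. a f) ` C)" for f
      proof (cases "f \<in> X")
        case True
        have mf: "(\<lambda>z. - f z) \<in> X" using scale_mem[OF True, of "-1"] by simp
        show ?thesis
        proof (rule bdd_belowI2)
          fix a assume "a \<in> C"
          then have "sublinear a" "a (\<lambda>z. - f z) \<le> p (\<lambda>z. - f z)" using CA mf by (auto simp: A_def)
          then show "- p (\<lambda>z. - f z) \<le> a f" using sublinear_neg_le[OF _ True, of a] by simp
        qed
      next
        case False
        then show ?thesis using CA by (intro bdd_belowI2[of _ 0]) (auto simp: A_def)
      qed
      have ule: "u f \<le> a f" if "a \<in> C" for a f
        unfolding u_def by (rule cINF_lower[OF bdd that])
      have ug: "b \<le> u f" if "\<And>a. a \<in> C \<Longrightarrow> b \<le> a f" for b f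
        unfolding u_def using False that by (rule cINF_greatest)
      have "sublinear u"
        unfolding sublinear_def
      proof (intro conjI ballI allI impI)
        fix f g assume f: "f \<in> X" and g: "g \<in> X"
        have "u (\<lambda>z. f z + g z) \<le> a f + b g" if ab: "a \<in> C" "b \<in> C" for a b
        proof -
          obtain d where d: "d \<in> C" "d f \<le> a f" "d g \<le> b g"
            using ch[OF ab] ab unfolding P_def by blast
          have "sublinear d" using d CA by (auto simp: A_def)
          then have "d (\<lambda>z. f z + g z) \<le> d f + d g" using f g by (rule sublinearD(1))
          then show ?thesis using ule[OF d(1), of "\<lambda>z. f z + g z"] d by linarith
        qed
        then have "u (\<lambda>z. f z + g z) - a f \<le> b g" if "a \<in> C" "b \<in> C" for a b
          using that by (simp add: diff_le_eq add.commute)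
        then have "u (\<lambda>z. f z + g z) - a f \<le> u g" if "a \<in> C" for a
          using that by (intro ug)
        then have "u (\<lambda>z. f z + g z) - u g \<le> u f" by (intro ug) (simp add: algebra_simps)
        then show "u (\<lambda>z. f z + g z) \<le> u f + u g" by simp
      next
        fix f and t :: real assume f: "f \<in> X" and t: "0 < t"
        have "u (\<lambda>z. of_real t * f z) / t \<le> u f"
        proof (rule ug)
          fix a assume a: "a \<in> C"
          then have "sublinear a" using CA by (auto simp: A_def)
          then have "a (\<lambda>z. of_real t * f z) \<le> t * a f" using f t by (rule sublinearD(2))
          then show "u (\<lambda>z. of_real t * f z) / t \<le> a f"
            using ule[OF a, of "\<lambda>z. of_real t * f z"] t by (simp add: divide_le_eq mult.commute)
        qed
        then show "u (\<lambda>z. of_real t * f z) \<le> t * u f" using t by (simp add: divide_le_eq mult.commute)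
      qed
      moreover obtain a where a: "a \<in> C" using False by blast
      then have "(\<forall>f\<in>X. a f \<le> p f) \<and> a mx \<le> - p x" using CA by (auto simp: A_def)
      then have "(\<forall>f\<in>X. u f \<le> p f) \<and> u mx \<le> - p x" using ule[OF a] order_trans by blast
      moreover have "u f = 0" if "f \<notin> X" for f
        using CA that False unfolding u_def by (subst INF_cong[of C C _ "\<lambda>a. 0"]) (auto simp: A_def)
      ultimately have "u \<in> A" by (auto simp: A_def)
      then show ?thesis using ule unfolding P_def by blast
    qed
  qed
  then obtain m where mA: "m \<in> A" and min: "\<And>a. a \<in> A \<Longrightarrow> P m a \<Longrightarrow> a = m" by blast
  have m: "sublinear m" "\<And>f. f \<in> X \<Longrightarrow> m f \<le> p f" "\<And>f. f \<notin> X \<Longrightarrow> m f = 0" "m mx \<le> - p x"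
    using mA by (auto simp: A_def)
  have add: "m (\<lambda>z. f z + y z) = m f + m y" if f: "f \<in> X" and y: "y \<in> X" for f y
  proof -
    have le: "lowered m y g \<le> m g" for g
      using lowered_le_self[OF m(1) y] m(3) by (cases "g \<in> X") (auto simp: lowered_def)
    then have "lowered m y \<in> A"
    proof -
      have "lowered m y g \<le> p g" if "g \<in> X" for g using order_trans[OF le m(2)[OF that]] .
      moreover have "lowered m y mx \<le> - p x" using order_trans[OF le m(4)] .
      moreover have "lowered m y g = 0" if "g \<notin> X" for g using that by (simp add: lowered_def)
      ultimately show ?thesis using sublinear_lowered[OF m(1) y] unfolding A_def by blast
    qed
    then have "lowered m y = m" using le by (intro min) (auto simp: P_def)
    then have "m f \<le> m (\<lambda>z. f z + y z) - m y" using lowered_le[OF m(1) y f, of 1] by simp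
    then show ?thesis using sublinearD(1)[OF m(1) f y] by linarith
  qed
  have neg: "m (\<lambda>z. - f z) = - m f" if f: "f \<in> X" for f
  proof -
    have "(\<lambda>z. - f z) \<in> X" using scale_mem[OF f, of "-1"] by simp
    then have "m (\<lambda>z. f z + - f z) = m f + m (\<lambda>z. - f z)" by (rule add[OF f])
    then show ?thesis using sublinear_zero[OF m(1) ne] by simp
  qed
  show ?thesis
  proof (rule that[of m])
    show "m (\<lambda>z. of_real t * f z) = t * m f" if f: "f \<in> X" for f t
    proof (cases "0 \<le> t")
      case True
      then show ?thesis by (rule sublinear_scale[OF m(1) f])
    next
      case False
      have "m (\<lambda>z. - (of_real t * f z)) = - m (\<lambda>z. of_real t * f z)" by (intro neg scale_mem f)
      moreover have "m (\<lambda>z. of_real (- t) * f z) = - t * m f" using False by (intro sublinear_scale m(1) f) simp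
      ultimately show ?thesis by simp
    qed
    show "p x \<le> m x" using neg[OF x] m(4) by (simp add: mx_def)
  qed (use add m(2) in auto)
qed

lemma Hahn_Banach_complex:
  assumes p: "sublinear p" and x: "x \<in> X"
    and scale: "\<And>f \<alpha>. f \<in> X \<Longrightarrow> norm \<alpha> = 1 \<Longrightarrow> p (\<lambda>z. \<alpha> * f z) \<le> p f"
  obtains S where "\<And>f g \<alpha> \<beta>. f \<in> X \<Longrightarrow> g \<in> X \<Longrightarrow> S (\<lambda>z. \<alpha> * f z + \<beta> * g z) = \<alpha> * S f + \<beta> * S g"
    "\<And>f. f \<in> X \<Longrightarrow> norm (S f) \<le> 2 * p f" "p x \<le> Re (S x)"
proof -
  obtain s where s: "\<And>f g. f \<in> X \<Longrightarrow> g \<in> X \<Longrightarrow> s (\<lambda>z. f z + g z) = s f + s g"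
    "\<And>f t. f \<in> X \<Longrightarrow> s (\<lambda>z. of_real t * f z) = t * s f" "\<And>f. f \<in> X \<Longrightarrow> s f \<le> p f" "p x \<le> s x"
    using Hahn_Banach_real[OF p x] by blast
  define S where "S f = Complex (s f) (- s (\<lambda>z. \<i> * f z))" for f
  have abs: "\<bar>s f\<bar> \<le> p f" if f: "f \<in> X" for f
  proof -
    have "s (\<lambda>z. of_real (-1) * f z) = - s f" using s(2)[OF f, of "-1"] by simp
    moreover have "s (\<lambda>z. of_real (-1) * f z) \<le> p (\<lambda>z. of_real (-1) * f z)" by (intro s scale_mem f)
    moreover have "p (\<lambda>z. of_real (-1) * f z) \<le> p f" by (intro scale f) simp
    ultimately show ?thesis using s(3)[OF f] by linarith
  qed
  have bound: "norm (S f) \<le> 2 * p f" if f: "f \<in> X" for f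
  proof -
    have "norm (S f) \<le> \<bar>s f\<bar> + \<bar>s (\<lambda>z. \<i> * f z)\<bar>" using cmod_le[of "S f"] by (simp add: S_def)
    also have "\<dots> \<le> p f + p (\<lambda>z. \<i> * f z)" by (intro add_mono abs f scale_mem)
    also have "p (\<lambda>z. \<i> * f z) \<le> p f" by (intro scale f) simp
    finally show ?thesis by simp
  qed
  have scal: "S (\<lambda>z. \<alpha> * f z) = \<alpha> * S f" if f: "f \<in> X" for f \<alpha>
  proof -
    have i: "(\<lambda>z. \<i> * f z) \<in> X" by (rule scale_mem[OF f])
    have 1: "s (\<lambda>z. Complex a b * f z) = a * s f + b * s (\<lambda>z. \<i> * f z)" for a b
    proof -
      have "(\<lambda>z. Complex a b * f z) = (\<lambda>z. of_real a * f z + of_real b * (\<i> * f z))"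
        by (simp add: fun_eq_iff complex_eq_iff algebra_simps)
      then show ?thesis using s(1)[OF scale_mem[OF f, of "of_real a"] scale_mem[OF i, of "of_real b"]] s(2)[OF f] s(2)[OF i] by simp
    qed
    obtain a b where \<alpha>: "\<alpha> = Complex a b" by (cases \<alpha>)
    have "(\<lambda>z. \<i> * (\<alpha> * f z)) = (\<lambda>z. Complex (- b) a * f z)"
      by (simp add: \<alpha> fun_eq_iff complex_eq_iff algebra_simps)
    then have "s (\<lambda>z. \<i> * (\<alpha> * f z)) = - b * s f + a * s (\<lambda>z. \<i> * f z)" by (simp add: 1)
    then show ?thesis unfolding S_def by (simp add: \<alpha> 1 complex_eq_iff)
  qed
  have "S (\<lambda>z. f z + g z) = S f + S g" if "f \<in> X" "g \<in> X" for f g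
    using s(1)[OF that] s(1)[OF scale_mem[OF that(1), of \<i>] scale_mem[OF that(2), of \<i>]]
    unfolding S_def by (simp add: distrib_left complex_eq_iff)
  then have "S (\<lambda>z. \<alpha> * f z + \<beta> * g z) = \<alpha> * S f + \<beta> * S g" if "f \<in> X" "g \<in> X" for f g \<alpha> \<beta>
    using scal scale_mem that by presburger
  then show ?thesis using that[of S] bound s(4) by (simp add: S_def)
qed

end

context weighted_space
begin

lemma closed_submodule_lin:
  assumes J: "closed_submodule \<omega> r c J" and "f \<in> J" "g \<in> J"
  shows "(\<lambda>z. \<alpha> * f z + \<beta> * g z) \<in> J"
proof -
  have "(\<lambda>z. poly [:\<alpha>:] z * f z) \<in> J" "(\<lambda>z. poly [:\<beta>:] z * g z) \<in> J"
    using assms unfolding closed_submodule_def by blast+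
  then have m: "(\<lambda>z. \<alpha> * f z) \<in> J" "(\<lambda>z. \<beta> * g z) \<in> J" by simp_all
  have "\<forall>f\<in>J. \<forall>g\<in>J. (\<lambda>z. f z + g z) \<in> J" using J by (simp add: closed_submodule_def)
  from this[rule_format, OF m] show ?thesis .
qed

text \<open>The functional is dominated by the gauge of \<open>V + J\<close>, where \<open>V\<close> is an absolutely convex
  neighbourhood of zero such that \<open>\<psi> + V\<close> does not meet \<open>J\<close>.\<close>

lemma separating_functional:
  assumes J: "closed_submodule \<omega> r c J" and \<psi>: "\<psi> \<in> Pa \<omega> r c" "\<psi> \<notin> J"
  obtains S where
    "\<And>f g \<alpha> \<beta>. f \<in> Pa \<omega> r c \<Longrightarrow> g \<in> Pa \<omega> r c \<Longrightarrow> S (\<lambda>z. \<alpha> * f z + \<beta> * g z) = \<alpha> * S f + \<beta> * S g"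
    "\<And>k. \<exists>C\<ge>0. \<forall>f\<in>Pk \<omega> r c k. norm (S f) \<le> C * Pk_norm \<omega> r c k f"
    "\<And>f. f \<in> J \<Longrightarrow> S f = 0" "S \<psi> \<noteq> (0::complex)"
proof -
  note sub = closed_submodule_subset_Pa[OF J]
  have top: "topspace (Pa_topology \<omega> r c) = Pa \<omega> r c"
    using weight_nonneg[OF weight] r(1) c(1) by (intro topspace_Pa_topology) auto
  have "openin (Pa_topology \<omega> r c) (Pa \<omega> r c - J)"
    using J top unfolding closed_submodule_def closedin_def by auto
  then obtain V where V: "Pa_nhd0 \<omega> r c V" "\<And>v. v \<in> V \<Longrightarrow> (\<lambda>z. \<psi> z + v z) \<in> Pa \<omega> r c - J"
    using \<psi> unfolding openin_Pa_topology by blast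
  have Vconv: "(\<lambda>z. \<alpha> * f z + \<beta> * g z) \<in> V" if "f \<in> V" "g \<in> V" "norm \<alpha> + norm \<beta> \<le> 1" for f g \<alpha> \<beta>
    using V(1) that unfolding Pa_nhd0_def by blast
  have Vball: "\<exists>e>0. \<forall>f\<in>Pk \<omega> r c k. Pk_norm \<omega> r c k f < e \<longrightarrow> f \<in> V" for k
    using V(1) unfolding Pa_nhd0_def by blast
  \<comment> \<open>\<open>p\<close> is the gauge of \<open>V + J\<close>\<close>
  define T where "T f = {t::real. 0 < t \<and> (\<exists>v\<in>V. \<exists>j\<in>J. f = (\<lambda>z. of_real t * v z + j z))}" for f
  have TI: "t \<in> T f" if "0 < t" "v \<in> V" "j \<in> J" "f = (\<lambda>z. of_real t * v z + j z)" for t v j f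
    unfolding T_def by (rule CollectI, rule conjI[OF that(1)], rule bexI[of _ v], rule bexI[of _ j]) (use that in auto)
  define p where "p f = Inf (T f)" for f
  have zJ: "(\<lambda>z. 0) \<in> J" using J by (simp add: closed_submodule_def)
  have bdd: "bdd_below (T f)" for f by (rule bdd_belowI[of _ 0]) (auto simp: T_def)
  have ple: "p f \<le> t" if "t \<in> T f" for f t unfolding p_def using bdd that by (intro cInf_lower)
  have small: "\<exists>C>0. \<forall>f\<in>Pk \<omega> r c k. \<forall>t>C * Pk_norm \<omega> r c k f. t \<in> T f" for k
  proof -
    obtain e where e: "0 < e" "\<And>f. f \<in> Pk \<omega> r c k \<Longrightarrow> Pk_norm \<omega> r c k f < e \<Longrightarrow> f \<in> V" using Vball by blast
    have "t \<in> T f" if f: "f \<in> Pk \<omega> r c k" and t: "1 / e * Pk_norm \<omega> r c k f < t" for f t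
    proof -
      have "0 \<le> 1 / e * Pk_norm \<omega> r c k f" using e Pk_norm_nonneg[OF f] by simp
      then have t0: "0 < t" using t by simp
      have "Pk_norm \<omega> r c k (\<lambda>z. of_real (1 / t) * f z + 0 * f z) \<le> norm (of_real (1 / t) :: complex) * Pk_norm \<omega> r c k f + norm (0::complex) * Pk_norm \<omega> r c k f"
        by (rule Pk_lin(2)[OF f f])
      also have "\<dots> = Pk_norm \<omega> r c k f / t" using t0 by (simp add: norm_divide)
      also have "\<dots> < e" using t t0 e by (simp add: field_simps)
      finally have "(\<lambda>z. of_real (1 / t) * f z + 0 * f z) \<in> V" by (rule e(2)[OF Pk_lin(1)[OF f f]])
      moreover have "f = (\<lambda>z. of_real t * (of_real (1 / t) * f z + 0 * f z) + 0)" using t0 by (simp add: fun_eq_iff)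
      ultimately show ?thesis by (rule TI[OF t0 _ zJ])
    qed
    then show ?thesis using e(1) by (intro exI[of _ "1 / e"]) auto
  qed
  have pnorm: "\<exists>C\<ge>0. \<forall>f\<in>Pk \<omega> r c k. p f \<le> C * Pk_norm \<omega> r c k f" for k
  proof -
    obtain C where C: "0 < C" "\<And>f t. f \<in> Pk \<omega> r c k \<Longrightarrow> C * Pk_norm \<omega> r c k f < t \<Longrightarrow> t \<in> T f" using small by blast
    have "p f \<le> C * Pk_norm \<omega> r c k f" if "f \<in> Pk \<omega> r c k" for f
      by (rule dense_ge) (use ple C(2)[OF that] in blast)
    then show ?thesis using C(1) by (intro exI[of _ C]) auto
  qed
  have Tne: "T f \<noteq> {}" if f: "f \<in> Pa \<omega> r c" for f
  proof -
    obtain k where k: "f \<in> Pk \<omega> r c k" using f unfolding Pa_def by blast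
    obtain C where "\<And>t. C * Pk_norm \<omega> r c k f < t \<Longrightarrow> t \<in> T f" using small[of k] k by blast
    then have "C * Pk_norm \<omega> r c k f + 1 \<in> T f" by simp
    then show ?thesis by blast
  qed
  have pge: "b \<le> p f" if "f \<in> Pa \<omega> r c" "\<And>t. t \<in> T f \<Longrightarrow> b \<le> t" for b f
    unfolding p_def using Tne[OF that(1)] that(2) by (rule cInf_greatest)
  interpret complex_function_space "Pa \<omega> r c" by standard (rule Pa_lin)
  have Tscale: "norm \<alpha> * t \<in> T (\<lambda>z. \<alpha> * f z)" if t: "t \<in> T f" and \<alpha>: "\<alpha> \<noteq> 0" for \<alpha> t f
  proof -
    obtain v j where vj: "0 < t" "v \<in> V" "j \<in> J" "f = (\<lambda>z. of_real t * v z + j z)" using t unfolding T_def by blast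
    have 1: "(\<lambda>z. (\<alpha> / of_real (norm \<alpha>)) * v z + 0 * v z) \<in> V"
      using \<alpha> by (intro Vconv vj) (simp add: norm_divide)
    have 2: "(\<lambda>z. \<alpha> * j z + 0 * j z) \<in> J" by (rule closed_submodule_lin[OF J vj(3,3)])
    have 3: "(\<lambda>z. \<alpha> * f z) = (\<lambda>z. of_real (norm \<alpha> * t) * ((\<alpha> / of_real (norm \<alpha>)) * v z + 0 * v z) + (\<alpha> * j z + 0 * j z))"
      using \<alpha> by (simp add: vj(4) fun_eq_iff algebra_simps)
    show ?thesis by (rule TI[OF _ 1 2 3]) (use \<alpha> vj in simp)
  qed
  have pscale: "p (\<lambda>z. \<alpha> * f z) \<le> norm \<alpha> * p f" if f: "f \<in> Pa \<omega> r c" and \<alpha>: "\<alpha> \<noteq> 0" for \<alpha> f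
  proof -
    have "p (\<lambda>z. \<alpha> * f z) / norm \<alpha> \<le> p f"
      using ple[OF Tscale[OF _ \<alpha>]] \<alpha> by (intro pge[OF f]) (simp add: divide_le_eq mult.commute)
    then show ?thesis using \<alpha> by (simp add: divide_le_eq mult.commute)
  qed
  have psub: "sublinear p"
    unfolding sublinear_def
  proof (intro conjI ballI allI impI)
    fix f g assume f: "f \<in> Pa \<omega> r c" and g: "g \<in> Pa \<omega> r c"
    have "p (\<lambda>z. f z + g z) \<le> t + s" if t: "t \<in> T f" and s: "s \<in> T g" for t s
    proof (rule ple)
      obtain v j where vj: "0 < t" "v \<in> V" "j \<in> J" "f = (\<lambda>z. of_real t * v z + j z)" using t unfolding T_def by blast
      obtain u i where ui: "0 < s" "u \<in> V" "i \<in> J" "g = (\<lambda>z. of_real s * u z + i z)" using s unfolding T_def by blast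
      have ts: "0 < t + s" using vj ui by simp
      have 1: "(\<lambda>z. of_real (t / (t + s)) * v z + of_real (s / (t + s)) * u z) \<in> V"
      proof (rule Vconv[OF vj(2) ui(2)])
        have "norm (complex_of_real (t / (t + s))) + norm (complex_of_real (s / (t + s))) = (t + s) / (t + s)"
          unfolding norm_of_real add_divide_distrib using vj ui by simp
        then show "norm (complex_of_real (t / (t + s))) + norm (complex_of_real (s / (t + s))) \<le> 1" using ts by simp
      qed
      have 2: "(\<lambda>z. 1 * j z + 1 * i z) \<in> J" by (rule closed_submodule_lin[OF J vj(3) ui(3)])
      have 3: "(\<lambda>z. f z + g z) = (\<lambda>z. of_real (t + s) * (of_real (t / (t + s)) * v z + of_real (s / (t + s)) * u z) + (1 * j z + 1 * i z))"
      proof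
        fix z
        have "complex_of_real (t + s) * of_real (t / (t + s)) = of_real t" "complex_of_real (t + s) * of_real (s / (t + s)) = of_real s"
          unfolding of_real_mult[symmetric] using ts by simp_all
        then show "f z + g z = of_real (t + s) * (of_real (t / (t + s)) * v z + of_real (s / (t + s)) * u z) + (1 * j z + 1 * i z)"
          unfolding vj(4) ui(4) distrib_left[of "of_real (t + s)"] mult.assoc[symmetric] by simp
      qed
      show "t + s \<in> T (\<lambda>z. f z + g z)" by (rule TI[OF ts 1 2 3])
    qed
    then have "p (\<lambda>z. f z + g z) - t \<le> s" if "t \<in> T f" "s \<in> T g" for t s
      using that by (metis add.commute diff_le_eq)
    then have "p (\<lambda>z. f z + g z) - t \<le> p g" if "t \<in> T f" for t
      using that by (intro pge[OF g])
    then have "p (\<lambda>z. f z + g z) - p g \<le> p f" by (intro pge[OF f]) (simp add: algebra_simps)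
    then show "p (\<lambda>z. f z + g z) \<le> p f + p g" by simp
  next
    fix f and t :: real assume "f \<in> Pa \<omega> r c" "0 < t"
    then show "p (\<lambda>z. of_real t * f z) \<le> t * p f" using pscale[of f "of_real t"] by simp
  qed
  have "p (\<lambda>z. \<alpha> * f z) \<le> p f" if "f \<in> Pa \<omega> r c" "norm \<alpha> = 1" for f \<alpha>
    using pscale[OF that(1), of \<alpha>] that(2) by fastforce
  then obtain S where S: "\<And>f g \<alpha> \<beta>. f \<in> Pa \<omega> r c \<Longrightarrow> g \<in> Pa \<omega> r c \<Longrightarrow> S (\<lambda>z. \<alpha> * f z + \<beta> * g z) = \<alpha> * S f + \<beta> * S g"
    "\<And>f. f \<in> Pa \<omega> r c \<Longrightarrow> norm (S f) \<le> 2 * p f" "p \<psi> \<le> Re (S \<psi>)"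
    using Hahn_Banach_complex[OF psub \<psi>(1)] by blast
  have "1 \<le> p \<psi>"
  proof (rule pge[OF \<psi>(1)], rule ccontr)
    fix t assume t: "t \<in> T \<psi>" "\<not> 1 \<le> t"
    obtain v j where vj: "0 < t" "v \<in> V" "j \<in> J" "\<psi> = (\<lambda>z. of_real t * v z + j z)" using t(1) unfolding T_def by blast
    have "(\<lambda>z. (- of_real t) * v z + 0 * v z) \<in> V" using vj t(2) by (intro Vconv) auto
    then have "(\<lambda>z. \<psi> z + ((- of_real t) * v z + 0 * v z)) \<notin> J" using V(2) by blast
    moreover have "(\<lambda>z. \<psi> z + ((- of_real t) * v z + 0 * v z)) = j" by (simp add: vj(4))
    ultimately show False using vj(3) by simp
  qed
  then have "S \<psi> \<noteq> 0" using S(3) by auto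
  moreover have "S f = 0" if f: "f \<in> J" for f
  proof -
    have "p f \<le> 0"
    proof (rule dense_ge)
      fix t :: real assume t: "0 < t"
      obtain e where e: "0 < e" "\<And>f. f \<in> Pk \<omega> r c 0 \<Longrightarrow> Pk_norm \<omega> r c 0 f < e \<Longrightarrow> f \<in> V" using Vball by blast
      have "Pk_norm \<omega> r c 0 (\<lambda>z. 0) \<le> 0" by (rule Pk_norm_le) simp
      moreover have "(\<lambda>z. 0) \<in> Pk \<omega> r c 0" unfolding Pk_iff by (auto intro!: exI[of _ 0])
      ultimately have "(\<lambda>z. 0) \<in> V" using e by simp
      then have "t \<in> T f" by (rule TI[OF t _ f]) simp
      then show "p f \<le> t" by (rule ple)
    qed
    then show ?thesis using S(2)[of f] sub f by (metis (no_types, opaque_lifting) mult_nonneg_nonpos norm_le_zero_iff order_trans subsetD zero_le_numeral)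
  qed
  moreover have "\<exists>C\<ge>0. \<forall>f\<in>Pk \<omega> r c k. norm (S f) \<le> C * Pk_norm \<omega> r c k f" for k
  proof -
    obtain C where C: "0 \<le> C" "\<And>f. f \<in> Pk \<omega> r c k \<Longrightarrow> p f \<le> C * Pk_norm \<omega> r c k f" using pnorm by blast
    have "norm (S f) \<le> 2 * C * Pk_norm \<omega> r c k f" if f: "f \<in> Pk \<omega> r c k" for f
    proof -
      have "f \<in> Pa \<omega> r c" using f unfolding Pa_def by blast
      then show ?thesis using S(2)[of f] C(2)[OF f] by simp
    qed
    then show ?thesis using C(1) by (intro exI[of _ "2 * C"]) auto
  qed
  ultimately show ?thesis using that[of S] S(1) by blast
qed

end

section \<open>Difference quotients\<close>

lemma entire_mult_cancel:
  assumes F: "F holomorphic_on UNIV" and G: "G holomorphic_on UNIV" and H: "H holomorphic_on UNIV" "H \<noteq> (\<lambda>z. 0)"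
    and eq: "\<And>z. F z * H z = G z * H z"
  shows "F z = G z"
proof -
  obtain a where a: "H a \<noteq> 0" using H(2) by auto
  have "continuous_on UNIV H" using H(1) by (rule holomorphic_on_imp_continuous_on)
  then have "open {z. H z \<noteq> 0}" by (intro open_Collect_neq continuous_intros) auto
  then have lim: "a islimpt {z. H z \<noteq> 0}" by (intro interior_limit_point) (simp add: interior_open a)
  have "F z - G z = 0"
    by (rule analytic_continuation[OF holomorphic_on_diff[OF F G] open_UNIV connected_UNIV subset_UNIV UNIV_I lim _ UNIV_I])
       (use eq in auto)
  then show ?thesis by simp
qed

text \<open>The divided difference of \<open>f\<close> at \<open>l\<close>, as a function of the second argument; the value at \<open>l\<close> fills
  in the removable singularity.\<close>

definition diff_quot :: "complex \<Rightarrow> (complex \<Rightarrow> complex) \<Rightarrow> complex \<Rightarrow> complex" where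
  "diff_quot l f z = (if z = l then deriv f l else (f z - f l) / (z - l))"

lemma diff_quot_holomorphic: "f holomorphic_on UNIV \<Longrightarrow> diff_quot l f holomorphic_on UNIV"
  using pole_lemma_open[of f UNIV l] by (simp add: diff_quot_def[abs_def])

lemma diff_quot_mult: "diff_quot l f z * (z - l) = f z - f l"
  by (simp add: diff_quot_def)

lemma diff_quot_eqI:
  assumes f: "f holomorphic_on UNIV" and g: "g holomorphic_on UNIV" and "\<And>z. g z * (z - l) = f z - f l"
  shows "diff_quot l f = g"
proof
  fix z
  have "(\<lambda>z. z - l) \<noteq> (\<lambda>z. 0)" by (metis diff_0_right zero_neq_one diff_add_cancel add_diff_cancel_left')
  then show "diff_quot l f z = g z"
    by (rule entire_mult_cancel[where H = "\<lambda>z. z - l", OF diff_quot_holomorphic[OF f] g, rotated])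
       (auto intro!: holomorphic_intros simp: diff_quot_mult assms(3))
qed

lemma diff_quot_lin:
  assumes f: "f holomorphic_on UNIV" and g: "g holomorphic_on UNIV"
  shows "diff_quot l (\<lambda>z. \<alpha> * f z + \<beta> * g z) = (\<lambda>z. \<alpha> * diff_quot l f z + \<beta> * diff_quot l g z)"
proof (rule diff_quot_eqI)
  show "(\<alpha> * diff_quot l f z + \<beta> * diff_quot l g z) * (z - l) = (\<alpha> * f z + \<beta> * g z) - (\<alpha> * f l + \<beta> * g l)" for z
    unfolding distrib_right mult.assoc diff_quot_mult by (simp add: algebra_simps)
qed (intro holomorphic_intros diff_quot_holomorphic f g)+

lemma diff_quot_resolvent:
  assumes f: "f holomorphic_on UNIV"
  shows "diff_quot l f = (\<lambda>z. 1 * diff_quot \<mu> f z + (l - \<mu>) * diff_quot l (diff_quot \<mu> f) z)"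
proof (rule diff_quot_eqI[OF f])
  fix z
  have "(1 * diff_quot \<mu> f z + (l - \<mu>) * diff_quot l (diff_quot \<mu> f) z) * (z - l)
      = diff_quot \<mu> f z * (z - l) + (l - \<mu>) * (diff_quot l (diff_quot \<mu> f) z * (z - l))" by (simp add: algebra_simps)
  also have "\<dots> = diff_quot \<mu> f z * (z - \<mu>) - diff_quot \<mu> f l * (l - \<mu>)"
    unfolding diff_quot_mult[of l "diff_quot \<mu> f"] by (simp add: algebra_simps)
  finally show "(1 * diff_quot \<mu> f z + (l - \<mu>) * diff_quot l (diff_quot \<mu> f) z) * (z - l) = f z - f l"
    unfolding diff_quot_mult by simp
qed (intro holomorphic_intros diff_quot_holomorphic f)

lemma diff_quot_times_id:
  assumes f: "f holomorphic_on UNIV"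
  shows "diff_quot l (\<lambda>z. z * f z) = (\<lambda>z. 1 * f z + l * diff_quot l f z)"
proof (rule diff_quot_eqI)
  fix z
  have "(1 * f z + l * diff_quot l f z) * (z - l) = f z * (z - l) + l * (diff_quot l f z * (z - l))"
    by (simp add: algebra_simps)
  then show "(1 * f z + l * diff_quot l f z) * (z - l) = z * f z - l * f l"
    unfolding diff_quot_mult by (simp add: algebra_simps)
qed (intro holomorphic_intros diff_quot_holomorphic f)+

text \<open>Divisibility may be checked locally, with a fraction \<open>v / u\<close> that is regular at the given point.\<close>

lemma entire_quotientI:
  assumes F: "F holomorphic_on UNIV" and G: "G holomorphic_on UNIV" "G \<noteq> (\<lambda>z. 0)"
    and loc: "\<And>\<mu>. \<exists>u v. u holomorphic_on UNIV \<and> v holomorphic_on UNIV \<and> u \<mu> \<noteq> 0 \<and> (\<forall>z. F z * u z = v z * G z)"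
  obtains \<theta> where "\<theta> holomorphic_on UNIV" "\<And>z. F z = \<theta> z * G z"
proof -
  obtain u v where uv: "\<And>\<mu>. u \<mu> holomorphic_on UNIV" "\<And>\<mu>. v \<mu> holomorphic_on UNIV" "\<And>\<mu>. u \<mu> \<mu> \<noteq> 0"
    "\<And>\<mu> z. F z * u \<mu> z = v \<mu> z * G z"
    using loc by metis
  define \<theta> where "\<theta> z = v z z / u z z" for z
  have cross: "v \<mu> z * u \<nu> z = v \<nu> z * u \<mu> z" for \<mu> \<nu> z
  proof (rule entire_mult_cancel[where F = "\<lambda>z. v \<mu> z * u \<nu> z" and G = "\<lambda>z. v \<nu> z * u \<mu> z", OF _ _ G])
    fix z
    have "v \<mu> z * u \<nu> z * G z = (v \<mu> z * G z) * u \<nu> z" by simp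
    also have "\<dots> = (v \<nu> z * G z) * u \<mu> z" unfolding uv(4)[symmetric] by simp
    finally show "v \<mu> z * u \<nu> z * G z = v \<nu> z * u \<mu> z * G z" by simp
  qed (intro holomorphic_intros uv)+
  have eq: "\<theta> z = v \<mu> z / u \<mu> z" if "u \<mu> z \<noteq> 0" for \<mu> z
    using cross[of z z \<mu>] uv(3)[of z] that unfolding \<theta>_def by (simp add: field_simps)
  have "\<theta> field_differentiable at \<mu>" for \<mu>
  proof -
    define U where "U = {z. u \<mu> z \<noteq> 0}"
    have "continuous_on UNIV (u \<mu>)" using uv(1) by (rule holomorphic_on_imp_continuous_on)
    then have U: "open U" unfolding U_def by (intro open_Collect_neq continuous_intros) auto
    have "(\<lambda>z. v \<mu> z / u \<mu> z) holomorphic_on U"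
      unfolding U_def by (intro holomorphic_intros holomorphic_on_subset[OF uv(1)] holomorphic_on_subset[OF uv(2)]) auto
    then have "\<theta> holomorphic_on U" by (rule holomorphic_transform) (simp add: U_def eq)
    then show ?thesis using U uv(3) by (intro holomorphic_on_imp_differentiable_at) (auto simp: U_def)
  qed
  then have "\<theta> holomorphic_on UNIV" by (simp add: holomorphic_on_def field_differentiable_at_within)
  moreover have "F z = \<theta> z * G z" for z
    using uv(4)[of z z] uv(3)[of z] unfolding \<theta>_def by (simp add: field_simps)
  ultimately show ?thesis by (rule that)
qed

context weighted_space
begin

text \<open>Uniform in \<open>l\<close>: away from \<open>l\<close> the denominator is at least \<open>1\<close>, and near \<open>l\<close> the maximum principle
  on the unit disc about \<open>l\<close> applies.  The passage to a larger step absorbs the variation of the weight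
  over distances up to \<open>2\<close>.\<close>

lemma diff_quot_bound:
  assumes k: "k \<le> k'" "r k < r k'"
  shows "\<exists>A\<ge>0. \<forall>h\<in>Pk \<omega> r c k. \<forall>l. diff_quot l h \<in> Pk \<omega> r c k' \<and>
     Pk_norm \<omega> r c k' (diff_quot l h) \<le> A * (Pk_norm \<omega> r c k h + norm (h l))"
proof -
  \<comment> \<open>the constant in the almost subadditivity of \<open>\<omega>\<close> that turns \<open>r k\<close> into \<open>r k'\<close>\<close>
  define \<sigma> where "\<sigma> = r k' / r k"
  have \<sigma>: "1 < \<sigma>" "r k * \<sigma> = r k'" using k(2) r(2)[of k] by (auto simp: \<sigma>_def)
  have "\<forall>\<sigma>>1. \<exists>C>0. \<forall>x\<ge>0. \<forall>y\<ge>0. \<omega> (x + y) \<le> \<sigma> * (\<omega> x + \<omega> y) + C"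
    using weight by (simp add: admissible_weight_def)
  from this[rule_format, OF \<sigma>(1)]
  obtain C where C: "0 < C" "\<And>x y. 0 \<le> x \<Longrightarrow> 0 \<le> y \<Longrightarrow> \<omega> (x + y) \<le> \<sigma> * (\<omega> x + \<omega> y) + C"
    by blast
  define C0 where "C0 = r k' * \<omega> 2 + r k * C + 2 * c k"
  have C00: "0 \<le> C0" unfolding C0_def using r(2) c(2) C(1) weight_nonneg[OF weight, of 2]
    by (intro add_nonneg_nonneg mult_nonneg_nonneg) (auto intro: less_imp_le)
  have near: "wt k z' \<le> wt k' z + C0" if d: "dist z' z \<le> 2" for z z'
  proof -
    have n: "norm z' \<le> norm z + 2" using d norm_triangle_ineq2[of z' z] by (simp add: dist_norm)
    have "\<omega> (norm z') \<le> \<omega> (norm z + 2)" by (intro weight_mono[OF weight] n) simp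
    also have "\<dots> \<le> \<sigma> * (\<omega> (norm z) + \<omega> 2) + C" by (intro C) auto
    finally have "r k * \<omega> (norm z') \<le> r k * (\<sigma> * (\<omega> (norm z) + \<omega> 2) + C)"
      using r(2)[of k] by (intro mult_left_mono) auto
    also have "\<dots> = r k' * (\<omega> (norm z) + \<omega> 2) + r k * C" unfolding \<sigma>(2)[symmetric] by (simp add: algebra_simps)
    finally have 1: "r k * \<omega> (norm z') \<le> r k' * (\<omega> (norm z) + \<omega> 2) + r k * C" .
    have "\<bar>Im z'\<bar> \<le> \<bar>Im z\<bar> + 2" using d abs_Im_le_cmod[of "z' - z"] by (simp add: dist_norm)
    then have "c k * \<bar>Im z'\<bar> \<le> c k * (\<bar>Im z\<bar> + 2)" using c(2)[of k] by (intro mult_left_mono) auto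
    moreover have "c k * \<bar>Im z\<bar> \<le> c k' * \<bar>Im z\<bar>" using c(1) k by (intro mult_right_mono) (auto simp: incseq_def)
    ultimately show ?thesis using 1 by (simp add: C0_def algebra_simps)
  qed
  have main: "norm (diff_quot l h z) \<le> exp C0 * (Pk_norm \<omega> r c k h + norm (h l)) * exp (wt k' z)"
    if h: "h \<in> Pk \<omega> r c k" for h l z
  proof -
    define N where "N = Pk_norm \<omega> r c k h + norm (h l)"
    have N0: "0 \<le> N" using Pk_norm_nonneg[OF h] by (simp add: N_def)
    have hb: "norm (h z' - h l) \<le> exp C0 * N * exp (wt k' z)" if d: "dist z' z \<le> 2" for z'
    proof -
      have "norm (h z' - h l) \<le> norm (h z') + norm (h l)" by (rule norm_triangle_ineq4)
      also have "\<dots> \<le> Pk_norm \<omega> r c k h * exp (wt k' z + C0) + norm (h l) * exp (wt k' z + C0)"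
      proof (intro add_mono)
        have "Pk_norm \<omega> r c k h * exp (wt k z') \<le> Pk_norm \<omega> r c k h * exp (wt k' z + C0)"
          using near[OF d] by (intro mult_left_mono Pk_norm_nonneg h) simp
        then show "norm (h z') \<le> Pk_norm \<omega> r c k h * exp (wt k' z + C0)"
          using Pk_norm_bound[OF h, of z'] by linarith
        have "0 \<le> wt k' z + C0" using wt_nonneg[of k' z] C00 by linarith
        then have "norm (h l) * 1 \<le> norm (h l) * exp (wt k' z + C0)" by (intro mult_left_mono) auto
        then show "norm (h l) \<le> norm (h l) * exp (wt k' z + C0)" by simp
      qed
      also have "\<dots> = exp C0 * N * exp (wt k' z)" unfolding N_def exp_add[of "wt k' z"] by (simp add: algebra_simps)
      finally show ?thesis .
    qed
    have "norm (diff_quot l h z) \<le> exp C0 * N * exp (wt k' z)"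
    proof (cases "1 \<le> dist z l")
      case True
      then have "norm (diff_quot l h z) = norm (h z - h l) / dist z l"
        by (auto simp: diff_quot_def norm_divide dist_norm)
      also have "\<dots> \<le> norm (h z - h l) / 1" using True by (intro divide_left_mono) auto
      finally show ?thesis using hb[of z] by simp
    next
      case False
      have hol: "diff_quot l h holomorphic_on UNIV" by (intro diff_quot_holomorphic Pk_holomorphic[OF h])
      show ?thesis
      proof (rule maximum_modulus_frontier[where S = "cball l 1" and f = "diff_quot l h" and \<xi> = z])
        show "diff_quot l h holomorphic_on interior (cball l 1)" by (rule holomorphic_on_subset[OF hol]) auto
        show "continuous_on (closure (cball l 1)) (diff_quot l h)"
          by (rule continuous_on_subset[OF holomorphic_on_imp_continuous_on[OF hol]]) auto
        fix z' assume "z' \<in> frontier (cball l 1)"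
        then have d: "dist l z' = 1" by (simp add: frontier_cball)
        then have "norm (diff_quot l h z') = norm (h z' - h l)"
          by (auto simp: diff_quot_def norm_divide dist_norm norm_minus_commute)
        moreover have "dist z' z \<le> 2"
          using dist_triangle[of z' z l] d False by (simp add: dist_commute)
        ultimately show "norm (diff_quot l h z') \<le> exp C0 * N * exp (wt k' z)" using hb[of z'] by simp
      qed (use False in \<open>auto simp: dist_commute\<close>)
    qed
    then show ?thesis by (simp add: N_def)
  qed
  have "diff_quot l h \<in> Pk \<omega> r c k' \<and> Pk_norm \<omega> r c k' (diff_quot l h) \<le> exp C0 * (Pk_norm \<omega> r c k h + norm (h l))"
    if h: "h \<in> Pk \<omega> r c k" for h l
  proof
    show "diff_quot l h \<in> Pk \<omega> r c k'"
      unfolding Pk_iff using main[OF h] diff_quot_holomorphic[OF Pk_holomorphic[OF h]] by blast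
    show "Pk_norm \<omega> r c k' (diff_quot l h) \<le> exp C0 * (Pk_norm \<omega> r c k h + norm (h l))"
      by (rule Pk_norm_le) (rule main[OF h])
  qed
  then show ?thesis by (intro exI[of _ "exp C0"]) auto
qed

lemma diff_quot_Pa:
  assumes "f \<in> Pa \<omega> r c"
  shows "diff_quot l f \<in> Pa \<omega> r c"
proof -
  obtain k where k: "f \<in> Pk \<omega> r c k" using assms unfolding Pa_def by blast
  obtain k' where "k \<le> k'" "r k < r k'" by (rule larger_r)
  then show ?thesis using diff_quot_bound[of k k'] k unfolding Pa_def by blast
qed

end

section \<open>Functionals evaluated at divided differences\<close>

text \<open>A continuous linear functional on the inductive limit; continuity means boundedness on each
  step.\<close>

locale bounded_functional = weighted_space +
  fixes S :: "(complex \<Rightarrow> complex) \<Rightarrow> complex"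
  assumes S_lin: "\<And>f g \<alpha> \<beta>. f \<in> Pa \<omega> r c \<Longrightarrow> g \<in> Pa \<omega> r c \<Longrightarrow> S (\<lambda>z. \<alpha> * f z + \<beta> * g z) = \<alpha> * S f + \<beta> * S g"
    and S_cont: "\<And>k. \<exists>C\<ge>0. \<forall>f\<in>Pk \<omega> r c k. norm (S f) \<le> C * Pk_norm \<omega> r c k f"
begin

text \<open>An entire function of \<open>l\<close>, by the resolvent identity for divided differences.\<close>

definition S_quot :: "(complex \<Rightarrow> complex) \<Rightarrow> complex \<Rightarrow> complex" where
  "S_quot f l = S (diff_quot l f)"

lemma S_quot_bound:
  "\<exists>A\<ge>0. \<forall>h\<in>Pk \<omega> r c k. \<forall>l. norm (S_quot h l) \<le> A * (Pk_norm \<omega> r c k h + norm (h l))"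
proof -
  obtain k' where k': "k \<le> k'" "r k < r k'" by (rule larger_r)
  obtain A where A: "0 \<le> A" "\<And>h l. h \<in> Pk \<omega> r c k \<Longrightarrow> diff_quot l h \<in> Pk \<omega> r c k' \<and>
     Pk_norm \<omega> r c k' (diff_quot l h) \<le> A * (Pk_norm \<omega> r c k h + norm (h l))"
    using diff_quot_bound[OF k'] by blast
  obtain C where C: "0 \<le> C" "\<And>f. f \<in> Pk \<omega> r c k' \<Longrightarrow> norm (S f) \<le> C * Pk_norm \<omega> r c k' f"
    using S_cont[of k'] by blast
  have "norm (S_quot h l) \<le> (C * A) * (Pk_norm \<omega> r c k h + norm (h l))" if h: "h \<in> Pk \<omega> r c k" for h l
  proof -
    have "norm (S_quot h l) \<le> C * Pk_norm \<omega> r c k' (diff_quot l h)"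
      unfolding S_quot_def using A(2)[OF h] by (intro C) blast
    also have "\<dots> \<le> C * (A * (Pk_norm \<omega> r c k h + norm (h l)))" using A(2)[OF h] C(1) by (intro mult_left_mono) auto
    finally show ?thesis by (simp add: mult.assoc)
  qed
  then show ?thesis using A C by (intro exI[of _ "C * A"]) auto
qed

lemma S_quot_resolvent:
  assumes f: "f \<in> Pa \<omega> r c"
  shows "S_quot f l = S_quot f \<mu> + (l - \<mu>) * S_quot (diff_quot \<mu> f) l"
  unfolding S_quot_def diff_quot_resolvent[OF Pa_holomorphic[OF f], of l \<mu>]
  by (subst S_lin) (auto intro: diff_quot_Pa f)

lemma S_quot_isCont:
  assumes f: "f \<in> Pa \<omega> r c"
  shows "isCont (S_quot f) \<mu>"
proof -
  define g where "g = diff_quot \<mu> f"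
  have g: "g \<in> Pa \<omega> r c" unfolding g_def by (rule diff_quot_Pa[OF f])
  obtain k where k: "g \<in> Pk \<omega> r c k" using g unfolding Pa_def by blast
  obtain A where A: "0 \<le> A" "\<And>l. norm (S_quot g l) \<le> A * (Pk_norm \<omega> r c k g + norm (g l))"
    using S_quot_bound[of k] k by blast
  have "isCont g \<mu>"
    using holomorphic_on_imp_continuous_on[OF Pa_holomorphic[OF g]] by (simp add: continuous_on_eq_continuous_at)
  then have "((\<lambda>l. norm (l - \<mu>) * (A * (Pk_norm \<omega> r c k g + norm (g l)))) \<longlongrightarrow> norm (\<mu> - \<mu>) * (A * (Pk_norm \<omega> r c k g + norm (g \<mu>)))) (at \<mu>)"
    by (intro tendsto_intros) (simp add: isCont_def)
  then have lim: "((\<lambda>l. norm (l - \<mu>) * (A * (Pk_norm \<omega> r c k g + norm (g l)))) \<longlongrightarrow> 0) (at \<mu>)" by simp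
  have "\<forall>\<^sub>F l in at \<mu>. norm ((l - \<mu>) * S_quot g l) \<le> norm (l - \<mu>) * (A * (Pk_norm \<omega> r c k g + norm (g l)))"
    unfolding norm_mult by (intro always_eventually allI mult_left_mono A(2)) simp
  from Lim_null_comparison[OF this lim]
  have "((\<lambda>l. (l - \<mu>) * S_quot g l) \<longlongrightarrow> 0) (at \<mu>)" .
  then have "((\<lambda>l. S_quot f \<mu> + (l - \<mu>) * S_quot g l) \<longlongrightarrow> S_quot f \<mu> + 0) (at \<mu>)" by (intro tendsto_intros)
  moreover have "S_quot f = (\<lambda>l. S_quot f \<mu> + (l - \<mu>) * S_quot g l)"
    unfolding g_def by (rule ext) (rule S_quot_resolvent[OF f])
  ultimately show ?thesis unfolding isCont_def by (metis add.right_neutral)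
qed

lemma S_quot_holomorphic:
  assumes f: "f \<in> Pa \<omega> r c"
  shows "S_quot f holomorphic_on UNIV"
proof -
  have "DERIV (S_quot f) \<mu> :> S_quot (diff_quot \<mu> f) \<mu>" for \<mu>
    unfolding CARAT_DERIV
  proof (intro exI[of _ "S_quot (diff_quot \<mu> f)"] conjI allI)
    show "S_quot f z - S_quot f \<mu> = S_quot (diff_quot \<mu> f) z * (z - \<mu>)" for z
      unfolding S_quot_resolvent[OF f, of z \<mu>] by simp
  qed (auto intro: S_quot_isCont diff_quot_Pa f)
  then show ?thesis unfolding holomorphic_on_def field_differentiable_def
    using has_field_derivative_at_within by blast
qed

text \<open>\<open>\<Phi> f \<psi> l\<close> is the value of \<open>S\<close> at the function \<open>(f l * \<psi> z - \<psi> l * f z) / (z - l)\<close> of \<open>z\<close>.\<close>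

definition \<Phi> :: "(complex \<Rightarrow> complex) \<Rightarrow> (complex \<Rightarrow> complex) \<Rightarrow> complex \<Rightarrow> complex" where
  "\<Phi> f \<psi> l = f l * S_quot \<psi> l - \<psi> l * S_quot f l"

lemma \<Phi>_holomorphic:
  assumes "f \<in> Pa \<omega> r c" "\<psi> \<in> Pa \<omega> r c"
  shows "\<Phi> f \<psi> holomorphic_on UNIV"
  unfolding \<Phi>_def by (intro holomorphic_intros S_quot_holomorphic Pa_holomorphic assms)

lemma \<Phi>_eq:
  assumes f: "f \<in> Pa \<omega> r c" and \<psi>: "\<psi> \<in> Pa \<omega> r c"
  shows "\<Phi> f \<psi> l = S_quot (\<lambda>z. f l * \<psi> z + (- \<psi> l) * f z) l"
  unfolding S_quot_def diff_quot_lin[OF Pa_holomorphic[OF \<psi>] Pa_holomorphic[OF f]]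
  by (subst S_lin) (auto intro: diff_quot_Pa f \<psi> simp: \<Phi>_def S_quot_def)

text \<open>The numerator vanishes at \<open>l\<close>, so there is no term with the product \<open>f l * \<psi> l\<close>.  Therefore \<open>\<Phi>\<close>
  does not leave the step containing \<open>f\<close> and \<open>\<psi>\<close>.\<close>

lemma \<Phi>_bound:
  "\<exists>A\<ge>0. \<forall>f\<in>Pk \<omega> r c k. \<forall>\<psi>\<in>Pk \<omega> r c k. \<forall>l. norm (\<Phi> f \<psi> l) \<le>
     A * (norm (f l) * Pk_norm \<omega> r c k \<psi> + norm (\<psi> l) * Pk_norm \<omega> r c k f)"
proof -
  obtain A where A: "0 \<le> A" "\<And>h l. h \<in> Pk \<omega> r c k \<Longrightarrow> norm (S_quot h l) \<le> A * (Pk_norm \<omega> r c k h + norm (h l))"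
    using S_quot_bound[of k] by blast
  have "norm (\<Phi> f \<psi> l) \<le> A * (norm (f l) * Pk_norm \<omega> r c k \<psi> + norm (\<psi> l) * Pk_norm \<omega> r c k f)"
    if f: "f \<in> Pk \<omega> r c k" and \<psi>: "\<psi> \<in> Pk \<omega> r c k" for f \<psi> l
  proof -
    let ?h = "\<lambda>z. f l * \<psi> z + (- \<psi> l) * f z"
    have Pa: "f \<in> Pa \<omega> r c" "\<psi> \<in> Pa \<omega> r c" using f \<psi> unfolding Pa_def by blast+
    have "norm (S_quot ?h l) \<le> A * (Pk_norm \<omega> r c k ?h + norm (?h l))" by (intro A Pk_lin f \<psi>)
    also have "\<dots> = A * Pk_norm \<omega> r c k ?h" by simp
    also have "\<dots> \<le> A * (norm (f l) * Pk_norm \<omega> r c k \<psi> + norm (- \<psi> l) * Pk_norm \<omega> r c k f)"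
      by (intro mult_left_mono A Pk_lin(2) f \<psi>)
    finally show ?thesis unfolding \<Phi>_eq[OF Pa] by simp
  qed
  then show ?thesis using A(1) by blast
qed

lemma \<Phi>_Pk:
  "\<exists>A\<ge>0. \<forall>f\<in>Pk \<omega> r c k. \<forall>\<psi>\<in>Pk \<omega> r c k. \<Phi> f \<psi> \<in> Pk \<omega> r c k \<and>
     Pk_norm \<omega> r c k (\<Phi> f \<psi>) \<le> A * Pk_norm \<omega> r c k \<psi> * Pk_norm \<omega> r c k f"
proof -
  obtain A where A: "0 \<le> A" "\<And>f \<psi> l. f \<in> Pk \<omega> r c k \<Longrightarrow> \<psi> \<in> Pk \<omega> r c k \<Longrightarrow> norm (\<Phi> f \<psi> l) \<le>
     A * (norm (f l) * Pk_norm \<omega> r c k \<psi> + norm (\<psi> l) * Pk_norm \<omega> r c k f)"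
    using \<Phi>_bound[of k] by blast
  have "\<Phi> f \<psi> \<in> Pk \<omega> r c k \<and> Pk_norm \<omega> r c k (\<Phi> f \<psi>) \<le> (2 * A) * Pk_norm \<omega> r c k \<psi> * Pk_norm \<omega> r c k f"
    if f: "f \<in> Pk \<omega> r c k" and \<psi>: "\<psi> \<in> Pk \<omega> r c k" for f \<psi>
  proof -
    have b: "norm (\<Phi> f \<psi> l) \<le> (2 * A) * Pk_norm \<omega> r c k \<psi> * Pk_norm \<omega> r c k f * exp (wt k l)" for l
    proof -
      have "norm (\<Phi> f \<psi> l) \<le> A * (norm (f l) * Pk_norm \<omega> r c k \<psi> + norm (\<psi> l) * Pk_norm \<omega> r c k f)"
        by (rule A(2)[OF f \<psi>])
      also have "\<dots> \<le> A * ((Pk_norm \<omega> r c k f * exp (wt k l)) * Pk_norm \<omega> r c k \<psi> + (Pk_norm \<omega> r c k \<psi> * exp (wt k l)) * Pk_norm \<omega> r c k f)"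
        by (intro mult_left_mono add_mono mult_right_mono Pk_norm_bound Pk_norm_nonneg f \<psi> A(1))
      finally show ?thesis by (simp add: algebra_simps)
    qed
    moreover have "\<Phi> f \<psi> holomorphic_on UNIV"
      using f \<psi> unfolding Pa_def by (intro \<Phi>_holomorphic) (auto simp: Pa_def)
    ultimately show ?thesis unfolding Pk_iff using Pk_norm_le[OF b] by blast
  qed
  then show ?thesis using A(1) by (intro exI[of _ "2 * A"]) auto
qed

lemma S_zero: "S (\<lambda>z. 0) = 0"
proof -
  have z: "(\<lambda>z. 0) \<in> Pa \<omega> r c" unfolding Pa_def Pk_iff by (auto simp: Pk_iff intro!: exI[of _ 0])
  show ?thesis using S_lin[OF z z, of 0 0] by simp
qed

lemma S_quot_times_id:
  assumes f: "f \<in> Pa \<omega> r c"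
  shows "S_quot (\<lambda>z. z * f z) l = S f + l * S_quot f l"
  unfolding S_quot_def diff_quot_times_id[OF Pa_holomorphic[OF f]]
  by (subst S_lin) (auto intro: diff_quot_Pa f)

lemma \<Phi>_times_id:
  assumes "\<psi> \<in> Pa \<omega> r c"
  shows "\<Phi> f (\<lambda>z. z * \<psi> z) l = l * \<Phi> f \<psi> l + S \<psi> * f l"
  unfolding \<Phi>_def S_quot_times_id[OF assms] by (simp add: algebra_simps)

end

section \<open>Stable submodules\<close>

lemma divisible_by_power:
  assumes \<psi>: "\<psi> holomorphic_on UNIV" and van: "\<And>j. j < n \<Longrightarrow> (deriv ^^ j) \<psi> \<mu> = 0"
  shows "\<exists>\<tau>. \<tau> holomorphic_on UNIV \<and> (\<forall>z. \<psi> z = (z - \<mu>) ^ n * \<tau> z)"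
proof (cases "\<psi> = (\<lambda>z. 0)")
  case True
  then show ?thesis by (intro exI[of _ "\<lambda>z. 0"]) auto
next
  case False
  have "n \<le> nat (zorder \<psi> \<mu>)" using zorder_ge_iff[OF \<psi> False] van by blast
  then obtain m where m: "nat (zorder \<psi> \<mu>) = n + m" using le_Suc_ex by blast
  have "\<exists>w\<in>UNIV. \<psi> w \<noteq> 0" using False by auto
  then obtain h where "h holomorphic_on UNIV" "\<And>w. w \<in> UNIV \<Longrightarrow> \<psi> w = (w - \<mu>) ^ nat (zorder \<psi> \<mu>) * h w"
    using factor_out_zero[OF \<psi> open_UNIV connected_UNIV UNIV_I] by blast
  then show ?thesis unfolding m
    by (intro exI[of _ "\<lambda>z. (z - \<mu>) ^ m * h z"]) (auto intro!: holomorphic_intros simp: power_add mult.assoc)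
qed

lemma minimal_type_power:
  assumes "minimal_type \<theta>"
  shows "minimal_type (\<lambda>z. \<theta> z ^ n)"
proof (cases "n = 0")
  case True
  then show ?thesis unfolding minimal_type_def
    by (auto intro!: holomorphic_intros exI[of _ 1])
next
  case False
  have "\<exists>C. \<forall>z. norm (\<theta> z ^ n) \<le> C * exp (e * norm z)" if e: "0 < e" for e
  proof -
    have "0 < e / n" using e False by simp
    then obtain C where C: "\<And>z. norm (\<theta> z) \<le> C * exp (e / n * norm z)" using assms unfolding minimal_type_def by blast
    have "norm (\<theta> z ^ n) \<le> C ^ n * exp (e * norm z)" for z
    proof -
      have "norm (\<theta> z ^ n) \<le> (C * exp (e / n * norm z)) ^ n" unfolding norm_power by (intro power_mono C) simp
      also have "\<dots> = C ^ n * exp (e * norm z)" using False by (simp add: power_mult_distrib exp_of_nat_mult[symmetric])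
      finally show ?thesis .
    qed
    then show ?thesis by blast
  qed
  then show ?thesis using assms unfolding minimal_type_def by (auto intro!: holomorphic_intros)
qed

text \<open>A functional vanishing on a stable submodule \<open>J\<close>.\<close>

locale annihilated_stable_submodule = bounded_functional +
  fixes J :: "(complex \<Rightarrow> complex) set"
  assumes J: "closed_submodule \<omega> r c J" and J_nonzero: "J \<noteq> {\<lambda>z. 0}"
    and stable: "stable_submodule J" and S_J: "\<And>f. f \<in> J \<Longrightarrow> S f = 0"
begin

lemma J_Pa: "f \<in> J \<Longrightarrow> f \<in> Pa \<omega> r c"
  using closed_submodule_subset_Pa[OF J] by blast

text \<open>If \<open>f l\<close> or \<open>g l\<close> is nonzero, then \<open>J\<close> has no zero at \<open>l\<close>, and stability at \<open>l\<close> puts the divided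
  difference into \<open>J\<close>.\<close>

lemma \<Phi>_eq_0:
  assumes f: "f \<in> J" and g: "g \<in> J"
  shows "\<Phi> f g l = 0"
proof (cases "f l = 0 \<and> g l = 0")
  case True
  then show ?thesis by (simp add: \<Phi>_def)
next
  case False
  define h where "h = (\<lambda>z. f l * g z + (- g l) * f z)"
  have hJ: "h \<in> J" unfolding h_def by (rule closed_submodule_lin[OF J g f])
  have hl: "h l = 0" by (simp add: h_def)
  have hh: "h holomorphic_on UNIV" by (rule Pa_holomorphic[OF J_Pa[OF hJ]])
  have eq: "\<Phi> f g l = S (diff_quot l h)"
    unfolding \<Phi>_eq[OF J_Pa[OF f] J_Pa[OF g]] S_quot_def h_def ..
  show ?thesis
  proof (cases "h = (\<lambda>z. 0)")
    case True
    have "diff_quot l (\<lambda>z. 0) = (\<lambda>z. 0)" by (simp add: diff_quot_def fun_eq_iff)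
    then show ?thesis using eq True S_zero by simp
  next
    case hnz: False
    have nv: "zero_mult J l = 0" if e: "e \<in> J" "e l \<noteq> 0" for e
    proof -
      have enz: "e \<noteq> (\<lambda>z. 0)" using e(2) by auto
      have "\<not> 1 \<le> nat (zorder e l)"
        unfolding zorder_ge_iff[OF Pa_holomorphic[OF J_Pa[OF e(1)]] enz] using e(2) by auto
      then show ?thesis using zero_mult_le_zorder[OF e(1) enz, of l] by linarith
    qed
    have n0: "zero_mult J l = 0" using False nv f g by blast
    have "1 \<le> nat (zorder h l)" unfolding zorder_ge_iff[OF hh hnz] using hl by simp
    then have "zorder h l > int (zero_mult J l)" using n0 by linarith
    then have "divide_root l h \<in> J"
      using stable hJ hnz unfolding stable_submodule_def stable_at_def by blast
    moreover have "divide_root l h = diff_quot l h"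
      using hl by (simp add: divide_root_def diff_quot_def fun_eq_iff)
    ultimately show ?thesis unfolding eq using S_J by simp
  qed
qed

lemma \<Phi>_cross:
  assumes f: "f \<in> J" and g: "g \<in> J"
  shows "\<Phi> f \<psi> l * g l = \<Phi> g \<psi> l * f l"
proof -
  have "\<Phi> f \<psi> l * g l - \<Phi> g \<psi> l * f l = \<psi> l * \<Phi> f g l"
    unfolding \<Phi>_def by (simp add: algebra_simps)
  then show ?thesis using \<Phi>_eq_0[OF f g] by simp
qed

lemma exists_minimal_order:
  "\<exists>f\<in>J. f \<noteq> (\<lambda>z. 0) \<and> nat (zorder f \<mu>) = zero_mult J \<mu>"
proof -
  have "(\<lambda>\<phi>. nat (zorder \<phi> \<mu>)) ` (J - {\<lambda>z. 0}) \<noteq> {}" using closed_submodule_nonzero[OF J J_nonzero] by blast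
  then have "zero_mult J \<mu> \<in> (\<lambda>\<phi>. nat (zorder \<phi> \<mu>)) ` (J - {\<lambda>z. 0})"
    unfolding zero_mult_def by (rule Inf_nat_def1)
  then show ?thesis by force
qed

text \<open>The quotient of \<open>\<Phi> f \<psi>\<close> by \<open>f\<close> is the same for all nonzero \<open>f \<in> J\<close>.  It is entire, since at a
  given point one may choose \<open>f\<close> with a zero of minimal order, and \<open>\<Phi> f \<psi>\<close> vanishes to that order.\<close>

lemma exists_quotient:
  assumes \<psi>: "\<psi> \<in> Pa \<omega> r c" and van: "\<And>\<mu> j. j < zero_mult J \<mu> \<Longrightarrow> (deriv ^^ j) \<psi> \<mu> = 0"
  obtains \<theta> where "\<theta> holomorphic_on UNIV" "\<And>f z. f \<in> J \<Longrightarrow> \<Phi> f \<psi> z = \<theta> z * f z"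
proof -
  obtain \<phi> where \<phi>: "\<phi> \<in> J" "\<phi> \<noteq> (\<lambda>z. 0)" using closed_submodule_nonzero[OF J J_nonzero] by blast
  have h\<phi>: "\<phi> holomorphic_on UNIV" by (rule Pa_holomorphic[OF J_Pa[OF \<phi>(1)]])
  have h\<Phi>: "\<Phi> f \<psi> holomorphic_on UNIV" if "f \<in> J" for f by (rule \<Phi>_holomorphic[OF J_Pa[OF that] \<psi>])
  have loc: "\<exists>u v. u holomorphic_on UNIV \<and> v holomorphic_on UNIV \<and> u \<mu> \<noteq> 0 \<and> (\<forall>z. \<Phi> \<phi> \<psi> z * u z = v z * \<phi> z)" for \<mu>
  proof -
    obtain f where f: "f \<in> J" "f \<noteq> (\<lambda>z. 0)" "nat (zorder f \<mu>) = zero_mult J \<mu>" using exists_minimal_order by blast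
    define n where "n = zero_mult J \<mu>"
    have "\<exists>w\<in>UNIV. f w \<noteq> 0" using f(2) by auto
    then obtain u where u: "u holomorphic_on UNIV" "u \<mu> \<noteq> 0" "\<And>w. f w = (w - \<mu>) ^ n * u w"
      using factor_out_zero[OF Pa_holomorphic[OF J_Pa[OF f(1)]] open_UNIV connected_UNIV UNIV_I] f(3)
      unfolding n_def by (metis UNIV_I)
    obtain \<tau> where \<tau>: "\<tau> holomorphic_on UNIV" "\<And>z. \<psi> z = (z - \<mu>) ^ n * \<tau> z"
      using divisible_by_power[OF Pa_holomorphic[OF \<psi>], of n \<mu>] van unfolding n_def by blast
    define v where "v z = u z * S_quot \<psi> z - \<tau> z * S_quot f z" for z
    have hv: "v holomorphic_on UNIV"
      unfolding v_def by (intro holomorphic_intros u \<tau> S_quot_holomorphic \<psi> J_Pa f)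
    have \<Phi>f: "\<Phi> f \<psi> z = (z - \<mu>) ^ n * v z" for z
      unfolding \<Phi>_def v_def u(3) \<tau>(2) by (simp add: algebra_simps)
    have nz: "(\<lambda>z. (z - \<mu>) ^ n) \<noteq> (\<lambda>z. 0)"
    proof
      assume "(\<lambda>z. (z - \<mu>) ^ n) = (\<lambda>z. 0)"
      then have "((\<mu> + 1) - \<mu>) ^ n = 0" by meson
      then show False by simp
    qed
    have "\<Phi> \<phi> \<psi> z * u z = v z * \<phi> z" for z
    proof (rule entire_mult_cancel[where F = "\<lambda>z. \<Phi> \<phi> \<psi> z * u z" and G = "\<lambda>z. v z * \<phi> z", OF _ _ _ nz])
      fix z
      have "\<Phi> \<phi> \<psi> z * u z * (z - \<mu>) ^ n = \<Phi> \<phi> \<psi> z * f z" unfolding u(3) by simp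
      also have "\<dots> = \<Phi> f \<psi> z * \<phi> z" by (rule \<Phi>_cross[OF \<phi>(1) f(1)])
      also have "\<dots> = v z * \<phi> z * (z - \<mu>) ^ n" unfolding \<Phi>f by simp
      finally show "\<Phi> \<phi> \<psi> z * u z * (z - \<mu>) ^ n = v z * \<phi> z * (z - \<mu>) ^ n" .
    qed (intro holomorphic_intros h\<Phi> \<phi> u hv h\<phi>)+
    then show ?thesis using u hv by blast
  qed
  obtain \<theta> where \<theta>: "\<theta> holomorphic_on UNIV" "\<And>z. \<Phi> \<phi> \<psi> z = \<theta> z * \<phi> z"
    using entire_quotientI[OF h\<Phi>[OF \<phi>(1)] h\<phi> \<phi>(2) loc] by blast
  have "\<Phi> f \<psi> z = \<theta> z * f z" if f: "f \<in> J" for f z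
  proof (rule entire_mult_cancel[where F = "\<Phi> f \<psi>" and G = "\<lambda>z. \<theta> z * f z", OF h\<Phi>[OF f] _ h\<phi> \<phi>(2)])
    show "(\<lambda>z. \<theta> z * f z) holomorphic_on UNIV"
      by (intro holomorphic_intros \<theta> Pa_holomorphic[OF J_Pa[OF f]])
    show "\<Phi> f \<psi> z * \<phi> z = \<theta> z * f z * \<phi> z" for z
      using \<Phi>_cross[OF f \<phi>(1), of \<psi> z] \<theta>(2)[of z] by simp
  qed
  then show ?thesis using that \<theta>(1) by blast
qed

text \<open>The indicator of \<open>\<Phi> f \<psi> = \<theta> * f\<close> is at most the maximum of those of \<open>f\<close> and \<open>\<psi>\<close>, and there are
  \<open>f \<in> J\<close> whose indicator is, up to \<open>e\<close>, not smaller than that of \<open>\<psi>\<close>.\<close>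

lemma quotient_is_minimal_type:
  assumes \<psi>: "\<psi> \<in> zeros_indicator_module (zero_mult J) (ind_lower J) (ind_upper J)"
    and \<theta>: "\<theta> holomorphic_on UNIV" "\<And>f z. f \<in> J \<Longrightarrow> \<Phi> f \<psi> z = \<theta> z * f z"
  shows "minimal_type \<theta>"
proof -
  have \<psi>Pa: "\<psi> \<in> Pa \<omega> r c" and lo: "indicator_fun \<psi> (- pi / 2) \<le> - ind_lower J" and up: "indicator_fun \<psi> (pi / 2) \<le> ind_upper J"
    using \<psi> by (auto simp: zeros_indicator_module_def)
  obtain \<phi> where \<phi>: "\<phi> \<in> J" "\<phi> \<noteq> (\<lambda>z. 0)" using closed_submodule_nonzero[OF J J_nonzero] by blast
  have eq: "(\<lambda>z. \<theta> z * f z) = \<Phi> f \<psi>" if "f \<in> J" for f using \<theta>(2)[OF that] by auto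
  have \<Phi>Pa: "\<Phi> f \<psi> \<in> Pa \<omega> r c" if f: "f \<in> J" for f
  proof -
    obtain k where "f \<in> Pk \<omega> r c k" "\<psi> \<in> Pk \<omega> r c k" using Pa_common[OF J_Pa[OF f] \<psi>Pa] by blast
    then show ?thesis using \<Phi>_Pk[of k] unfolding Pa_def by blast
  qed
  have ind: "indicator_fun (\<lambda>z. \<theta> z * f z) t \<le> indicator_fun f t + ereal e"
    if f: "f \<in> J" and le: "indicator_fun \<psi> t \<le> indicator_fun f t + ereal e" and e: "0 < e" for f t e
    unfolding eq[OF f]
  proof (rule indicator_le_max[OF _ _ le])
    have "indicator_fun f t + 0 \<le> indicator_fun f t + ereal e" using e by (intro add_left_mono) simp
    then show "indicator_fun f t \<le> indicator_fun f t + ereal e" by simp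
    fix d :: real assume d: "0 < d"
    obtain k where k: "f \<in> Pk \<omega> r c k" "\<psi> \<in> Pk \<omega> r c k" using Pa_common[OF J_Pa[OF f] \<psi>Pa] by blast
    obtain A where A: "0 \<le> A" "\<And>l. norm (\<Phi> f \<psi> l) \<le> A * (norm (f l) * Pk_norm \<omega> r c k \<psi> + norm (\<psi> l) * Pk_norm \<omega> r c k f)"
      using \<Phi>_bound[of k] k by blast
    define B where "B = max (Pk_norm \<omega> r c k \<psi>) (Pk_norm \<omega> r c k f)"
    have B0: "0 \<le> B" using Pk_norm_nonneg[OF k(1)] by (simp add: B_def)
    have "norm (\<Phi> f \<psi> z) \<le> (A * B) * exp (d * norm z) * (norm (f z) + norm (\<psi> z))" for z
    proof -
      have "norm (\<Phi> f \<psi> z) \<le> A * (norm (f z) * B + norm (\<psi> z) * B)"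
        by (rule order_trans[OF A(2)]) (intro mult_left_mono add_mono A(1), auto simp: B_def)
      also have "\<dots> = (A * B) * 1 * (norm (f z) + norm (\<psi> z))" by (simp add: algebra_simps)
      also have "\<dots> \<le> (A * B) * exp (d * norm z) * (norm (f z) + norm (\<psi> z))"
        using A(1) B0 d by (intro mult_right_mono mult_left_mono) auto
      finally show ?thesis .
    qed
    then show "\<exists>C. \<forall>z. norm (\<Phi> f \<psi> z) \<le> C * exp (d * norm z) * (norm (f z) + norm (\<psi> z))" by blast
  qed
  show ?thesis
  proof (rule quotient_minimal_type[OF weight \<theta>(1), of J])
    show "Cartwright_bounded \<omega> f \<and> Cartwright_bounded \<omega> (\<lambda>z. \<theta> z * f z)" if "f \<in> J" for f
      unfolding eq[OF that] using that by (intro conjI Pa_Cartwright J_Pa \<Phi>Pa)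
    fix e :: real assume e: "0 < e"
    show "\<exists>f\<in>J. f \<noteq> (\<lambda>z. 0) \<and> indicator_fun (\<lambda>z. \<theta> z * f z) (pi / 2) \<le> indicator_fun f (pi / 2) + ereal e"
    proof (cases "\<psi> = (\<lambda>z. 0)")
      case True
      then show ?thesis using \<phi> ind[OF \<phi>(1) _ e] indicator_fun_zero by blast
    next
      case False
      obtain d where d: "indicator_fun \<psi> (pi / 2) = ereal d"
        using indicator_upper_finite[OF weight Pa_Cartwright[OF \<psi>Pa] False] by blast
      have "ereal (d - e) < ind_upper J" using up e unfolding d by (intro less_le_trans[OF _ up[unfolded d]]) simp
      then obtain f where f: "f \<in> J" "f \<noteq> (\<lambda>z. 0)" "ereal (d - e) < indicator_fun f (pi / 2)"
        unfolding ind_upper_def less_SUP_iff by blast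
      have "ereal (d - e) + ereal e \<le> indicator_fun f (pi / 2) + ereal e" using f(3) by (intro add_right_mono) simp
      then have "indicator_fun \<psi> (pi / 2) \<le> indicator_fun f (pi / 2) + ereal e" by (simp add: d)
      then show ?thesis using f ind[OF f(1) _ e] by blast
    qed
    show "\<exists>f\<in>J. f \<noteq> (\<lambda>z. 0) \<and> indicator_fun (\<lambda>z. \<theta> z * f z) (- pi / 2) \<le> indicator_fun f (- pi / 2) + ereal e"
    proof (cases "\<psi> = (\<lambda>z. 0)")
      case True
      then show ?thesis using \<phi> ind[OF \<phi>(1) _ e] indicator_fun_zero by blast
    next
      case False
      have "(\<lambda>z. \<psi> (- z)) \<noteq> (\<lambda>z. 0)"
      proof
        assume "(\<lambda>z. \<psi> (- z)) = (\<lambda>z. 0)"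
        then have "\<psi> (- (- z)) = 0" for z by meson
        then show False using False by auto
      qed
      then obtain d where d: "indicator_fun \<psi> (- pi / 2) = ereal d"
        using indicator_upper_finite[OF weight Cartwright_bounded_uminus[OF Pa_Cartwright[OF \<psi>Pa]]]
        unfolding indicator_fun_uminus by blast
      have "ind_lower J \<le> ereal (- d)" using lo unfolding d by (simp add: ereal_le_uminus_swap)
      also have "ereal (- d) < ereal (- (d - e))" using e by simp
      finally obtain f where f: "f \<in> J" "f \<noteq> (\<lambda>z. 0)" "- indicator_fun f (- pi / 2) < ereal (- (d - e))"
        unfolding ind_lower_def INF_less_iff by blast
      have "ereal (d - e) < indicator_fun f (- pi / 2)"
        using f(3) by (metis ereal_minus_less_minus uminus_ereal.simps(1))
      then have "ereal (d - e) + ereal e \<le> indicator_fun f (- pi / 2) + ereal e" by (intro add_right_mono) simp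
      then have "indicator_fun \<psi> (- pi / 2) \<le> indicator_fun f (- pi / 2) + ereal e" unfolding d by simp
      then show ?thesis using f ind[OF f(1) _ e] by blast
    qed
  qed
qed

text \<open>All products \<open>\<theta> ^ n * \<phi>\<close> lie in \<open>J\<close>: if \<open>F = \<theta> ^ n * \<phi>\<close> does, then \<open>\<theta> * F = \<Phi> F \<psi>\<close> lies in the same
  step as \<open>F\<close> and \<open>\<psi>\<close> and is therefore an element of \<open>J_gen \<omega> r c \<phi>\<close>.  Their norms grow at most
  geometrically in \<open>n\<close>, which bounds \<open>\<theta>\<close>.\<close>

lemma quotient_constant:
  assumes \<psi>: "\<psi> \<in> zeros_indicator_module (zero_mult J) (ind_lower J) (ind_upper J)"
    and \<phi>: "\<phi> \<in> J" "\<phi> \<noteq> (\<lambda>z. 0)" "J_gen \<omega> r c \<phi> \<subseteq> J"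
  shows "\<exists>\<kappa>. \<forall>l. \<Phi> \<phi> \<psi> l = \<kappa> * \<phi> l"
proof -
  have \<psi>Pa: "\<psi> \<in> Pa \<omega> r c" and van: "\<And>\<mu> j. j < zero_mult J \<mu> \<Longrightarrow> (deriv ^^ j) \<psi> \<mu> = 0"
    using \<psi> by (auto simp: zeros_indicator_module_def)
  obtain \<theta> where \<theta>: "\<theta> holomorphic_on UNIV" "\<And>f z. f \<in> J \<Longrightarrow> \<Phi> f \<psi> z = \<theta> z * f z"
    using exists_quotient[OF \<psi>Pa van] by blast
  have mt: "minimal_type \<theta>" by (rule quotient_is_minimal_type[OF \<psi> \<theta>])
  obtain k where k: "\<phi> \<in> Pk \<omega> r c k" "\<psi> \<in> Pk \<omega> r c k" using Pa_common[OF J_Pa[OF \<phi>(1)] \<psi>Pa] by blast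
  obtain A0 where A0: "0 \<le> A0" "\<And>f. f \<in> Pk \<omega> r c k \<Longrightarrow> \<Phi> f \<psi> \<in> Pk \<omega> r c k \<and>
     Pk_norm \<omega> r c k (\<Phi> f \<psi>) \<le> A0 * Pk_norm \<omega> r c k \<psi> * Pk_norm \<omega> r c k f"
    using \<Phi>_Pk[of k] k(2) by blast
  define A where "A = A0 * Pk_norm \<omega> r c k \<psi>"
  have A: "0 \<le> A" using A0(1) Pk_norm_nonneg[OF k(2)] by (simp add: A_def)
  define F where "F n = (\<lambda>z. \<theta> z ^ n * \<phi> z)" for n :: nat
  have FJ: "F n \<in> J \<and> F n \<in> Pk \<omega> r c k \<and> Pk_norm \<omega> r c k (F n) \<le> A ^ n * Pk_norm \<omega> r c k \<phi>" for n
  proof (induction n)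
    case 0
    then show ?case using \<phi> k by (simp add: F_def)
  next
    case (Suc n)
    have eq: "F (Suc n) = \<Phi> (F n) \<psi>" using \<theta>(2)[of "F n"] Suc by (auto simp: F_def)
    have Pk: "F (Suc n) \<in> Pk \<omega> r c k" unfolding eq using A0(2) Suc by blast
    then have "F (Suc n) \<in> J_gen \<omega> r c \<phi>"
      unfolding J_gen_def using minimal_type_power[OF mt, of "Suc n"] by (auto simp: Pa_def F_def)
    moreover have "Pk_norm \<omega> r c k (F (Suc n)) \<le> A * Pk_norm \<omega> r c k (F n)"
      unfolding eq A_def using A0(2) Suc by blast
    then have "Pk_norm \<omega> r c k (F (Suc n)) \<le> A * (A ^ n * Pk_norm \<omega> r c k \<phi>)"
      using Suc A by (meson mult_left_mono order_trans)
    ultimately show ?case using \<phi>(3) Pk by (auto simp: mult.assoc)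
  qed
  have bound: "norm (\<theta> z) \<le> A" if z: "\<phi> z \<noteq> 0" for z
  proof (rule ccontr)
    assume "\<not> norm (\<theta> z) \<le> A"
    then have gt: "A < norm (\<theta> z)" by simp
    define q where "q = A / norm (\<theta> z)"
    have t0: "0 < norm (\<theta> z)" using gt A by linarith
    have q: "0 \<le> q" "q < 1" using gt A t0 by (auto simp: q_def)
    define E where "E = Pk_norm \<omega> r c k \<phi> * exp (wt k z)"
    have "norm (\<phi> z) \<le> q ^ n * E" for n
    proof -
      have "norm (\<theta> z) ^ n * norm (\<phi> z) = norm (F n z)" by (simp add: F_def norm_mult norm_power)
      also have "\<dots> \<le> Pk_norm \<omega> r c k (F n) * exp (wt k z)" using FJ by (intro Pk_norm_bound) blast
      also have "\<dots> \<le> (A ^ n * Pk_norm \<omega> r c k \<phi>) * exp (wt k z)" using FJ by (intro mult_right_mono) auto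
      finally have "norm (\<theta> z) ^ n * norm (\<phi> z) \<le> A ^ n * E" by (simp add: E_def mult.assoc)
      then show ?thesis using t0 by (simp add: q_def power_divide field_simps)
    qed
    moreover have "(\<lambda>n. q ^ n * E) \<longlonglongrightarrow> 0 * E" using q by (intro tendsto_intros LIMSEQ_power_zero) auto
    ultimately have "norm (\<phi> z) \<le> 0 * E" by (intro tendsto_lowerbound[of _ _ sequentially]) (auto intro: always_eventually)
    then show False using z by simp
  qed
  have bound': "norm (\<theta> z) \<le> A" for z
  proof (cases "\<phi> z = 0")
    case True
    obtain b where b: "\<phi> b \<noteq> 0" using \<phi>(2) by auto
    obtain d where d: "0 < d" "\<And>w. w \<in> ball z d - {z} \<Longrightarrow> \<phi> w \<noteq> 0"
      by (rule isolated_zeros[OF Pa_holomorphic[OF J_Pa[OF \<phi>(1)]] open_UNIV connected_UNIV UNIV_I True UNIV_I b]) (rule that)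
    have "isCont \<theta> z" using holomorphic_on_imp_continuous_on[OF \<theta>(1)] by (simp add: continuous_on_eq_continuous_at)
    then have "(\<theta> \<longlongrightarrow> \<theta> z) (at z)" by (simp add: isCont_def)
    moreover have "\<forall>\<^sub>F w in at z. norm (\<theta> w) \<le> A"
      unfolding eventually_at using d bound by (intro exI[of _ d]) (auto simp: dist_commute)
    ultimately show ?thesis by (intro tendsto_upperbound[OF tendsto_norm]) auto
  qed (rule bound)
  then have "bounded (range \<theta>)" by (auto simp: bounded_iff)
  then have "\<theta> constant_on UNIV" by (rule Liouville_theorem[OF \<theta>(1)])
  then obtain \<kappa> where "\<And>z. \<theta> z = \<kappa>" unfolding constant_on_def by auto
  then show ?thesis using \<theta>(2)[OF \<phi>(1)] by auto
qed

text \<open>The quotients for \<open>\<psi>\<close> and \<open>z * \<psi>\<close> are related by \<open>\<theta>' = z * \<theta> + S \<psi>\<close>.  As both are constant,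
  \<open>\<theta> = 0\<close>; the same holds for \<open>\<theta>'\<close>, and so \<open>S \<psi> = 0\<close>.\<close>

lemma S_eq_0:
  assumes \<psi>: "\<psi> \<in> zeros_indicator_module (zero_mult J) (ind_lower J) (ind_upper J)"
    and \<phi>: "\<phi> \<in> J" "\<phi> \<noteq> (\<lambda>z. 0)" "J_gen \<omega> r c \<phi> \<subseteq> J"
  shows "S \<psi> = 0"
proof -
  define K where "K = zeros_indicator_module (zero_mult J) (ind_lower J) (ind_upper J)"
  have shift: "(\<lambda>z. z * \<psi> z) \<in> K" if "\<psi> \<in> K" for \<psi>
  proof -
    have "(\<lambda>z. poly [:0, 1:] z * \<psi> z) \<in> K"
      using closed_submodule_zeros_indicator_module that unfolding closed_submodule_def K_def by blast
    then show ?thesis by simp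
  qed
  have zero: "\<Phi> \<phi> \<psi> l = 0" if \<psi>: "\<psi> \<in> K" for \<psi> l
  proof -
    obtain \<kappa> where \<kappa>: "\<And>l. \<Phi> \<phi> \<psi> l = \<kappa> * \<phi> l" using quotient_constant[OF _ \<phi>] \<psi> unfolding K_def by blast
    obtain \<kappa>' where \<kappa>': "\<And>l. \<Phi> \<phi> (\<lambda>z. z * \<psi> z) l = \<kappa>' * \<phi> l"
      using quotient_constant[OF _ \<phi>] shift[OF \<psi>] unfolding K_def by blast
    have "\<psi> \<in> Pa \<omega> r c" using \<psi> by (simp add: K_def zeros_indicator_module_def)
    then have "(l * \<kappa> + S \<psi>) * \<phi> l = \<kappa>' * \<phi> l" for l
      using \<Phi>_times_id[of \<psi> \<phi> l] \<kappa> \<kappa>' by (simp add: algebra_simps)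
    then have "l * \<kappa> + S \<psi> = \<kappa>'" for l
      by (intro entire_mult_cancel[where F = "\<lambda>l. l * \<kappa> + S \<psi>" and G = "\<lambda>l. \<kappa>'", OF _ _ Pa_holomorphic[OF J_Pa[OF \<phi>(1)]] \<phi>(2)])
         (auto intro!: holomorphic_intros)
    from this[of 0] this[of 1] have "\<kappa> = 0" by simp
    then show "\<Phi> \<phi> \<psi> l = 0" by (simp add: \<kappa>)
  qed
  obtain a where a: "\<phi> a \<noteq> 0" using \<phi>(2) by auto
  have \<psi>K: "\<psi> \<in> K" using \<psi> by (simp add: K_def)
  have "\<psi> \<in> Pa \<omega> r c" using \<psi> by (simp add: zeros_indicator_module_def)
  then have "S \<psi> * \<phi> a = 0"
    using \<Phi>_times_id[of \<psi> \<phi> a] zero[OF \<psi>K] zero[OF shift[OF \<psi>K]] by simp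
  then show ?thesis using a by simp
qed

end

section \<open>Weak localisability\<close>

theorem theorem3p1:
  fixes \<omega> :: "real \<Rightarrow> real" and a :: ereal and c r :: "nat \<Rightarrow> real"
    and J :: "(complex \<Rightarrow> complex) set"
  assumes "admissible_weight \<omega>"
    and "0 < a"
    and "incseq c" and "\<And>k. 0 < c k" and "\<And>k. ereal (c k) < a"
    and "(\<lambda>k. ereal (c k)) \<longlonglongrightarrow> a"
    and "incseq r" and "\<And>k. 0 < r k" and "\<And>k. r k < 1" and "r \<longlonglongrightarrow> 1"
    and "closed_submodule \<omega> r c J" and "J \<noteq> {\<lambda>z. 0}"
    and "stable_submodule J"
  shows "weakly_localisable \<omega> r c J \<longleftrightarrow>
    (\<exists>\<phi>\<in>J. \<phi> \<noteq> (\<lambda>z. 0) \<and> J_gen \<omega> r c \<phi> \<subseteq> J)"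
proof -
  interpret weighted_space \<omega> r c
    by unfold_locales (fact assms)+
  show ?thesis
  proof
    assume "weakly_localisable \<omega> r c J"
    then show "\<exists>\<phi>\<in>J. \<phi> \<noteq> (\<lambda>z. 0) \<and> J_gen \<omega> r c \<phi> \<subseteq> J"
      using closed_submodule_nonzero[OF assms(11,12)] weakly_localisable_imp_J_gen_subset by blast
  next
    assume "\<exists>\<phi>\<in>J. \<phi> \<noteq> (\<lambda>z. 0) \<and> J_gen \<omega> r c \<phi> \<subseteq> J"
    then obtain \<phi> where \<phi>: "\<phi> \<in> J" "\<phi> \<noteq> (\<lambda>z. 0)" "J_gen \<omega> r c \<phi> \<subseteq> J" by blast
    have "K \<subseteq> J" if K: "closed_submodule \<omega> r c K" "zero_mult K = zero_mult J" "ind_lower K = ind_lower J" "ind_upper K = ind_upper J" for K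
    proof
      fix \<psi> assume \<psi>: "\<psi> \<in> K"
      show "\<psi> \<in> J"
      proof (rule ccontr)
        assume nJ: "\<psi> \<notin> J"
        have mem: "\<psi> \<in> zeros_indicator_module (zero_mult J) (ind_lower J) (ind_upper J)"
          using subset_zeros_indicator_module[OF closed_submodule_subset_Pa[OF K(1)]] \<psi> unfolding K(2-4) by blast
        then have \<psi>Pa: "\<psi> \<in> Pa \<omega> r c" by (simp add: zeros_indicator_module_def)
        obtain S where S: "\<And>f g \<alpha> \<beta>. f \<in> Pa \<omega> r c \<Longrightarrow> g \<in> Pa \<omega> r c \<Longrightarrow> S (\<lambda>z. \<alpha> * f z + \<beta> * g z) = \<alpha> * S f + \<beta> * S g"
          "\<And>k. \<exists>C\<ge>0. \<forall>f\<in>Pk \<omega> r c k. norm (S f) \<le> C * Pk_norm \<omega> r c k f"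
          "\<And>f. f \<in> J \<Longrightarrow> S f = 0" "S \<psi> \<noteq> (0::complex)"
          using separating_functional[OF assms(11) \<psi>Pa nJ] by blast
        interpret annihilated_stable_submodule \<omega> r c S J
          by unfold_locales (fact S assms)+
        show False using S_eq_0[OF mem \<phi>] S(4) by simp
      qed
    qed
    then show "weakly_localisable \<omega> r c J"
      unfolding weakly_localisable_def using assms(11,12) by blast
  qed
qed

end
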